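(* Let $\{\psi_\nu\}_{\nu\in\nabla}$ be an orthonormal (wavelet) basis of $L_2(0,1)$ such that $\{2^{-2|\nu|}\psi_\nu\}_{\nu\in\nabla}$ is a Riesz basis of $H^2(0,1)\cap H^1_0(0,1)$. Let $d\in\mathbb{N}$, let $M=(m_{ij})\in\mathbb{R}^{d\times d}$ be a constant, symmetric positive definite, diagonally dominant matrix, and let the infinite matrices $\mathbf{T}$ and $\mathbf{S}$ (indexed by $\nabla^d\times\nabla^d$) be defined as in the context. Then $\mathbf{S}^{-2}\mathbf{T}$ is an isomorphism from $\ell_2(\nabla^d)$ onto itself; that is, it maps $\ell_2(\nabla^d)$ bijectively onto $\ell_2(\nabla^d)$ and there exist constants $0<c\le C<\infty$ such that $$c\,\|\mathbf{v}\|\le \|\mathbf{S}^{-2}\mathbf{T}\mathbf{v}\|\le C\,\|\mathbf{v}\|,\qquad \mathbf{v}\in\ell_2(\nabla^d).$$ Moreover, when $M$ is diagonal and the weights satisfy $\hat\omega_{i,\nu_i}\sim\sqrt{m_{ii}}\,2^{|\nu_i|}$ for $i=1,\dots,d$, $\nu_i\in\nabla$ (with equivalence constants independent of $i,\nu_i$ and $d$), the constants $c,C$ are independent of the spatial dimension $d$ (for a fixed univariate basis $\{\psi_\nu\}$ and a family of such matrices $M=M^{(d)}$ indexed by $d$).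
   Context: $\nabla$ is a countable index set; each $\nu\in\nabla$ has a level $|\nu|\in\mathbb{N}_0$. $\Omega=(0,1)^d$. For $\nu=(\nu_1,\dots,\nu_d)\in\nabla^d$ put $\Psi_\nu=\psi_{\nu_1}\otimes\cdots\otimes\psi_{\nu_d}$, so that $\{\Psi_\nu\}$ is an orthonormal basis of $L_2(\Omega)$. $\|\cdot\|$ is the norm of $\ell_2(\nabla^d)$. The operator is $Au=-\sum_{i,j=1}^d m_{ij}\partial_i\partial_j u$ with homogeneous Dirichlet boundary conditions, i.e. $\langle Au,v\rangle=\int_\Omega M\nabla u\cdot\nabla v\,dx$ for $u,v\in H^1_0(\Omega)$, and $$\mathbf{T}=\bigl(\langle\Psi_\mu,A\Psi_\nu\rangle\bigr)_{\mu,\nu\in\nabla^d}.$$ Scaling: for $i=1,\dots,d$ choose weights $\hat\omega_{i,\nu_i}>0$, $\nu_i\in\nabla$, with $\hat\omega_{i,\nu_i}\sim 2^{|\nu_i|}$ with uniform constants. Set $\omega_\nu=\bigl(\sum_{i=1}^d\hat\omega_{i,\nu_i}^2\bigr)^{1/2}$ for $\nu\in\nabla^d$ and let $\mathbf{S}=(\omega_\nu\delta_{\nu,\mu})_{\nu,\mu\in\nabla^d}$, so that $\mathbf{S}^{-2}$ is the diagonal matrix with entries $\omega_\nu^{-2}$. Here $a\sim b$ means that $a/b$ is bounded above and below by positive constants. *)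

theory Defs
  imports "HOL-Analysis.Analysis"
begin

text \<open>
  The dimension \<open>d\<close> is a natural number that the theorem quantifies over, so
  points of \<open>\<real>\<^sup>d\<close> and multi-indices are functions on the index set \<open>{..<d}\<close>
  (coordinates \<open>0, \<dots>, d - 1\<close>), extensional outside it. Elements of
  \<open>L\<^sub>2\<close> and of Sobolev spaces are represented by functions; values outside
  the domain are irrelevant, and functions that agree almost everywhere are not identified.
\<close>

section \<open>Square integrable functions\<close>

definition sq_integrable :: "'a measure \<Rightarrow> ('a \<Rightarrow> real) set" where
  "sq_integrable \<Omega> = {f. f \<in> borel_measurable \<Omega> \<and> integrable \<Omega> (\<lambda>x. (f x)\<^sup>2)}"

definition L2_inner :: "'a measure \<Rightarrow> ('a \<Rightarrow> real) \<Rightarrow> ('a \<Rightarrow> real) \<Rightarrow> real" where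
  "L2_inner \<Omega> f g = (\<integral>x. f x * g x \<partial>\<Omega>)"

definition L2_nrm :: "'a measure \<Rightarrow> ('a \<Rightarrow> real) \<Rightarrow> real" where
  "L2_nrm \<Omega> f = sqrt (L2_inner \<Omega> f f)"

section \<open>Bases in spaces of functions\<close>

definition lin_comb :: "'i set \<Rightarrow> ('i \<Rightarrow> real) \<Rightarrow> ('i \<Rightarrow> 'a \<Rightarrow> real) \<Rightarrow> 'a \<Rightarrow> real" where
  "lin_comb F a b = (\<lambda>x. \<Sum>\<nu>\<in>F. a \<nu> * b \<nu> x)"

definition dense_span ::
    "('a \<Rightarrow> real) set \<Rightarrow> (('a \<Rightarrow> real) \<Rightarrow> real) \<Rightarrow> ('i \<Rightarrow> 'a \<Rightarrow> real) \<Rightarrow> bool" where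
  "dense_span H nrm b \<longleftrightarrow>
     (\<forall>f\<in>H. \<forall>\<epsilon>>0. \<exists>F a. finite F \<and> nrm (\<lambda>x. f x - lin_comb F a b x) < \<epsilon>)"

definition orthonormal_basis_L2 :: "'a measure \<Rightarrow> ('i \<Rightarrow> 'a \<Rightarrow> real) \<Rightarrow> bool" where
  "orthonormal_basis_L2 \<Omega> b \<longleftrightarrow>
     (\<forall>\<nu>. b \<nu> \<in> sq_integrable \<Omega>) \<and>
     (\<forall>\<mu> \<nu>. L2_inner \<Omega> (b \<mu>) (b \<nu>) = (if \<mu> = \<nu> then 1 else 0)) \<and>
     dense_span (sq_integrable \<Omega>) (L2_nrm \<Omega>) b"

definition riesz_basis ::
    "('a \<Rightarrow> real) set \<Rightarrow> (('a \<Rightarrow> real) \<Rightarrow> real) \<Rightarrow> ('i \<Rightarrow> 'a \<Rightarrow> real) \<Rightarrow> bool" where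
  "riesz_basis H nrm b \<longleftrightarrow>
     (\<forall>\<nu>. b \<nu> \<in> H) \<and>
     dense_span H nrm b \<and>
     (\<exists>c>0. \<exists>C>0. \<forall>F a. finite F \<longrightarrow>
        c * (\<Sum>\<nu>\<in>F. (a \<nu>)\<^sup>2) \<le> (nrm (lin_comb F a b))\<^sup>2 \<and>
        (nrm (lin_comb F a b))\<^sup>2 \<le> C * (\<Sum>\<nu>\<in>F. (a \<nu>)\<^sup>2))"

section \<open>Sobolev spaces on the unit interval\<close>

definition unit_ivl :: "real measure" where
  "unit_ivl = restrict_space lborel {0<..<1}"

definition test_fun1 :: "(real \<Rightarrow> real) set" where
  "test_fun1 = {\<phi>. (\<forall>k x. ((deriv ^^ k) \<phi>) differentiable (at x)) \<and>
     (\<exists>K. compact K \<and> K \<subseteq> {0<..<1} \<and> (\<forall>x. x \<notin> K \<longrightarrow> \<phi> x = 0))}"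

definition is_weak_deriv :: "(real \<Rightarrow> real) \<Rightarrow> (real \<Rightarrow> real) \<Rightarrow> bool" where
  "is_weak_deriv u g \<longleftrightarrow>
     (\<forall>\<phi>\<in>test_fun1. (\<integral>x. u x * deriv \<phi> x \<partial>unit_ivl) = - (\<integral>x. g x * \<phi> x \<partial>unit_ivl))"

text \<open>A representative of the (almost everywhere unique) weak derivative, when there is one
  in \<open>L\<^sub>2(0,1)\<close>.\<close>
definition weak_deriv :: "(real \<Rightarrow> real) \<Rightarrow> real \<Rightarrow> real" where
  "weak_deriv u = (SOME g. g \<in> sq_integrable unit_ivl \<and> is_weak_deriv u g)"

definition H1_ivl :: "(real \<Rightarrow> real) set" where
  "H1_ivl = {u \<in> sq_integrable unit_ivl. \<exists>g \<in> sq_integrable unit_ivl. is_weak_deriv u g}"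

definition H1_nrm :: "(real \<Rightarrow> real) \<Rightarrow> real" where
  "H1_nrm u = sqrt ((L2_nrm unit_ivl u)\<^sup>2 + (L2_nrm unit_ivl (weak_deriv u))\<^sup>2)"

definition H10_ivl :: "(real \<Rightarrow> real) set" where
  "H10_ivl = {u \<in> H1_ivl. \<forall>\<epsilon>>0. \<exists>\<phi>\<in>test_fun1. H1_nrm (\<lambda>x. u x - \<phi> x) < \<epsilon>}"

definition H2_ivl :: "(real \<Rightarrow> real) set" where
  "H2_ivl = {u \<in> H1_ivl. weak_deriv u \<in> H1_ivl}"

definition H2_nrm :: "(real \<Rightarrow> real) \<Rightarrow> real" where
  "H2_nrm u = sqrt ((L2_nrm unit_ivl u)\<^sup>2 + (L2_nrm unit_ivl (weak_deriv u))\<^sup>2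
                    + (L2_nrm unit_ivl (weak_deriv (weak_deriv u)))\<^sup>2)"

section \<open>Weak partial derivatives on the unit cube\<close>

definition Rd :: "nat \<Rightarrow> (nat \<Rightarrow> real) set" where
  "Rd d = (\<Pi>\<^sub>E i\<in>{..<d}. UNIV)"

definition unit_cube :: "nat \<Rightarrow> (nat \<Rightarrow> real) measure" where
  "unit_cube d = (\<Pi>\<^sub>M i\<in>{..<d}. unit_ivl)"

definition partial :: "nat \<Rightarrow> ((nat \<Rightarrow> real) \<Rightarrow> real) \<Rightarrow> (nat \<Rightarrow> real) \<Rightarrow> real" where
  "partial i \<phi> x = deriv (\<lambda>t. \<phi> (x(i := t))) (x i)"

text \<open>\<open>C\<^sup>\<infinity>(\<real>\<^sup>d)\<close>: all iterated partial derivatives \<open>foldr partial is \<phi>\<close> exist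
  and are continuous. On \<open>Rd d\<close> the product topology is the Euclidean one.\<close>
definition smooth_Rd :: "nat \<Rightarrow> ((nat \<Rightarrow> real) \<Rightarrow> real) \<Rightarrow> bool" where
  "smooth_Rd d \<phi> \<longleftrightarrow> (\<forall>is. set is \<subseteq> {..<d} \<longrightarrow>
     continuous_on (Rd d) (foldr partial is \<phi>) \<and>
     (\<forall>i<d. \<forall>x\<in>Rd d. (\<lambda>t. foldr partial is \<phi> (x(i := t))) differentiable (at (x i))))"

definition test_fun :: "nat \<Rightarrow> ((nat \<Rightarrow> real) \<Rightarrow> real) set" where
  "test_fun d = {\<phi>. smooth_Rd d \<phi> \<and>
     (\<exists>K. compact K \<and> K \<subseteq> (\<Pi>\<^sub>E i\<in>{..<d}. {0<..<1}) \<and> (\<forall>x\<in>Rd d. x \<notin> K \<longrightarrow> \<phi> x = 0))}"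

definition is_weak_partial ::
    "nat \<Rightarrow> nat \<Rightarrow> ((nat \<Rightarrow> real) \<Rightarrow> real) \<Rightarrow> ((nat \<Rightarrow> real) \<Rightarrow> real) \<Rightarrow> bool" where
  "is_weak_partial d i u g \<longleftrightarrow>
     (\<forall>\<phi>\<in>test_fun d.
        (\<integral>x. u x * partial i \<phi> x \<partial>unit_cube d) = - (\<integral>x. g x * \<phi> x \<partial>unit_cube d))"

definition weak_partial ::
    "nat \<Rightarrow> nat \<Rightarrow> ((nat \<Rightarrow> real) \<Rightarrow> real) \<Rightarrow> (nat \<Rightarrow> real) \<Rightarrow> real" where
  "weak_partial d i u = (SOME g. g \<in> sq_integrable (unit_cube d) \<and> is_weak_partial d i u g)"

section \<open>The operator and its matrix\<close>

text \<open>\<open>\<langle>A u, v\<rangle> = \<integral>\<^sub>\<Omega> M \<nabla>u \<cdot> \<nabla>v dx\<close>\<close>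
definition form_A :: "nat \<Rightarrow> (nat \<Rightarrow> nat \<Rightarrow> real) \<Rightarrow>
    ((nat \<Rightarrow> real) \<Rightarrow> real) \<Rightarrow> ((nat \<Rightarrow> real) \<Rightarrow> real) \<Rightarrow> real" where
  "form_A d M u v =
     (\<integral>x. (\<Sum>i<d. (\<Sum>j<d. M i j * weak_partial d j u x) * weak_partial d i v x) \<partial>unit_cube d)"

definition multi_idx :: "nat \<Rightarrow> (nat \<Rightarrow> 'i) set" where
  "multi_idx d = (\<Pi>\<^sub>E i\<in>{..<d}. UNIV)"

definition tensor_basis ::
    "nat \<Rightarrow> ('i \<Rightarrow> real \<Rightarrow> real) \<Rightarrow> (nat \<Rightarrow> 'i) \<Rightarrow> (nat \<Rightarrow> real) \<Rightarrow> real" where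
  "tensor_basis d \<psi> \<nu> x = (\<Prod>i<d. \<psi> (\<nu> i) (x i))"

definition matrix_T :: "nat \<Rightarrow> ('i \<Rightarrow> real \<Rightarrow> real) \<Rightarrow> (nat \<Rightarrow> nat \<Rightarrow> real) \<Rightarrow>
    (nat \<Rightarrow> 'i) \<Rightarrow> (nat \<Rightarrow> 'i) \<Rightarrow> real" where
  "matrix_T d \<psi> M \<mu> \<nu> = form_A d M (tensor_basis d \<psi> \<nu>) (tensor_basis d \<psi> \<mu>)"

definition omega :: "nat \<Rightarrow> (nat \<Rightarrow> 'i \<Rightarrow> real) \<Rightarrow> (nat \<Rightarrow> 'i) \<Rightarrow> real" where
  "omega d w \<nu> = sqrt (\<Sum>i<d. (w i (\<nu> i))\<^sup>2)"

definition matrix_S_inv2 ::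
    "nat \<Rightarrow> (nat \<Rightarrow> 'i \<Rightarrow> real) \<Rightarrow> (nat \<Rightarrow> 'i) \<Rightarrow> (nat \<Rightarrow> 'i) \<Rightarrow> real" where
  "matrix_S_inv2 d w \<mu> \<nu> = (if \<mu> = \<nu> then inverse ((omega d w \<nu>)\<^sup>2) else 0)"

section \<open>Infinite matrices acting on \<open>\<ell>\<^sub>2(J)\<close>\<close>

text \<open>Vectors indexed by \<open>J\<close> are functions that vanish outside \<open>J\<close>, so that
  equality in \<open>\<ell>\<^sub>2(J)\<close> is equality of functions.\<close>
definition l2 :: "'k set \<Rightarrow> ('k \<Rightarrow> real) set" where
  "l2 J = {v. (\<forall>\<nu>. \<nu> \<notin> J \<longrightarrow> v \<nu> = 0) \<and> (\<lambda>\<nu>. (v \<nu>)\<^sup>2) summable_on J}"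

definition l2_nrm :: "'k set \<Rightarrow> ('k \<Rightarrow> real) \<Rightarrow> real" where
  "l2_nrm J v = sqrt (\<Sum>\<^sub>\<infinity>\<nu>\<in>J. (v \<nu>)\<^sup>2)"

definition imat_mult ::
    "'k set \<Rightarrow> ('k \<Rightarrow> 'k \<Rightarrow> real) \<Rightarrow> ('k \<Rightarrow> 'k \<Rightarrow> real) \<Rightarrow> 'k \<Rightarrow> 'k \<Rightarrow> real" where
  "imat_mult J A B \<mu> \<nu> = (\<Sum>\<^sub>\<infinity>\<kappa>\<in>J. A \<mu> \<kappa> * B \<kappa> \<nu>)"

definition imat_vec :: "'k set \<Rightarrow> ('k \<Rightarrow> 'k \<Rightarrow> real) \<Rightarrow> ('k \<Rightarrow> real) \<Rightarrow> 'k \<Rightarrow> real" where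
  "imat_vec J A v \<mu> = (if \<mu> \<in> J then \<Sum>\<^sub>\<infinity>\<nu>\<in>J. A \<mu> \<nu> * v \<nu> else 0)"

definition l2_bounds :: "'k set \<Rightarrow> ('k \<Rightarrow> 'k \<Rightarrow> real) \<Rightarrow> real \<Rightarrow> real \<Rightarrow> bool" where
  "l2_bounds J A c C \<longleftrightarrow>
     (\<forall>v\<in>l2 J. c * l2_nrm J v \<le> l2_nrm J (imat_vec J A v) \<and>
               l2_nrm J (imat_vec J A v) \<le> C * l2_nrm J v)"

text \<open>The summability clause says that the products \<open>A v\<close> are genuinely convergent;
  \<open>infsum\<close> is \<open>0\<close> by convention otherwise.\<close>
definition l2_isomorphism :: "'k set \<Rightarrow> ('k \<Rightarrow> 'k \<Rightarrow> real) \<Rightarrow> bool" where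
  "l2_isomorphism J A \<longleftrightarrow>
     (\<forall>v\<in>l2 J. \<forall>\<mu>\<in>J. (\<lambda>\<nu>. A \<mu> \<nu> * v \<nu>) summable_on J) \<and>
     bij_betw (imat_vec J A) (l2 J) (l2 J) \<and>
     (\<exists>c C. 0 < c \<and> c \<le> C \<and> l2_bounds J A c C)"

section \<open>Conditions on the coefficients and the weights\<close>

definition sym_pos_def :: "nat \<Rightarrow> (nat \<Rightarrow> nat \<Rightarrow> real) \<Rightarrow> bool" where
  "sym_pos_def d M \<longleftrightarrow>
     (\<forall>i<d. \<forall>j<d. M i j = M j i) \<and>
     (\<forall>x :: nat \<Rightarrow> real. (\<exists>i<d. x i \<noteq> 0) \<longrightarrow> 0 < (\<Sum>i<d. \<Sum>j<d. x i * M i j * x j))"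

definition diag_dominant :: "nat \<Rightarrow> (nat \<Rightarrow> nat \<Rightarrow> real) \<Rightarrow> bool" where
  "diag_dominant d M \<longleftrightarrow> (\<forall>i<d. (\<Sum>j\<in>{..<d} - {i}. \<bar>M i j\<bar>) \<le> \<bar>M i i\<bar>)"

definition is_diagonal :: "nat \<Rightarrow> (nat \<Rightarrow> nat \<Rightarrow> real) \<Rightarrow> bool" where
  "is_diagonal d M \<longleftrightarrow> (\<forall>i<d. \<forall>j<d. i \<noteq> j \<longrightarrow> M i j = 0)"

text \<open>\<open>a \<sim> b\<close> with constants uniform over \<open>X\<close>, for positive \<open>b\<close>.\<close>
definition unif_equiv :: "'x set \<Rightarrow> ('x \<Rightarrow> real) \<Rightarrow> ('x \<Rightarrow> real) \<Rightarrow> bool" where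
  "unif_equiv X a b \<longleftrightarrow> (\<exists>k>0. \<exists>K>0. \<forall>x\<in>X. k * b x \<le> a x \<and> a x \<le> K * b x)"

end

theory Submission
  imports Defs
begin

text \<open>
  In coordinates with respect to the orthonormal basis, integration by parts gives
  \<open>\<langle>\<partial>\<^sub>k \<partial>\<^sub>m u, \<partial>\<^sub>i \<partial>\<^sub>i u\<rangle> = \<langle>\<partial>\<^sub>k \<partial>\<^sub>i u, \<partial>\<^sub>m \<partial>\<^sub>i u\<rangle>\<close> for finite combinations \<open>u\<close> of the \<open>\<Psi>\<^sub>\<nu>\<close>.
  For diagonal \<open>M\<close> it turns \<open>\<parallel>A u\<parallel>\<^sup>2\<close> into the sum of the nonnegative terms
  \<open>m\<^sub>i\<^sub>i m\<^sub>j\<^sub>j \<parallel>\<partial>\<^sub>i \<partial>\<^sub>j u\<parallel>\<^sup>2\<close>, each of which factorises into univariate norm equivalences with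
  constants that do not see \<open>d\<close>; the equivalence for first derivatives follows from the given one for
  second derivatives by operator monotonicity of the square root. For general \<open>M\<close> it gives the coercivity
  estimate \<open>\<langle>A u, \<Delta> u\<rangle> \<ge> \<gamma> \<parallel>\<Delta> u\<parallel>\<^sup>2\<close>. So the scaled columns of \<open>\<^bold>T\<close> satisfy two-sided Riesz
  bounds. They are total: for the Laplacian by testing with tensor products of sines, which lie in the
  closure of the finite combinations in the graph norm, and then for \<open>A\<close> by coercivity. Finally
  \<open>\<^bold>S\<^sup>-\<^sup>2 \<^bold>T\<close> is the analysis operator of this Riesz basis.
\<close>

section \<open>The Hilbert space of square summable families\<close>

text \<open>The hypothesis speaks of second derivatives in one variable only, while the mixed terms
  call for first derivatives with weight 2^|\<nu>|. The bounds derived for these carry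
  \<open>c\<close> and \<open>C\<close> unsquared, so a product of two first derivatives costs
  exactly as much as one second derivative. One pair of constants therefore serves all pairs of
  coordinates, and summing over the pairs introduces no power of \<open>d\<close>. Two-sided bounds
  alone give an injective map with closed range. That the map is onto amounts to H^2 regularity of
  the Dirichlet problem on the cube, and explicit eigenfunctions take the place of a regularity
  theorem. For this the Riesz hypothesis is kept not only as norm bounds but also as a statement on
  the closure of the graph of the second derivative, a set of pairs; unbounded operators never
  appear. For nondiagonal \<open>M\<close> the cross terms have no sign, so the operator is compared
  with the Laplacian as a whole, and its constants depend on \<open>M\<close> and
  \<open>d\<close>.\<close>

lemma sq_le_of_quadratic_nonneg:
  fixes a b c :: real
  assumes nonneg: "\<And>t. 0 \<le> a + 2 * t * b + t\<^sup>2 * c" and c: "0 \<le> c"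
  shows "b\<^sup>2 \<le> a * c"
proof (cases "c = 0")
  case True
  then show ?thesis
    \<comment> \<open>With \<open>c = 0\<close> the quadratic is affine in \<open>t\<close> and
      equals -1 at this \<open>t\<close>, unless \<open>b = 0\<close>. In the other case the
      minimiser \<open>- b / c\<close> is inserted.\<close>
    using nonneg[of "- (a + 1) / (2 * b)"] by (cases "b = 0") (simp_all add: field_simps)
next
  case False
  then show ?thesis using nonneg[of "- b / c"] c by (simp add: field_simps power2_eq_square)
qed

text \<open>A type rather than a set, so that inner products, completeness, infinite sums, product
  spaces and the contraction principle come with the type classes. The index set is all of
  \<open>'k\<close>; smaller index sets are treated through supports.\<close>

typedef 'k ell2 = "{f :: 'k \<Rightarrow> real. (\<lambda>\<nu>. (f \<nu>)\<^sup>2) summable_on UNIV}"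
  morphisms coord Abs_ell2
  by (rule exI[of _ "\<lambda>_. 0"]) simp

setup_lifting type_definition_ell2

lemma summable_on_mult_of_sq:
  fixes f g :: "'k \<Rightarrow> real"
  assumes "(\<lambda>\<nu>. (f \<nu>)\<^sup>2) summable_on A" "(\<lambda>\<nu>. (g \<nu>)\<^sup>2) summable_on A"
  shows "(\<lambda>\<nu>. f \<nu> * g \<nu>) summable_on A"
proof (rule abs_summable_summable, rule abs_summable_product)
  show "(\<lambda>i. norm (f i * f i)) summable_on A" "(\<lambda>i. norm (g i * g i)) summable_on A"
    using assms by (simp_all add: power2_eq_square)
qed

lemma summable_on_sq_add:
  fixes f g :: "'k \<Rightarrow> real"
  assumes "(\<lambda>\<nu>. (f \<nu>)\<^sup>2) summable_on A" "(\<lambda>\<nu>. (g \<nu>)\<^sup>2) summable_on A"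
  shows "(\<lambda>\<nu>. (f \<nu> + g \<nu>)\<^sup>2) summable_on A"
proof -
  have "(\<lambda>\<nu>. (f \<nu>)\<^sup>2 + (g \<nu>)\<^sup>2 + 2 * (f \<nu> * g \<nu>)) summable_on A"
    using assms by (intro summable_on_add summable_on_cmult_right summable_on_mult_of_sq)
  then show ?thesis by (simp add: power2_sum algebra_simps)
qed

lemma summable_coord_sq: "(\<lambda>\<nu>. (coord x \<nu>)\<^sup>2) summable_on A"
  using summable_on_subset_banach[of "\<lambda>\<nu>. (coord x \<nu>)\<^sup>2" UNIV A] coord[of x] by simp

lemma summable_coord_mult: "(\<lambda>\<nu>. coord x \<nu> * coord y \<nu>) summable_on A"
  by (intro summable_on_mult_of_sq summable_coord_sq)

lemma ell2_eqI: "(\<And>\<nu>. coord x \<nu> = coord y \<nu>) \<Longrightarrow> x = y"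
  by (metis coord_inject ext)

instantiation ell2 :: (type) real_inner
begin

lift_definition zero_ell2 :: "'a ell2" is "\<lambda>_. 0" by simp
lift_definition plus_ell2 :: "'a ell2 \<Rightarrow> 'a ell2 \<Rightarrow> 'a ell2" is "\<lambda>f g \<nu>. f \<nu> + g \<nu>"
  by (rule summable_on_sq_add)
lift_definition uminus_ell2 :: "'a ell2 \<Rightarrow> 'a ell2" is "\<lambda>f \<nu>. - f \<nu>" by simp
definition minus_ell2 :: "'a ell2 \<Rightarrow> 'a ell2 \<Rightarrow> 'a ell2" where "minus_ell2 x y = x + (- y)"
lift_definition scaleR_ell2 :: "real \<Rightarrow> 'a ell2 \<Rightarrow> 'a ell2" is "\<lambda>c f \<nu>. c * f \<nu>"
  by (simp add: power_mult_distrib summable_on_cmult_right)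
definition inner_ell2 :: "'a ell2 \<Rightarrow> 'a ell2 \<Rightarrow> real" where
  "inner_ell2 x y = (\<Sum>\<^sub>\<infinity>\<nu>. coord x \<nu> * coord y \<nu>)"
definition norm_ell2 :: "'a ell2 \<Rightarrow> real" where "norm_ell2 x = sqrt (inner x x)"
definition sgn_ell2 :: "'a ell2 \<Rightarrow> 'a ell2" where "sgn_ell2 x = scaleR (inverse (norm x)) x"
definition dist_ell2 :: "'a ell2 \<Rightarrow> 'a ell2 \<Rightarrow> real" where "dist_ell2 x y = norm (x - y)"
definition uniformity_ell2 :: "('a ell2 \<times> 'a ell2) filter" where
  "uniformity_ell2 = (INF e\<in>{0 <..}. principal {(x, y). dist x y < e})"
definition open_ell2 :: "'a ell2 set \<Rightarrow> bool" where
  "open_ell2 S = (\<forall>x\<in>S. \<forall>\<^sub>F (x', y) in uniformity. x' = x \<longrightarrow> y \<in> S)"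

lemma coord_simps [simp]:
  "coord 0 \<nu> = 0" "coord (x + y) \<nu> = coord x \<nu> + coord y \<nu>" "coord (- x) \<nu> = - coord x \<nu>"
  "coord (x - y) \<nu> = coord x \<nu> - coord y \<nu>" "coord (scaleR c x) \<nu> = c * coord x \<nu>"
  by (simp_all add: zero_ell2.rep_eq plus_ell2.rep_eq uminus_ell2.rep_eq minus_ell2_def scaleR_ell2.rep_eq)

instance
proof
  fix x y z :: "'a ell2" and a b :: real
  show "x + y + z = x + (y + z)" "x + y = y + x" "0 + x = x" "- x + x = 0" "x - y = x + (- y)"
    "scaleR a (x + y) = scaleR a x + scaleR a y" "scaleR (a + b) x = scaleR a x + scaleR b x"
    "scaleR a (scaleR b x) = scaleR (a * b) x" "scaleR 1 x = x"
    by (simp_all add: ell2_eqI algebra_simps)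
  show "inner x y = inner y x" by (simp add: inner_ell2_def mult.commute)
  show "inner (x + y) z = inner x z + inner y z"
    unfolding inner_ell2_def by (simp add: distrib_right infsum_add summable_coord_mult)
  show "inner (scaleR a x) y = a * inner x y"
    unfolding inner_ell2_def by (simp add: mult.assoc infsum_cmult_right')
  show "0 \<le> inner x x"
    unfolding inner_ell2_def by (intro infsum_nonneg) simp
  show "(inner x x = 0) = (x = 0)"
  proof
    assume "inner x x = 0"
    then have "coord x \<nu> * coord x \<nu> = 0" for \<nu>
      unfolding inner_ell2_def using nonneg_infsum_le_0D[of "\<lambda>\<nu>. coord x \<nu> * coord x \<nu>" UNIV \<nu>]
        summable_coord_mult[of x x UNIV] by simp
    then show "x = 0" by (intro ell2_eqI) simp
  qed (simp add: inner_ell2_def)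
qed (rule norm_ell2_def sgn_ell2_def dist_ell2_def uniformity_ell2_def open_ell2_def)+

end

lemma coord_sum: "coord (\<Sum>i\<in>A. f i) \<nu> = (\<Sum>i\<in>A. coord (f i) \<nu>)"
  by (induction A rule: infinite_finite_induct) auto

lemma norm_ell2_sq: "(norm x)\<^sup>2 = (\<Sum>\<^sub>\<infinity>\<nu>. (coord x \<nu>)\<^sup>2)"
  unfolding power2_norm_eq_inner inner_ell2_def by (simp add: power2_eq_square)

lemma sum_coord_sq_le: "finite F \<Longrightarrow> (\<Sum>\<nu>\<in>F. (coord x \<nu>)\<^sup>2) \<le> (norm x)\<^sup>2"
  unfolding norm_ell2_sq by (intro finite_sum_le_infsum summable_coord_sq) auto

lemma norm_ell2_sq_le:
  assumes "\<And>F. finite F \<Longrightarrow> (\<Sum>\<nu>\<in>F. (coord x \<nu>)\<^sup>2) \<le> b"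
  shows "(norm x)\<^sup>2 \<le> b"
  unfolding norm_ell2_sq by (rule infsum_le_finite_sums[OF summable_coord_sq]) (use assms in auto)

lemma summable_on_sq_bounded:
  fixes f :: "'k \<Rightarrow> real"
  assumes "\<And>F. finite F \<Longrightarrow> (\<Sum>\<nu>\<in>F. (f \<nu>)\<^sup>2) \<le> b"
  shows "(\<lambda>\<nu>. (f \<nu>)\<^sup>2) summable_on UNIV"
  by (rule nonneg_bdd_above_summable_on) (use assms in \<open>auto intro!: bdd_aboveI2[of _ _ b]\<close>)

lemma coord_Abs: "(\<lambda>\<nu>. (f \<nu>)\<^sup>2) summable_on UNIV \<Longrightarrow> coord (Abs_ell2 f) = f"
  by (simp add: Abs_ell2_inverse)

lemma abs_coord_le: "\<bar>coord x \<nu>\<bar> \<le> norm x"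
  using sum_coord_sq_le[of "{\<nu>}" x] by (simp add: abs_le_square_iff[symmetric])

instance ell2 :: (type) complete_space
proof
  fix X :: "nat \<Rightarrow> 'a ell2" assume X: "Cauchy X"
  have "Cauchy (\<lambda>n. coord (X n) \<nu>)" for \<nu>
  proof (rule metric_CauchyI)
    fix e :: real assume "e > 0"
    with X obtain M where M: "\<forall>m\<ge>M. \<forall>n\<ge>M. dist (X m) (X n) < e" using metric_CauchyD by blast
    have "dist (coord (X m) \<nu>) (coord (X n) \<nu>) \<le> dist (X m) (X n)" for m n
      using abs_coord_le[of "X m - X n" \<nu>] by (simp add: dist_real_def dist_norm)
    then have "\<forall>m\<ge>M. \<forall>n\<ge>M. dist (coord (X m) \<nu>) (coord (X n) \<nu>) < e"
      by (intro allI impI order.strict_trans1[OF _ M[rule_format]])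
    then show "\<exists>M. \<forall>m\<ge>M. \<forall>n\<ge>M. dist (coord (X m) \<nu>) (coord (X n) \<nu>) < e" by blast
  qed
  then have "\<exists>l. (\<lambda>n. coord (X n) \<nu>) \<longlonglongrightarrow> l" for \<nu>
    by (simp add: Cauchy_convergent_iff convergent_def)
  then obtain l where l: "(\<lambda>n. coord (X n) \<nu>) \<longlonglongrightarrow> l \<nu>" for \<nu> by metis
  \<comment> \<open>The Cauchy estimate passes to the limit in \<open>m\<close> over each finite set
    \<open>F\<close>, uniformly in \<open>F\<close>; this replaces an exchange of limit and infinite
    sum.\<close>
  have tail: "(\<Sum>\<nu>\<in>F. (coord (X n) \<nu> - l \<nu>)\<^sup>2) \<le> e\<^sup>2"
    if F: "finite F" and M: "\<forall>m\<ge>M. \<forall>n\<ge>M. dist (X m) (X n) < e" and n: "n \<ge> M" for F n M e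
  proof (rule LIMSEQ_le_const2)
    show "(\<lambda>m. \<Sum>\<nu>\<in>F. (coord (X n) \<nu> - coord (X m) \<nu>)\<^sup>2) \<longlonglongrightarrow> (\<Sum>\<nu>\<in>F. (coord (X n) \<nu> - l \<nu>)\<^sup>2)"
      by (intro tendsto_intros l)
    have "(\<Sum>\<nu>\<in>F. (coord (X n) \<nu> - coord (X m) \<nu>)\<^sup>2) \<le> e\<^sup>2" if "m \<ge> M" for m
    proof -
      have "(\<Sum>\<nu>\<in>F. (coord (X n - X m) \<nu>)\<^sup>2) \<le> (norm (X n - X m))\<^sup>2"
        by (rule sum_coord_sq_le[OF F])
      also have "\<dots> \<le> e\<^sup>2"
        using M[rule_format, OF n that] by (intro power_mono) (simp_all add: dist_norm)
      finally show ?thesis by simp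
    qed
    then show "\<exists>N. \<forall>m\<ge>N. (\<Sum>\<nu>\<in>F. (coord (X n) \<nu> - coord (X m) \<nu>)\<^sup>2) \<le> e\<^sup>2" by blast
  qed
  obtain M0 where M0: "\<forall>m\<ge>M0. \<forall>n\<ge>M0. dist (X m) (X n) < 1"
    using metric_CauchyD[OF X zero_less_one] by blast
  have sd: "(\<lambda>\<nu>. (coord (X M0) \<nu> - l \<nu>)\<^sup>2) summable_on UNIV"
    by (rule summable_on_sq_bounded[of _ "1\<^sup>2"], rule tail[OF _ M0 order_refl])
  \<comment> \<open>The coordinatewise limit is square summable as the difference of
    \<open>X M0\<close> and the square summable family \<open>X M0 - l\<close>.\<close>
  have "(\<lambda>\<nu>. (coord (X M0) \<nu> + - (coord (X M0) \<nu> - l \<nu>))\<^sup>2) summable_on UNIV"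
    by (rule summable_on_sq_add[OF summable_coord_sq]) (subst power2_minus, rule sd)
  then have cl: "coord (Abs_ell2 l) = l" by (intro coord_Abs) simp
  have "X \<longlonglongrightarrow> Abs_ell2 l"
  proof (rule metric_LIMSEQ_I)
    fix r :: real assume r: "r > 0"
    obtain M where M: "\<forall>m\<ge>M. \<forall>n\<ge>M. dist (X m) (X n) < r / 2"
      using metric_CauchyD[OF X half_gt_zero[OF r]] by blast
    have "dist (X n) (Abs_ell2 l) < r" if "n \<ge> M" for n
    proof -
      have "(norm (X n - Abs_ell2 l))\<^sup>2 \<le> (r/2)\<^sup>2"
        by (rule norm_ell2_sq_le, simp only: coord_simps cl, rule tail[OF _ M that])
      then have "norm (X n - Abs_ell2 l) \<le> r / 2" by (rule power2_le_imp_le) (use r in simp)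
      then show ?thesis using r by (simp add: dist_norm)
    qed
    then show "\<exists>no. \<forall>n\<ge>no. dist (X n) (Abs_ell2 l) < r" by blast
  qed
  then show "convergent X" by (auto simp: convergent_def)
qed

instance ell2 :: (type) banach ..

lift_definition unit_vec :: "'k \<Rightarrow> 'k ell2" is "\<lambda>\<mu> \<nu>. if \<nu> = \<mu> then 1 else 0"
proof -
  fix \<mu> :: 'k
  have "(\<lambda>\<nu>. (if \<nu> = \<mu> then 1 else 0 :: real)\<^sup>2) summable_on {\<mu>}" by simp
  then show "(\<lambda>\<nu>. (if \<nu> = \<mu> then 1 else 0 :: real)\<^sup>2) summable_on UNIV"
    by (rule summable_on_cong_neutral[THEN iffD1, rotated -1]) auto
qed

lemma coord_unit_vec: "coord (unit_vec \<mu>) \<nu> = (if \<nu> = \<mu> then 1 else 0)"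
  by transfer simp

lemma inner_unit_vec_right: "inner x (unit_vec \<mu>) = coord x \<mu>"
proof -
  have "(\<Sum>\<^sub>\<infinity>\<nu>. coord x \<nu> * coord (unit_vec \<mu>) \<nu>) = (\<Sum>\<^sub>\<infinity>\<nu>\<in>{\<mu>}. coord x \<nu>)"
    by (rule infsum_cong_neutral) (auto simp: coord_unit_vec)
  then show ?thesis by (simp add: inner_ell2_def)
qed

lemma inner_unit_vec_left: "inner (unit_vec \<mu>) x = coord x \<mu>"
  using inner_unit_vec_right[of x \<mu>] by (simp add: inner_commute)

lemma norm_sum_unit_vec:
  assumes "finite F"
  shows "(norm (\<Sum>\<nu>\<in>F. a \<nu> *\<^sub>R unit_vec \<nu>))\<^sup>2 = (\<Sum>\<nu>\<in>F. (a \<nu>)\<^sup>2)"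
  unfolding power2_norm_eq_inner using assms
  by (simp add: inner_sum_right inner_sum_left inner_unit_vec_left coord_unit_vec power2_eq_square
      if_distrib[of "\<lambda>x. _ * x"] cong: if_cong)

text \<open>By Pythagoras the remainder has squared norm \<open>(norm x)\<^sup>2\<close> minus a
  partial sum of squares, so convergence in norm reduces to convergence of a real series.\<close>

lemma has_sum_unit_vec: "((\<lambda>\<nu>. coord x \<nu> *\<^sub>R unit_vec \<nu>) has_sum x) UNIV"
proof -
  have "((\<lambda>F. norm ((\<Sum>\<nu>\<in>F. coord x \<nu> *\<^sub>R unit_vec \<nu>) - x)) \<longlongrightarrow> 0) (finite_subsets_at_top UNIV)"
  proof -
    have eq: "norm ((\<Sum>\<nu>\<in>F. coord x \<nu> *\<^sub>R unit_vec \<nu>) - x) = sqrt ((norm x)\<^sup>2 - (\<Sum>\<nu>\<in>F. (coord x \<nu>)\<^sup>2))"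
      if "finite F" for F
    proof -
      have "(norm ((\<Sum>\<nu>\<in>F. coord x \<nu> *\<^sub>R unit_vec \<nu>) - x))\<^sup>2 =
          (norm (\<Sum>\<nu>\<in>F. coord x \<nu> *\<^sub>R unit_vec \<nu>))\<^sup>2 + (norm x)\<^sup>2
          - 2 * inner (\<Sum>\<nu>\<in>F. coord x \<nu> *\<^sub>R unit_vec \<nu>) x"
        unfolding power2_norm_eq_inner by (simp add: inner_diff_left inner_diff_right inner_commute)
      also have "\<dots> = (norm x)\<^sup>2 - (\<Sum>\<nu>\<in>F. (coord x \<nu>)\<^sup>2)"
        unfolding norm_sum_unit_vec[OF that]
        by (simp add: inner_sum_left inner_unit_vec_left power2_eq_square)
      finally show ?thesis by (metis norm_ge_zero real_sqrt_unique)
    qed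
    have "(sum (\<lambda>\<nu>. (coord x \<nu>)\<^sup>2) \<longlongrightarrow> (norm x)\<^sup>2) (finite_subsets_at_top UNIV)"
      unfolding norm_ell2_sq using summable_coord_sq has_sum_infsum has_sum_def by blast
    then have "((\<lambda>F. sqrt ((norm x)\<^sup>2 - (\<Sum>\<nu>\<in>F. (coord x \<nu>)\<^sup>2))) \<longlongrightarrow> sqrt ((norm x)\<^sup>2 - (norm x)\<^sup>2))
        (finite_subsets_at_top UNIV)"
      by (intro tendsto_intros)
    then show ?thesis
      by (subst tendsto_cong[OF eventually_finite_subsets_at_top_weakI[OF eq]]) auto
  qed
  then show ?thesis
    unfolding has_sum_def by (rule LIM_zero_cancel[OF tendsto_norm_zero_cancel])
qed

section \<open>Riesz families\<close>

lemma bounded_linear_eq_on_unit_vec: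
  fixes f g :: "'k ell2 \<Rightarrow> 'b::real_normed_vector"
  assumes f: "bounded_linear f" and g: "bounded_linear g"
    and eq: "\<And>\<nu>. f (unit_vec \<nu>) = g (unit_vec \<nu>)"
  shows "f x = g x"
proof -
  interpret f: bounded_linear f by fact
  interpret g: bounded_linear g by fact
  have "((\<lambda>\<nu>. f (coord x \<nu> *\<^sub>R unit_vec \<nu>)) has_sum f x) UNIV"
    by (rule has_sum_bounded_linear[OF f has_sum_unit_vec])
  moreover have "((\<lambda>\<nu>. g (coord x \<nu> *\<^sub>R unit_vec \<nu>)) has_sum g x) UNIV"
    by (rule has_sum_bounded_linear[OF g has_sum_unit_vec])
  ultimately show ?thesis by (simp add: f.scaleR g.scaleR eq has_sum_unique)
qed

text \<open>Cauchy criterion for the net of finite partial sums: a block of \<open>f\<close> is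
  controlled by the same block of \<open>g\<close>. The family \<open>f\<close> need not be
  absolutely summable.\<close>

lemma summable_on_of_norm_sq_le:
  fixes f :: "'k \<Rightarrow> 'h::banach" and g :: "'k \<Rightarrow> real"
  assumes g: "g summable_on UNIV" and g0: "\<And>\<nu>. 0 \<le> g \<nu>" and C: "0 < C"
    and le: "\<And>F. finite F \<Longrightarrow> (norm (\<Sum>\<nu>\<in>F. f \<nu>))\<^sup>2 \<le> C * (\<Sum>\<nu>\<in>F. g \<nu>)"
  shows "f summable_on UNIV"
proof -
  have "cauchy_filter (filtermap (sum f) (finite_subsets_at_top UNIV))"
    unfolding cauchy_filter_metric_filtermap
  proof (intro allI impI)
    fix e :: real assume e: "e > 0"
    \<comment> \<open>Chosen so that \<open>C * (2 * \<delta>) = (e / 2)\<^sup>2\<close>.\<close>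
    define \<delta> where "\<delta> = (e / 2)\<^sup>2 / (2 * C)"
    have \<delta>: "\<delta> > 0" using e C by (simp add: \<delta>_def)
    obtain L where L: "(sum g \<longlongrightarrow> L) (finite_subsets_at_top UNIV)"
      using g unfolding summable_on_def has_sum_def by blast
    have "\<forall>\<^sub>F F in finite_subsets_at_top UNIV. dist (sum g F) L < \<delta>"
      by (rule tendstoD[OF L \<delta>])
    then obtain G where G: "finite G" and Gc: "\<And>F. finite F \<Longrightarrow> G \<subseteq> F \<Longrightarrow> dist (sum g F) L < \<delta>"
      by (auto simp: eventually_finite_subsets_at_top)
    have near: "dist (sum f F) (sum f G) < e / 2" if F: "finite F" "G \<subseteq> F" for F
    proof -
      have "(dist (sum f F) (sum f G))\<^sup>2 = (norm (sum f (F - G)))\<^sup>2"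
        unfolding dist_norm using F by (subst sum_diff) auto
      also have "\<dots> \<le> C * sum g (F - G)" by (rule le) (use F in simp)
      also have "sum g (F - G) = sum g F - sum g G" using F by (subst sum_diff) auto
      also have "C * (sum g F - sum g G) < C * (2 * \<delta>)"
        using Gc[OF F] Gc[OF G order_refl] C by (intro mult_strict_left_mono) (auto simp: dist_real_def)
      also have "\<dots> = (e / 2)\<^sup>2" using C by (simp add: \<delta>_def)
      finally show ?thesis by (rule power2_less_imp_less) (use e in simp)
    qed
    show "\<exists>P. eventually P (finite_subsets_at_top UNIV) \<and>
        (\<forall>x y. P x \<and> P y \<longrightarrow> dist (sum f x) (sum f y) < e)"
    proof (intro exI[of _ "\<lambda>F. finite F \<and> G \<subseteq> F"] conjI allI impI)
      show "\<forall>\<^sub>F F in finite_subsets_at_top UNIV. finite F \<and> G \<subseteq> F"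
        using G by (auto simp: eventually_finite_subsets_at_top)
      fix F F' assume "(finite F \<and> G \<subseteq> F) \<and> finite F' \<and> G \<subseteq> F'"
      then have "dist (sum f F) (sum f G) < e / 2" "dist (sum f F') (sum f G) < e / 2"
        using near by auto
      then show "dist (sum f F) (sum f F') < e" by (rule dist_triangle_half_l)
    qed
  qed
  moreover have "complete (UNIV :: 'h set)"
    by (meson Cauchy_convergent UNIV_I complete_def convergent_def)
  ultimately obtain L' where "(sum f \<longlongrightarrow> L') (finite_subsets_at_top UNIV)"
    using complete_uniform[where S = UNIV] by (force simp add: filterlim_def)
  then show ?thesis using summable_on_def has_sum_def by blast
qed

text \<open>\<open>lower\<close> and \<open>upper\<close> make synthesis a bounded map with closed
  range, and \<open>total\<close> makes that range dense. The constants are squared here so that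
  \<open>c\<close> and \<open>C\<close> themselves bound \<open>synth\<close> and, by duality,
  \<open>analysis\<close>.\<close>

locale riesz_family =
  fixes k :: "'k \<Rightarrow> 'h::{real_inner, banach}" and c C :: real
  assumes c_pos: "0 < c" and C_pos: "0 < C"
    and lower: "\<And>F a. finite F \<Longrightarrow> c\<^sup>2 * (\<Sum>\<nu>\<in>F. (a \<nu>)\<^sup>2) \<le> (norm (\<Sum>\<nu>\<in>F. a \<nu> *\<^sub>R k \<nu>))\<^sup>2"
    and upper: "\<And>F a. finite F \<Longrightarrow> (norm (\<Sum>\<nu>\<in>F. a \<nu> *\<^sub>R k \<nu>))\<^sup>2 \<le> C\<^sup>2 * (\<Sum>\<nu>\<in>F. (a \<nu>)\<^sup>2)"
    and total: "\<And>w. (\<And>\<nu>. inner (k \<nu>) w = 0) \<Longrightarrow> w = 0"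
begin

definition synth :: "'k ell2 \<Rightarrow> 'h" where
  "synth x = (\<Sum>\<^sub>\<infinity>\<nu>. coord x \<nu> *\<^sub>R k \<nu>)"

definition analysis :: "'h \<Rightarrow> 'k ell2" where
  "analysis w = Abs_ell2 (\<lambda>\<nu>. inner (k \<nu>) w)"

lemma c_le_C: "c \<le> C"
proof -
  have "c\<^sup>2 \<le> C\<^sup>2" using lower[of "{undefined}" "\<lambda>_. 1"] upper[of "{undefined}" "\<lambda>_. 1"] by simp
  then show ?thesis by (rule power2_le_imp_le) (use C_pos in simp)
qed

lemma synth_has_sum: "((\<lambda>\<nu>. coord x \<nu> *\<^sub>R k \<nu>) has_sum synth x) UNIV"
  unfolding synth_def
  by (rule has_sum_infsum, rule summable_on_of_norm_sq_le[OF summable_coord_sq[of x], where C = "C\<^sup>2"])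
    (use upper C_pos in auto)

text \<open>Duality: \<open>upper\<close> applied to the coefficients
  \<open>inner (k \<nu>) w\<close> turns the sum of squares into an inner product with
  \<open>w\<close>.\<close>

lemma bessel:
  assumes F: "finite F" shows "(\<Sum>\<nu>\<in>F. (inner (k \<nu>) w)\<^sup>2) \<le> (C * norm w)\<^sup>2"
proof -
  define s where "s = (\<Sum>\<nu>\<in>F. (inner (k \<nu>) w)\<^sup>2)"
  have s0: "0 \<le> s" unfolding s_def by (intro sum_nonneg) auto
  have "s = inner (\<Sum>\<nu>\<in>F. inner (k \<nu>) w *\<^sub>R k \<nu>) w"
    by (simp add: s_def inner_sum_left power2_eq_square)
  also have "\<dots> \<le> norm (\<Sum>\<nu>\<in>F. inner (k \<nu>) w *\<^sub>R k \<nu>) * norm w" by (rule norm_cauchy_schwarz)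
  finally have "s\<^sup>2 \<le> (norm (\<Sum>\<nu>\<in>F. inner (k \<nu>) w *\<^sub>R k \<nu>))\<^sup>2 * (norm w)\<^sup>2"
    using s0 by (metis power_mono power_mult_distrib)
  also have "\<dots> \<le> (C\<^sup>2 * s) * (norm w)\<^sup>2"
    unfolding s_def by (intro mult_right_mono upper F) auto
  finally have "s * s \<le> s * (C * norm w)\<^sup>2" by (simp add: power2_eq_square algebra_simps)
  then show ?thesis using s0 s_def by (cases "s = 0") auto
qed

lemma coord_analysis: "coord (analysis w) \<nu> = inner (k \<nu>) w"
  unfolding analysis_def by (subst coord_Abs) (auto intro: summable_on_sq_bounded bessel)

lemma norm_analysis_le: "norm (analysis w) \<le> C * norm w"
proof (rule power2_le_imp_le)
  show "(norm (analysis w))\<^sup>2 \<le> (C * norm w)\<^sup>2"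
    by (rule norm_ell2_sq_le) (simp add: coord_analysis bessel)
qed (use C_pos in simp)

text \<open>\<open>analysis\<close> is the adjoint of \<open>synth\<close>; every transfer of bounds
  between the two rests on this.\<close>

lemma inner_synth: "inner (synth x) w = inner x (analysis w)"
proof -
  have "((\<lambda>\<nu>. inner (coord x \<nu> *\<^sub>R k \<nu>) w) has_sum inner (synth x) w) UNIV"
    by (rule has_sum_bounded_linear[OF bounded_linear_inner_left synth_has_sum])
  then show ?thesis unfolding inner_ell2_def coord_analysis by (simp add: infsumI)
qed

lemma norm_synth_sq_tendsto:
  "((\<lambda>F. (norm (\<Sum>\<nu>\<in>F. coord x \<nu> *\<^sub>R k \<nu>))\<^sup>2) \<longlongrightarrow> (norm (synth x))\<^sup>2) (finite_subsets_at_top UNIV)"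
  using synth_has_sum[of x] unfolding has_sum_def by (intro tendsto_intros)

lemma norm_coord_sq_tendsto:
  "((\<lambda>F. b * (\<Sum>\<nu>\<in>F. (coord x \<nu>)\<^sup>2)) \<longlongrightarrow> b * (norm x)\<^sup>2) (finite_subsets_at_top UNIV)"
  unfolding norm_ell2_sq using has_sum_infsum[OF summable_coord_sq[of x UNIV]] has_sum_def
  by (intro tendsto_intros) blast

lemma norm_synth_le: "norm (synth x) \<le> C * norm x"
proof (rule power2_le_imp_le)
  show "(norm (synth x))\<^sup>2 \<le> (C * norm x)\<^sup>2"
    unfolding power_mult_distrib
    by (rule tendsto_le[OF _ norm_coord_sq_tendsto norm_synth_sq_tendsto])
      (auto intro: eventually_finite_subsets_at_top_weakI upper)
qed (use C_pos in simp)

lemma norm_synth_ge: "c * norm x \<le> norm (synth x)"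
proof (rule power2_le_imp_le)
  show "(c * norm x)\<^sup>2 \<le> (norm (synth x))\<^sup>2"
    unfolding power_mult_distrib
    by (rule tendsto_le[OF _ norm_synth_sq_tendsto norm_coord_sq_tendsto])
      (auto intro: eventually_finite_subsets_at_top_weakI lower)
qed simp

lemma bounded_linear_synth: "bounded_linear synth"
proof (rule bounded_linear_intro[where K = C])
  fix x y :: "'k ell2" and r :: real
  have "((\<lambda>\<nu>. coord (x + y) \<nu> *\<^sub>R k \<nu>) has_sum (synth x + synth y)) UNIV"
    using has_sum_add[OF synth_has_sum[of x] synth_has_sum[of y]] by (simp add: scaleR_add_left)
  then show "synth (x + y) = synth x + synth y" by (rule has_sum_unique[OF synth_has_sum])
  have "((\<lambda>\<nu>. r *\<^sub>R (coord x \<nu> *\<^sub>R k \<nu>)) has_sum (r *\<^sub>R synth x)) UNIV"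
    by (rule has_sum_bounded_linear[OF bounded_linear_scaleR_right synth_has_sum])
  then have "((\<lambda>\<nu>. coord (r *\<^sub>R x) \<nu> *\<^sub>R k \<nu>) has_sum (r *\<^sub>R synth x)) UNIV" by simp
  then show "synth (r *\<^sub>R x) = r *\<^sub>R synth x" by (rule has_sum_unique[OF synth_has_sum])
  show "norm (synth x) \<le> norm x * C" using norm_synth_le[of x] by (simp add: mult.commute)
qed

lemma analysis_diff: "analysis (v - w) = analysis v - analysis w"
  by (rule ell2_eqI) (simp add: coord_analysis inner_diff_right)

lemma synth_unit_vec: "synth (unit_vec \<nu>) = k \<nu>"
proof -
  have "synth (unit_vec \<nu>) = (\<Sum>\<^sub>\<infinity>\<mu>\<in>{\<nu>}. k \<mu>)"
    unfolding synth_def by (rule infsum_cong_neutral) (auto simp: coord_unit_vec)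
  then show ?thesis by simp
qed

text \<open>The normal operator \<^term>\<open>analysis \<circ> synth\<close> is coercive, so a damped Richardson
  iteration for it is a contraction.\<close>
lemma analysis_synth_surj: "\<exists>x. analysis (synth x) = f"
proof -
  interpret S: bounded_linear synth by (rule bounded_linear_synth)
  \<comment> \<open>This damping minimises
    \<open>1 - 2 * \<tau> * c\<^sup>2 + \<tau>\<^sup>2 * C ^ 4\<close>; the minimum is
    \<open>1 - (c / C) ^ 4\<close>, the square of the contraction factor \<open>q\<close>.\<close>
  define \<tau> where "\<tau> = c\<^sup>2 / C ^ 4"
  define q where "q = sqrt (1 - (c / C) ^ 4)"
  define \<Phi> where "\<Phi> x = x - \<tau> *\<^sub>R (analysis (synth x) - f)" for x
  have cC: "(c / C) ^ 4 \<le> 1" "0 < (c / C) ^ 4"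
    using c_le_C c_pos C_pos by (auto intro!: power_le_one)
  have q: "0 \<le> q" "q < 1" using cC by (auto simp: q_def)
  have \<tau>: "0 < \<tau>" using c_pos C_pos by (simp add: \<tau>_def)
  have contr: "dist (\<Phi> x) (\<Phi> y) \<le> q * dist x y" for x y
  proof -
    define z where "z = x - y"
    define n where "n = analysis (synth z)"
    have eq: "\<Phi> x - \<Phi> y = z - \<tau> *\<^sub>R n"
      by (simp add: \<Phi>_def z_def n_def S.diff analysis_diff algebra_simps)
    have "(norm (z - \<tau> *\<^sub>R n))\<^sup>2 = (norm z)\<^sup>2 - 2 * \<tau> * inner z n + \<tau>\<^sup>2 * (norm n)\<^sup>2"
      unfolding power2_norm_eq_inner
      by (simp add: inner_diff_left inner_diff_right inner_commute algebra_simps power2_eq_square)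
    also have "inner z n = (norm (synth z))\<^sup>2"
      using inner_synth[of z "synth z"] by (simp add: n_def power2_norm_eq_inner)
    also have "(norm z)\<^sup>2 - 2 * \<tau> * (norm (synth z))\<^sup>2 + \<tau>\<^sup>2 * (norm n)\<^sup>2
        \<le> (norm z)\<^sup>2 - 2 * \<tau> * (c * norm z)\<^sup>2 + \<tau>\<^sup>2 * (C\<^sup>2 * norm z)\<^sup>2"
    proof -
      have "(c * norm z)\<^sup>2 \<le> (norm (synth z))\<^sup>2"
        using norm_synth_ge[of z] c_pos by (intro power_mono) auto
      moreover have "norm n \<le> C\<^sup>2 * norm z"
        using order_trans[OF norm_analysis_le[of "synth z"] mult_left_mono[OF norm_synth_le[of z], of C]] C_pos
        by (simp add: n_def power2_eq_square mult.assoc)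
      then have "(norm n)\<^sup>2 \<le> (C\<^sup>2 * norm z)\<^sup>2" by (intro power_mono) auto
      ultimately show ?thesis using \<tau>
        by (intro add_mono diff_mono mult_left_mono) auto
    qed
    also have "\<dots> = (1 - (c / C) ^ 4) * (norm z)\<^sup>2"
      using C_pos by (simp add: \<tau>_def field_simps power2_eq_square power4_eq_xxxx)
    also have "\<dots> = (q * norm z)\<^sup>2" using cC by (simp add: q_def power_mult_distrib)
    finally have "norm (z - \<tau> *\<^sub>R n) \<le> q * norm z"
      by (rule power2_le_imp_le) (use q in simp)
    then show ?thesis by (simp add: dist_norm eq z_def)
  qed
  have "\<exists>!x. \<Phi> x = x"
    using banach_fix_type[OF q] contr by blast
  then obtain x where "\<Phi> x = x" by blast
  then show ?thesis using \<tau> by (auto simp: \<Phi>_def)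
qed

text \<open>Totality enters here: \<open>v - w\<close> is orthogonal to the whole family. Together
  with \<open>analysis_synth_surj\<close> this makes \<open>synth\<close> onto.\<close>

lemma analysis_eqD: "analysis v = analysis w \<Longrightarrow> v = w"
  using total[of "v - w"] by (metis coord_analysis coord_simps(1) eq_iff_diff_eq_0 analysis_diff)

lemma synth_surj: "\<exists>x. synth x = w"
  using analysis_synth_surj[of "analysis w"] analysis_eqD by blast

lemma bij_synth: "bij synth"
proof (rule bijI)
  interpret S: bounded_linear synth by (rule bounded_linear_synth)
  show "inj synth"
  proof (rule injI)
    fix x y assume "synth x = synth y"
    then have "c * norm (x - y) \<le> 0" using norm_synth_ge[of "x - y"] by (simp add: S.diff)
    then show "x = y" using c_pos by (simp add: mult_le_0_iff)
  qed
  show "surj synth" using synth_surj by (metis surj_def)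
qed

lemma bij_analysis: "bij analysis"
  using analysis_synth_surj analysis_eqD by (intro bijI injI) (auto simp: surj_def, metis)

text \<open>For \<open>w = synth x\<close>, adjointness bounds the square of \<open>norm w\<close>
  by \<open>norm x * norm (analysis w)\<close>, and \<open>norm x\<close> is at most
  \<open>norm w / c\<close>. The lower constant thus survives duality unchanged.\<close>

lemma norm_analysis_ge: "c * norm w \<le> norm (analysis w)"
proof -
  obtain x where x: "synth x = w" using synth_surj by blast
  have "norm w * norm w = inner x (analysis w)"
    using inner_synth[of x w] x by (simp add: dot_square_norm power2_eq_square)
  also have "\<dots> \<le> norm x * norm (analysis w)" by (rule norm_cauchy_schwarz)
  finally have "c * (norm w * norm w) \<le> c * (norm x * norm (analysis w))"
    using c_pos by (simp add: mult_left_mono)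
  also have "\<dots> \<le> norm w * norm (analysis w)"
    using mult_right_mono[OF norm_synth_ge[of x] norm_ge_zero[of "analysis w"]] x
    by (simp add: mult.assoc)
  finally show ?thesis by (cases "norm w = 0") (auto simp: mult.left_commute)
qed

end

section \<open>Comparison of quadratic forms\<close>

text \<open>Lax's argument: iterating the Cauchy--Schwarz inequality for the form bounds
  \<^term>\<open>s (B u) u / s u u\<close> by the spectral radius of \<^term>\<open>B\<close> in the stronger norm.\<close>
lemma lax_form_bound:
  fixes B :: "'v::real_normed_vector \<Rightarrow> 'v" and s :: "'v \<Rightarrow> 'v \<Rightarrow> real"
  assumes add: "\<And>x y z. s (x + y) z = s x z + s y z"
    and scale: "\<And>a x z. s (a *\<^sub>R x) z = a * s x z"
    and sym: "\<And>x y. s x y = s y x" and nonneg: "\<And>x. 0 \<le> s x x"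
    and B_sym: "\<And>x y. s (B x) y = s x (B y)"
    and s_le: "\<And>x. s x x \<le> K * (norm x)\<^sup>2"
    and B_le: "\<And>x. norm (B x) \<le> C * norm x" and C: "0 < C"
  shows "s (B u) u \<le> C * s u u"
proof -
  have expand: "s (x + a *\<^sub>R y) (x + a *\<^sub>R y) = s x x + 2 * a * s x y + a\<^sup>2 * s y y" for x y a
    using sym[of x "x + a *\<^sub>R y"] sym[of y "x + a *\<^sub>R y"] sym[of y x]
    by (simp add: add scale power2_eq_square algebra_simps)
  have cs: "(s x y)\<^sup>2 \<le> s x x * s y y" for x y
    using sq_le_of_quadratic_nonneg[of "s x x" "s x y" "s y y"] expand[of x _ y] nonneg by metis
  show ?thesis
  proof (rule ccontr)
    assume neg: "\<not> s (B u) u \<le> C * s u u"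
    define \<sigma> where "\<sigma> = s u u"
    have \<sigma>: "0 < \<sigma>"
    proof (rule ccontr)
      assume "\<not> 0 < \<sigma>"
      then have "\<sigma> = 0" using nonneg[of u] by (simp add: \<sigma>_def)
      then have "(s (B u) u)\<^sup>2 \<le> 0" using cs[of "B u" u] by (simp add: \<sigma>_def)
      then show False using neg \<open>\<sigma> = 0\<close> by (simp add: \<sigma>_def)
    qed
    define \<rho> where "\<rho> = s (B u) u / \<sigma>"
    have \<rho>: "C < \<rho>" using neg \<sigma> by (simp add: \<rho>_def \<sigma>_def field_simps)
    have shift: "s ((B ^^ m) x) y = s x ((B ^^ m) y)" for m x y
      by (induction m arbitrary: x) (simp_all add: B_sym funpow_swap1)
    \<comment> \<open>Cauchy-Schwarz for \<open>s\<close> against \<open>u\<close>. Passing from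
      \<open>m\<close> to \<open>2 * m\<close> squares the quotient, whence the exponents
      \<open>2 ^ n\<close> below.\<close>
    have step: "(s ((B ^^ m) u) u / \<sigma>)\<^sup>2 \<le> s ((B ^^ m) u) ((B ^^ m) u) / \<sigma>" for m
      using cs[of "(B ^^ m) u" u] \<sigma> by (simp add: \<sigma>_def[symmetric] power2_eq_square field_simps)
    have dbl: "s ((B ^^ m) u) ((B ^^ m) u) = s ((B ^^ (2 * m)) u) u" for m
      using shift[of m "(B ^^ m) u" u] by (simp add: mult_2 funpow_add)
    have pow: "\<rho> ^ (2 ^ n) \<le> s ((B ^^ (2 ^ n)) u) u / \<sigma>" for n
    proof (induction n)
      case 0 show ?case by (simp add: \<rho>_def)
    next
      case (Suc n)
      have "\<rho> ^ (2 ^ Suc n) = (\<rho> ^ (2 ^ n))\<^sup>2" by (simp add: power_mult[symmetric] mult.commute)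
      also have "\<dots> \<le> (s ((B ^^ (2 ^ n)) u) u / \<sigma>)\<^sup>2"
        using Suc \<rho> C by (intro power_mono) auto
      also have "\<dots> \<le> s ((B ^^ (2 * 2 ^ n)) u) u / \<sigma>" using step[of "2 ^ n"] by (simp add: dbl)
      finally show ?case by simp
    qed
    have Bn: "norm ((B ^^ m) u) \<le> C ^ m * norm u" for m
    proof (induction m)
      case (Suc m)
      have "norm ((B ^^ Suc m) u) \<le> C * norm ((B ^^ m) u)" using B_le by simp
      also have "\<dots> \<le> C * (C ^ m * norm u)" using Suc C by (intro mult_left_mono) auto
      finally show ?case by (simp add: mult.assoc)
    qed simp
    have K: "0 \<le> K"
    proof -
      have "norm u \<noteq> 0"
      proof
        assume "norm u = 0"
        then have "\<sigma> \<le> 0" using s_le[of u] by (simp add: \<sigma>_def)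
        with \<sigma> show False by simp
      qed
      moreover have "0 \<le> K * (norm u)\<^sup>2" using s_le[of u] nonneg[of u] by linarith
      ultimately show ?thesis by (simp add: zero_le_mult_iff)
    qed
    \<comment> \<open>If \<open>\<rho>\<close> exceeded \<open>C\<close>, arbitrarily high powers of
      \<open>(\<rho> / C)\<^sup>2\<close> would stay below a fixed number. The factor
      \<open>K\<close> is swallowed by the growth, so it leaves no trace in the conclusion.\<close>
    have bound: "((\<rho> / C)\<^sup>2) ^ (2 ^ n) \<le> K * (norm u)\<^sup>2 / \<sigma>" for n
    proof -
      let ?m = "2 ^ n :: nat"
      have "(\<rho> ^ ?m)\<^sup>2 \<le> (s ((B ^^ ?m) u) u / \<sigma>)\<^sup>2"
        using pow[of n] \<rho> C by (intro power_mono) auto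
      also have "\<dots> \<le> s ((B ^^ ?m) u) ((B ^^ ?m) u) / \<sigma>" by (rule step)
      also have "\<dots> \<le> K * (norm ((B ^^ ?m) u))\<^sup>2 / \<sigma>" using s_le \<sigma> by (intro divide_right_mono) auto
      also have "\<dots> \<le> K * (C ^ ?m * norm u)\<^sup>2 / \<sigma>"
        using K \<sigma> Bn by (intro divide_right_mono mult_left_mono power_mono) auto
      finally have "(\<rho> ^ ?m)\<^sup>2 / (C ^ ?m)\<^sup>2 \<le> K * (norm u)\<^sup>2 / \<sigma>"
        using C \<sigma> by (simp add: field_simps power_mult_distrib)
      then show ?thesis
        by (simp add: power_divide power_mult[symmetric] mult.commute)
    qed
    have "1 < (\<rho> / C)\<^sup>2" using \<rho> C by (simp add: power_one_over one_less_power)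
    then obtain n where n: "K * (norm u)\<^sup>2 / \<sigma> < ((\<rho> / C)\<^sup>2) ^ n" using real_arch_pow by blast
    also have "\<dots> \<le> ((\<rho> / C)\<^sup>2) ^ (2 ^ n)"
      using \<open>1 < (\<rho> / C)\<^sup>2\<close> by (intro power_increasing less_imp_le[OF less_exp]) simp
    finally show False using bound[of n] by simp
  qed
qed

text \<open>The bound on the multiplier is tested inside the definition, with zero as default, to
  make the lifting total. It is applied only to factors \<open>inverse (l \<nu>)\<close> with
  \<open>1 \<le> l \<nu>\<close>.\<close>

lift_definition diag_scale :: "('k \<Rightarrow> real) \<Rightarrow> 'k ell2 \<Rightarrow> 'k ell2" is
  "\<lambda>d f \<nu>. if \<forall>\<mu>. \<bar>d \<mu>\<bar> \<le> 1 then d \<nu> * f \<nu> else 0"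
proof -
  fix d f :: "'k \<Rightarrow> real" assume f: "(\<lambda>\<nu>. (f \<nu>)\<^sup>2) summable_on UNIV"
  show "(\<lambda>\<nu>. (if \<forall>\<mu>. \<bar>d \<mu>\<bar> \<le> 1 then d \<nu> * f \<nu> else 0)\<^sup>2) summable_on UNIV"
  proof (cases "\<forall>\<mu>. \<bar>d \<mu>\<bar> \<le> 1")
    case True
    then have "(d \<nu>)\<^sup>2 \<le> 1" for \<nu> by (simp add: abs_square_le_1)
    then have "(\<lambda>\<nu>. (d \<nu> * f \<nu>)\<^sup>2) summable_on UNIV"
      by (intro summable_on_comparison_test[OF f]) (auto simp: power_mult_distrib mult_left_le_one_le)
    then show ?thesis using True by simp
  next
    case False
    show ?thesis by (simp only: False if_False) simp
  qed
qed

text \<open>Operator monotonicity of the square root, specialised to the comparison of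
  a positive symmetric matrix \<^term>\<open>\<lambda>\<nu> \<mu>. coord (q \<nu>) \<mu>\<close> with a diagonal one.\<close>
lemma form_bounds_of_riesz:
  fixes q :: "'k \<Rightarrow> 'k ell2" and l :: "'k \<Rightarrow> real"
  assumes l: "\<And>\<nu>. 1 \<le> l \<nu>" and riesz: "riesz_family (\<lambda>\<nu>. inverse (l \<nu>) *\<^sub>R q \<nu>) c C"
    and sym: "\<And>\<mu> \<nu>. coord (q \<nu>) \<mu> = coord (q \<mu>) \<nu>"
    and psd: "\<And>F a. finite F \<Longrightarrow> 0 \<le> (\<Sum>\<mu>\<in>F. \<Sum>\<nu>\<in>F. a \<mu> * a \<nu> * coord (q \<nu>) \<mu>)"
    and F: "finite F"
  shows "c * (\<Sum>\<nu>\<in>F. l \<nu> * (a \<nu>)\<^sup>2) \<le> (\<Sum>\<mu>\<in>F. \<Sum>\<nu>\<in>F. a \<mu> * a \<nu> * coord (q \<nu>) \<mu>)"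
    and "(\<Sum>\<mu>\<in>F. \<Sum>\<nu>\<in>F. a \<mu> * a \<nu> * coord (q \<nu>) \<mu>) \<le> C * (\<Sum>\<nu>\<in>F. l \<nu> * (a \<nu>)\<^sup>2)"
proof -
  interpret riesz_family "\<lambda>\<nu>. inverse (l \<nu>) *\<^sub>R q \<nu>" c C by (rule riesz)
  interpret K: bounded_linear synth by (rule bounded_linear_synth)
  \<comment> \<open>Let L be multiplication by \<open>l\<close> and Q the operator with columns
    \<open>q\<close>. Then \<open>R\<close> is L^-1 and \<open>synth\<close> is Q L^-1, both
    bounded, and for x = L a the two forms <Q a, a> and <L a, a> read
    \<open>inner (synth x) (R x)\<close> and \<open>inner x (R x)\<close>.\<close>
  define R where "R = diag_scale (\<lambda>\<nu>. inverse (l \<nu>))"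
  have l0: "0 < l \<nu>" for \<nu> using l[of \<nu>] by linarith
  have l_cancel: "l \<nu> * b * inverse (l \<nu>) = b" for \<nu> b using l0[of \<nu>] by simp
  have l1: "\<bar>inverse (l \<nu>)\<bar> \<le> 1" for \<nu> using l[of \<nu>] by (simp add: inverse_le_1_iff)
  have coord_R: "coord (R x) \<nu> = inverse (l \<nu>) * coord x \<nu>" for x \<nu>
    unfolding R_def diag_scale.rep_eq using l1 by simp
  have R_le: "norm (R x) \<le> norm x" for x
  proof (rule power2_le_imp_le)
    show "(norm (R x))\<^sup>2 \<le> (norm x)\<^sup>2"
    proof (rule norm_ell2_sq_le)
      fix G :: "'k set" assume G: "finite G"
      have "(\<Sum>\<nu>\<in>G. (coord (R x) \<nu>)\<^sup>2) \<le> (\<Sum>\<nu>\<in>G. (coord x \<nu>)\<^sup>2)"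
        unfolding coord_R power_mult_distrib using l1
        by (intro sum_mono mult_left_le_one_le) (simp_all add: abs_square_le_1)
      also have "\<dots> \<le> (norm x)\<^sup>2" by (rule sum_coord_sq_le[OF G])
      finally show "(\<Sum>\<nu>\<in>G. (coord (R x) \<nu>)\<^sup>2) \<le> (norm x)\<^sup>2" .
    qed
  qed simp
  have bl_R: "bounded_linear R"
    by (rule bounded_linear_intro[where K = 1]) (auto intro!: ell2_eqI simp: coord_R algebra_simps R_le)
  interpret R: bounded_linear R by (rule bl_R)
  have R_sym: "inner (R x) y = inner x (R y)" for x y
    unfolding inner_ell2_def coord_R by (simp add: algebra_simps)
  have R_pos: "0 \<le> inner x (R x)" for x
    unfolding inner_ell2_def coord_R using l0
    by (intro infsum_nonneg) (simp add: mult.left_commute[of "coord x _"] less_imp_le)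
  have Ru: "R (unit_vec \<nu>) = inverse (l \<nu>) *\<^sub>R unit_vec \<nu>" for \<nu>
    by (rule ell2_eqI) (simp add: coord_R coord_unit_vec)
  \<comment> \<open>Symmetry of the matrix is tested on unit vectors in one argument and then in the
    other; bounded linearity does the rest.\<close>
  have KR_sym: "inner (synth x) (R y) = inner (synth y) (R x)" for x y
  proof (rule bounded_linear_eq_on_unit_vec[of "\<lambda>x. inner (synth x) (R y)" "\<lambda>x. inner (synth y) (R x)"])
    show "bounded_linear (\<lambda>x. inner (synth x) (R y))"
      by (rule bounded_linear_compose[OF bounded_linear_inner_left bounded_linear_synth])
    show "bounded_linear (\<lambda>x. inner (synth y) (R x))"
      by (rule bounded_linear_compose[OF bounded_linear_inner_right bl_R])
    show "inner (synth (unit_vec \<nu>)) (R y) = inner (synth y) (R (unit_vec \<nu>))" for \<nu>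
    proof (rule bounded_linear_eq_on_unit_vec[of "\<lambda>y. inner (synth (unit_vec \<nu>)) (R y)"
          "\<lambda>y. inner (synth y) (R (unit_vec \<nu>))"])
      show "bounded_linear (\<lambda>y. inner (synth (unit_vec \<nu>)) (R y))"
        by (rule bounded_linear_compose[OF bounded_linear_inner_right bl_R])
      show "bounded_linear (\<lambda>y. inner (synth y) (R (unit_vec \<nu>)))"
        by (rule bounded_linear_compose[OF bounded_linear_inner_left bounded_linear_synth])
      show "inner (synth (unit_vec \<nu>)) (R (unit_vec \<mu>)) = inner (synth (unit_vec \<mu>)) (R (unit_vec \<nu>))" for \<mu>
        by (simp add: synth_unit_vec Ru inner_unit_vec_right sym[of \<nu> \<mu>])
    qed
  qed
  have finite_form: "inner (synth x) (R x) = (\<Sum>\<mu>\<in>G. \<Sum>\<nu>\<in>G. b \<mu> * b \<nu> * coord (q \<nu>) \<mu>)"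
    if "finite G" "x = (\<Sum>\<nu>\<in>G. (l \<nu> * b \<nu>) *\<^sub>R unit_vec \<nu>)" for G b x
  proof -
    have "synth x = (\<Sum>\<nu>\<in>G. b \<nu> *\<^sub>R q \<nu>)" "R x = (\<Sum>\<mu>\<in>G. b \<mu> *\<^sub>R unit_vec \<mu>)"
      by (simp_all add: that(2) K.sum K.scaleR R.sum R.scaleR synth_unit_vec Ru l_cancel)
    then show ?thesis
      by (simp add: inner_sum_right inner_unit_vec_right coord_sum sum_distrib_left mult.assoc
          mult.left_commute)
  qed
  have KR_pos: "0 \<le> inner (synth x) (R x)" for x
  proof (rule tendsto_lowerbound)
    have t: "((\<lambda>G. \<Sum>\<nu>\<in>G. coord x \<nu> *\<^sub>R unit_vec \<nu>) \<longlongrightarrow> x) (finite_subsets_at_top UNIV)"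
      using has_sum_unit_vec[of x] unfolding has_sum_def .
    show "((\<lambda>G. inner (synth (\<Sum>\<nu>\<in>G. coord x \<nu> *\<^sub>R unit_vec \<nu>)) (R (\<Sum>\<nu>\<in>G. coord x \<nu> *\<^sub>R unit_vec \<nu>)))
        \<longlongrightarrow> inner (synth x) (R x)) (finite_subsets_at_top UNIV)"
      by (intro tendsto_inner K.tendsto R.tendsto t)
    have "0 \<le> inner (synth (\<Sum>\<nu>\<in>G. coord x \<nu> *\<^sub>R unit_vec \<nu>)) (R (\<Sum>\<nu>\<in>G. coord x \<nu> *\<^sub>R unit_vec \<nu>))"
      if "finite G" for G
      using psd[OF that, of "\<lambda>\<nu>. coord x \<nu> / l \<nu>"] l0
      by (subst finite_form[OF that, where b = "\<lambda>\<nu>. coord x \<nu> / l \<nu>"]) (auto simp: less_imp_neq[symmetric])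
    then show "\<forall>\<^sub>F G in finite_subsets_at_top UNIV.
        0 \<le> inner (synth (\<Sum>\<nu>\<in>G. coord x \<nu> *\<^sub>R unit_vec \<nu>)) (R (\<Sum>\<nu>\<in>G. coord x \<nu> *\<^sub>R unit_vec \<nu>))"
      by (rule eventually_finite_subsets_at_top_weakI)
  qed simp
  have cs: "inner x (R x) \<le> 1 * (norm x)\<^sup>2" for x
    using order_trans[OF norm_cauchy_schwarz mult_left_mono[OF R_le]] by (simp add: power2_eq_square)
  \<comment> \<open>\<open>synth\<close> is symmetric in the form \<open>inner x (R y)\<close>, so
    its norm bound \<open>C\<close> becomes a form bound without being squared.\<close>
  have form_le: "inner (synth x) (R x) \<le> C * inner x (R x)" for x
  proof (rule lax_form_bound[where s = "\<lambda>x y. inner x (R y)" and K = 1])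
    show "inner x (R y) = inner y (R x)" for x y by (metis R_sym inner_commute)
    show "inner (synth x) (R y) = inner x (R (synth y))" for x y
      using KR_sym[of x y] R_sym[of x "synth y"] by (simp add: inner_commute)
  qed (use R_pos cs norm_synth_le C_pos in \<open>simp_all add: inner_add_left\<close>)
  have inv: "synth (inv synth x) = x" "inv synth (synth x) = x" for x
    using bij_synth by (simp_all add: bij_is_surj surj_f_inv_f bij_is_inj)
  \<comment> \<open>The roles are exchanged: the form is now that of Q, and the symmetric operator
    is \<open>inv synth\<close> with norm bound \<open>inverse c\<close>.\<close>
  have form_ge: "inner x (R x) \<le> inverse c * inner (synth x) (R x)" for x
  proof -
    have "inner (synth (inv synth x)) (R x) \<le> inverse c * inner (synth x) (R x)"
    proof (rule lax_form_bound[where s = "\<lambda>x y. inner (synth x) (R y)" and K = C])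
      show "inner (synth x) (R x) \<le> C * (norm x)\<^sup>2" for x
      proof -
        have "inner (synth x) (R x) \<le> norm (synth x) * norm (R x)" by (rule norm_cauchy_schwarz)
        also have "\<dots> \<le> (C * norm x) * norm x"
          using C_pos by (intro mult_mono norm_synth_le R_le) auto
        finally show ?thesis by (simp add: power2_eq_square)
      qed
      show "norm (inv synth x) \<le> inverse c * norm x" for x
        using norm_synth_ge[of "inv synth x", unfolded inv] c_pos by (simp add: field_simps)
      show "inner (synth (inv synth x)) (R y) = inner (synth x) (R (inv synth y))" for x y
        using KR_sym[of x "inv synth y"] R_sym[of x y] by (simp add: inv inner_commute)
    qed (use KR_pos KR_sym c_pos in \<open>auto simp: K.add K.scaleR inner_add_left\<close>)
    then show ?thesis by (simp add: inv)
  qed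
  define x where "x = (\<Sum>\<nu>\<in>F. (l \<nu> * a \<nu>) *\<^sub>R unit_vec \<nu>)"
  have "R x = (\<Sum>\<mu>\<in>F. a \<mu> *\<^sub>R unit_vec \<mu>)"
    by (simp add: x_def R.sum R.scaleR Ru l_cancel)
  then have "inner x (R x) = (\<Sum>\<nu>\<in>F. l \<nu> * (a \<nu>)\<^sup>2)"
    using F by (simp add: x_def inner_sum_right inner_unit_vec_right coord_sum coord_unit_vec
        power2_eq_square algebra_simps if_distrib[of "\<lambda>x. _ * x"] cong: if_cong)
  with form_le[of x] form_ge[of x] finite_form[OF F x_def] c_pos
  show "c * (\<Sum>\<nu>\<in>F. l \<nu> * (a \<nu>)\<^sup>2) \<le> (\<Sum>\<mu>\<in>F. \<Sum>\<nu>\<in>F. a \<mu> * a \<nu> * coord (q \<nu>) \<mu>)"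
    "(\<Sum>\<mu>\<in>F. \<Sum>\<nu>\<in>F. a \<mu> * a \<nu> * coord (q \<nu>) \<mu>) \<le> C * (\<Sum>\<nu>\<in>F. l \<nu> * (a \<nu>)\<^sup>2)"
    by (simp_all add: field_simps)
qed

section \<open>Tensor products of square summable sequences\<close>

definition tens :: "nat \<Rightarrow> (nat \<Rightarrow> 'i ell2) \<Rightarrow> (nat \<Rightarrow> 'i) ell2" where
  "tens d f = Abs_ell2 (\<lambda>\<kappa>. if \<kappa> \<in> multi_idx d then \<Prod>i<d. coord (f i) (\<kappa> i) else 0)"

lemma tens_sq_sum_le:
  assumes "finite G"
  shows "(\<Sum>\<kappa>\<in>G. (if \<kappa> \<in> multi_idx d then \<Prod>i<d. coord (f i) (\<kappa> i) else 0)\<^sup>2) \<le> (\<Prod>i<d. (norm (f i))\<^sup>2)"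
proof -
  \<comment> \<open>A finite set of multi-indices lies in the box of its projections, and over a box
    the sum of products factorises.\<close>
  define B where "B i = (\<lambda>\<kappa>. \<kappa> i) ` (G \<inter> multi_idx d)" for i
  have fB: "finite (B i)" for i using assms by (simp add: B_def)
  have sub: "G \<inter> multi_idx d \<subseteq> (\<Pi>\<^sub>E i\<in>{..<d}. B i)"
    by (auto simp: B_def multi_idx_def PiE_def extensional_def)
  have "(\<Sum>\<kappa>\<in>G. (if \<kappa> \<in> multi_idx d then \<Prod>i<d. coord (f i) (\<kappa> i) else 0)\<^sup>2)
      = (\<Sum>\<kappa>\<in>G \<inter> multi_idx d. \<Prod>i<d. (coord (f i) (\<kappa> i))\<^sup>2)"
    by (rule sum.mono_neutral_cong_right) (use assms in \<open>auto simp: prod_power_distrib\<close>)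
  also have "\<dots> \<le> (\<Sum>\<kappa>\<in>(\<Pi>\<^sub>E i\<in>{..<d}. B i). \<Prod>i<d. (coord (f i) (\<kappa> i))\<^sup>2)"
    by (rule sum_mono2[OF _ sub]) (simp_all add: finite_PiE fB prod_nonneg)
  also have "\<dots> = (\<Prod>i<d. \<Sum>a\<in>B i. (coord (f i) a)\<^sup>2)"
    by (rule prod_sum_PiE[symmetric]) (auto simp: fB)
  also have "\<dots> \<le> (\<Prod>i<d. (norm (f i))\<^sup>2)"
    by (intro prod_mono conjI sum_nonneg sum_coord_sq_le fB) auto
  finally show ?thesis .
qed

lemma coord_tens:
  "coord (tens d f) \<kappa> = (if \<kappa> \<in> multi_idx d then \<Prod>i<d. coord (f i) (\<kappa> i) else 0)"
  unfolding tens_def by (subst coord_Abs) (auto intro: summable_on_sq_bounded[OF tens_sq_sum_le])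

lemma inner_tens: "inner (tens d f) (tens d g) = (\<Prod>i<d. inner (f i) (g i))"
proof -
  have "inner (tens d f) (tens d g)
      = (\<Sum>\<^sub>\<infinity>\<kappa>\<in>(\<Pi>\<^sub>E i\<in>{..<d}. UNIV). \<Prod>i<d. coord (f i) (\<kappa> i) * coord (g i) (\<kappa> i))"
    unfolding inner_ell2_def
    by (rule infsum_cong_neutral) (auto simp: coord_tens multi_idx_def prod.distrib)
  also have "\<dots> = (\<Prod>i<d. \<Sum>\<^sub>\<infinity>a. coord (f i) a * coord (g i) a)"
    by (rule infsum_prod_PiE_abs, simp, rule abs_summable_product)
      (simp_all add: summable_coord_sq flip: power2_eq_square)
  finally show ?thesis by (simp add: inner_ell2_def)
qed

lemma norm_tens: "norm (tens d f) = (\<Prod>i<d. norm (f i))"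
proof (rule power2_eq_imp_eq)
  show "(norm (tens d f))\<^sup>2 = (\<Prod>i<d. norm (f i))\<^sup>2"
    by (simp add: power2_norm_eq_inner inner_tens prod_power_distrib)
qed (simp_all add: prod_nonneg)

lemma coord_tens_upd:
  assumes "i < d" "\<kappa> \<in> multi_idx d"
  shows "coord (tens d (f(i := x))) \<kappa> = coord x (\<kappa> i) * (\<Prod>j\<in>{..<d} - {i}. coord (f j) (\<kappa> j))"
proof -
  have "coord (tens d (f(i := x))) \<kappa> = coord x (\<kappa> i) * (\<Prod>j\<in>{..<d} - {i}. coord ((f(i := x)) j) (\<kappa> j))"
    unfolding coord_tens using assms by (simp add: prod.remove[of _ i])
  also have "(\<Prod>j\<in>{..<d} - {i}. coord ((f(i := x)) j) (\<kappa> j)) = (\<Prod>j\<in>{..<d} - {i}. coord (f j) (\<kappa> j))"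
    by (rule prod.cong) auto
  finally show ?thesis .
qed

lemma coord_tens_out: "\<kappa> \<notin> multi_idx d \<Longrightarrow> coord (tens d f) \<kappa> = 0"
  by (simp add: coord_tens)

lemma bounded_linear_tens:
  assumes "i < d" shows "bounded_linear (\<lambda>x. tens d (f(i := x)))"
proof (rule bounded_linear_intro[where K = "\<Prod>j\<in>{..<d} - {i}. norm (f j)"])
  fix x y :: "'a ell2" and r :: real
  show "tens d (f(i := x + y)) = tens d (f(i := x)) + tens d (f(i := y))"
  proof (rule ell2_eqI)
    fix \<kappa> show "coord (tens d (f(i := x + y))) \<kappa> = coord (tens d (f(i := x)) + tens d (f(i := y))) \<kappa>"
      by (cases "\<kappa> \<in> multi_idx d") (simp_all add: coord_tens_upd[OF assms] coord_tens_out distrib_right)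
  qed
  show "tens d (f(i := r *\<^sub>R x)) = r *\<^sub>R tens d (f(i := x))"
  proof (rule ell2_eqI)
    fix \<kappa> show "coord (tens d (f(i := r *\<^sub>R x))) \<kappa> = coord (r *\<^sub>R tens d (f(i := x))) \<kappa>"
      by (cases "\<kappa> \<in> multi_idx d") (simp_all add: coord_tens_upd[OF assms] coord_tens_out)
  qed
  have "(\<Prod>j\<in>{..<d} - {i}. norm ((f(i := x)) j)) = (\<Prod>j\<in>{..<d} - {i}. norm (f j))"
    by (rule prod.cong) auto
  then show "norm (tens d (f(i := x))) \<le> norm x * (\<Prod>j\<in>{..<d} - {i}. norm (f j))"
    unfolding norm_tens using assms by (simp add: prod.remove[of _ i])
qed

lemma tens_scaleR: "i < d \<Longrightarrow> tens d (f(i := r *\<^sub>R x)) = r *\<^sub>R tens d (f(i := x))"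
  by (rule linear_scale[OF bounded_linear.linear[OF bounded_linear_tens]])

lemma tens_unit_vec:
  assumes "\<nu> \<in> multi_idx d" shows "tens d (\<lambda>i. unit_vec (\<nu> i)) = unit_vec \<nu>"
proof (rule ell2_eqI)
  fix \<kappa>
  show "coord (tens d (\<lambda>i. unit_vec (\<nu> i))) \<kappa> = coord (unit_vec \<nu>) \<kappa>"
  proof (cases "\<kappa> \<in> multi_idx d")
    case True
    show ?thesis
    proof (cases "\<kappa> = \<nu>")
      case False
      then obtain i where "i < d" "\<kappa> i \<noteq> \<nu> i"
        using True assms unfolding multi_idx_def by (metis PiE_ext lessThan_iff)
      then have "(\<Prod>i<d. coord (unit_vec (\<nu> i)) (\<kappa> i)) = 0"
        by (intro prod_zero) (auto simp: coord_unit_vec)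
      then show ?thesis using False by (simp add: coord_tens coord_unit_vec)
    qed (use True in \<open>simp add: coord_tens coord_unit_vec\<close>)
  qed (use assms in \<open>auto simp: coord_tens coord_unit_vec\<close>)
qed

text \<open>The slots are released one at a time. With all other slots fixed, the map is bounded
  linear in slot \<open>m\<close>, so its zero set there is a closed subspace containing
  \<open>S\<close>.\<close>

lemma multilinear_vanish:
  fixes \<Phi> :: "(nat \<Rightarrow> 'h::real_normed_vector) \<Rightarrow> real"
  assumes bl: "\<And>i p. i < d \<Longrightarrow> bounded_linear (\<lambda>x. \<Phi> (p(i := x)))"
    and van: "\<And>p. (\<And>i. i < d \<Longrightarrow> p i \<in> S) \<Longrightarrow> \<Phi> p = 0"
    and p: "\<And>i. i < d \<Longrightarrow> p i \<in> closure (span S)"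
  shows "\<Phi> p = 0"
proof -
  have "\<Phi> p = 0" if "m \<le> d" "\<And>i. i < m \<Longrightarrow> p i \<in> closure (span S)" "\<And>i. m \<le> i \<Longrightarrow> i < d \<Longrightarrow> p i \<in> S" for m p
    using that
  proof (induction m arbitrary: p)
    case 0 then show ?case by (intro van) auto
  next
    case (Suc m)
    then have m: "m < d" by simp
    interpret L: bounded_linear "\<lambda>x. \<Phi> (p(m := x))" by (rule bl[OF m])
    let ?N = "{x. \<Phi> (p(m := x)) = 0}"
    have "S \<subseteq> ?N"
    proof
      fix x assume x: "x \<in> S"
      have "\<Phi> (p(m := x)) = 0"
        by (rule Suc.IH) (use Suc.prems x in \<open>auto simp: less_Suc_eq\<close>)
      then show "x \<in> ?N" by simp
    qed
    moreover have "subspace ?N"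
      by (auto simp: subspace_def L.zero L.add L.scaleR)
    ultimately have "span S \<subseteq> ?N" by (rule span_minimal)
    moreover have "closed ?N"
      by (rule closed_Collect_eq) (intro L.continuous_on continuous_on_id continuous_on_const)+
    ultimately have "closure (span S) \<subseteq> ?N" by (rule closure_minimal)
    moreover have "p m \<in> closure (span S)" using Suc.prems by simp
    ultimately show ?case by auto
  qed
  from this[of d p] show ?thesis using p by simp
qed

lemma has_sum_sum:
  fixes f :: "'n \<Rightarrow> 'k \<Rightarrow> 'b::topological_comm_monoid_add"
  assumes "\<And>i. i \<in> A \<Longrightarrow> (f i has_sum S i) B"
  shows "((\<lambda>x. \<Sum>i\<in>A. f i x) has_sum (\<Sum>i\<in>A. S i)) B"
  using assms by (induction A rule: infinite_finite_induct) (auto intro: has_sum_add)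

text \<open>Expanding the inner products coordinatewise reduces the Schur product to a sum of values of \<open>Z\<close>.\<close>
lemma schur_nonneg:
  fixes Z :: "'i \<Rightarrow> 'i \<Rightarrow> real" and \<rho> :: "'n \<Rightarrow> 'k ell2"
  assumes psd: "\<And>a. 0 \<le> (\<Sum>i\<in>\<iota> ` G. \<Sum>j\<in>\<iota> ` G. a i * a j * Z i j)" and G: "finite G"
  shows "0 \<le> (\<Sum>\<mu>\<in>G. \<Sum>\<nu>\<in>G. v \<mu> * v \<nu> * Z (\<iota> \<mu>) (\<iota> \<nu>) * inner (\<rho> \<mu>) (\<rho> \<nu>))"
proof (rule has_sum_nonneg)
  have "((\<lambda>\<kappa>. coord x \<kappa> * coord y \<kappa>) has_sum inner x y) UNIV" for x y :: "'k ell2"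
    unfolding inner_ell2_def by (rule has_sum_infsum[OF summable_coord_mult])
  then show "((\<lambda>\<kappa>. \<Sum>\<mu>\<in>G. \<Sum>\<nu>\<in>G. v \<mu> * v \<nu> * Z (\<iota> \<mu>) (\<iota> \<nu>) * (coord (\<rho> \<mu>) \<kappa> * coord (\<rho> \<nu>) \<kappa>)) has_sum
      (\<Sum>\<mu>\<in>G. \<Sum>\<nu>\<in>G. v \<mu> * v \<nu> * Z (\<iota> \<mu>) (\<iota> \<nu>) * inner (\<rho> \<mu>) (\<rho> \<nu>))) UNIV"
    by (intro has_sum_sum has_sum_cmult_right)
  fix \<kappa>
  define b where "b \<mu> = v \<mu> * coord (\<rho> \<mu>) \<kappa>" for \<mu>
  \<comment> \<open>Indices with the same value of \<open>\<iota>\<close> are grouped, because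
    positivity of \<open>Z\<close> is assumed over distinct values only.\<close>
  define a where "a i = (\<Sum>\<mu>\<in>{\<mu>\<in>G. \<iota> \<mu> = i}. b \<mu>)" for i
  have "(\<Sum>\<mu>\<in>G. \<Sum>\<nu>\<in>G. v \<mu> * v \<nu> * Z (\<iota> \<mu>) (\<iota> \<nu>) * (coord (\<rho> \<mu>) \<kappa> * coord (\<rho> \<nu>) \<kappa>))
      = (\<Sum>\<mu>\<in>G. \<Sum>\<nu>\<in>G. b \<mu> * (b \<nu> * Z (\<iota> \<mu>) (\<iota> \<nu>)))"
    by (simp add: b_def mult_ac)
  also have "\<dots> = (\<Sum>\<mu>\<in>G. b \<mu> * (\<Sum>j\<in>\<iota> ` G. a j * Z (\<iota> \<mu>) j))"
  proof (rule sum.cong[OF refl])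
    fix \<mu>
    have "(\<Sum>\<nu>\<in>G. b \<nu> * Z (\<iota> \<mu>) (\<iota> \<nu>)) = (\<Sum>j\<in>\<iota> ` G. \<Sum>\<nu>\<in>{\<nu>\<in>G. \<iota> \<nu> = j}. b \<nu> * Z (\<iota> \<mu>) (\<iota> \<nu>))"
      by (rule sum.image_gen[OF G])
    also have "\<dots> = (\<Sum>j\<in>\<iota> ` G. a j * Z (\<iota> \<mu>) j)"
      by (simp add: a_def sum_distrib_right)
    finally show "(\<Sum>\<nu>\<in>G. b \<mu> * (b \<nu> * Z (\<iota> \<mu>) (\<iota> \<nu>))) = b \<mu> * (\<Sum>j\<in>\<iota> ` G. a j * Z (\<iota> \<mu>) j)"
      by (simp add: sum_distrib_left[symmetric])
  qed
  also have "\<dots> = (\<Sum>i\<in>\<iota> ` G. \<Sum>\<mu>\<in>{\<mu>\<in>G. \<iota> \<mu> = i}. b \<mu> * (\<Sum>j\<in>\<iota> ` G. a j * Z (\<iota> \<mu>) j))"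
    by (rule sum.image_gen[OF G])
  also have "\<dots> = (\<Sum>i\<in>\<iota> ` G. a i * (\<Sum>j\<in>\<iota> ` G. a j * Z i j))"
  proof (rule sum.cong[OF refl])
    fix i
    have "(\<Sum>\<mu>\<in>{\<mu>\<in>G. \<iota> \<mu> = i}. b \<mu> * (\<Sum>j\<in>\<iota> ` G. a j * Z (\<iota> \<mu>) j))
        = (\<Sum>\<mu>\<in>{\<mu>\<in>G. \<iota> \<mu> = i}. b \<mu> * (\<Sum>j\<in>\<iota> ` G. a j * Z i j))"
      by (rule sum.cong) auto
    then show "(\<Sum>\<mu>\<in>{\<mu>\<in>G. \<iota> \<mu> = i}. b \<mu> * (\<Sum>j\<in>\<iota> ` G. a j * Z (\<iota> \<mu>) j))
        = a i * (\<Sum>j\<in>\<iota> ` G. a j * Z i j)"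
      unfolding a_def[of i] sum_distrib_right .
  qed
  also have "\<dots> = (\<Sum>i\<in>\<iota> ` G. \<Sum>j\<in>\<iota> ` G. a i * a j * Z i j)"
    by (simp add: sum_distrib_left mult.assoc)
  finally show "0 \<le> (\<Sum>\<mu>\<in>G. \<Sum>\<nu>\<in>G. v \<mu> * v \<nu> * Z (\<iota> \<mu>) (\<iota> \<nu>) * (coord (\<rho> \<mu>) \<kappa> * coord (\<rho> \<nu>) \<kappa>))"
    using psd by simp
qed

lemma norm_sum_sq:
  fixes g :: "'n \<Rightarrow> 'h::real_inner"
  shows "(norm (\<Sum>\<nu>\<in>G. v \<nu> *\<^sub>R g \<nu>))\<^sup>2 = (\<Sum>\<mu>\<in>G. \<Sum>\<nu>\<in>G. v \<mu> * v \<nu> * inner (g \<mu>) (g \<nu>))"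
  unfolding power2_norm_eq_inner inner_sum_left unfolding inner_sum_right
  by (simp add: mult.assoc mult.left_commute)

text \<open>The Gram matrix of the tensors is the entrywise product of the Gram matrix in slot
  \<open>j\<close> and that of the remaining slots. The difference of the two sides is therefore a
  Schur product of positive semidefinite matrices. The remaining slots may depend on \<nu>
  arbitrarily, which allows one slot to be exchanged after another.\<close>

lemma norm_sum_tens_mono:
  fixes x y :: "'i \<Rightarrow> 'i ell2"
  assumes le: "\<And>F a. finite F \<Longrightarrow> (norm (\<Sum>\<nu>\<in>F. a \<nu> *\<^sub>R x \<nu>))\<^sup>2 \<le> (norm (\<Sum>\<nu>\<in>F. a \<nu> *\<^sub>R y \<nu>))\<^sup>2"
    and j: "j < d" and G: "finite G"
  shows "(norm (\<Sum>\<nu>\<in>G. v \<nu> *\<^sub>R tens d ((f \<nu>)(j := x (\<nu> j)))))\<^sup>2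
       \<le> (norm (\<Sum>\<nu>\<in>G. v \<nu> *\<^sub>R tens d ((f \<nu>)(j := y (\<nu> j)))))\<^sup>2"
proof -
  \<comment> \<open>Slot \<open>j\<close> is filled with a fixed unit vector so that it contributes
    the factor 1 to the inner products.\<close>
  define \<rho> where "\<rho> \<nu> = tens d ((f \<nu>)(j := unit_vec undefined))" for \<nu>
  have split: "inner (tens d ((f \<mu>)(j := p))) (tens d ((f \<nu>)(j := p'))) = inner p p' * inner (\<rho> \<mu>) (\<rho> \<nu>)"
    for \<mu> \<nu> p p'
  proof -
    have "(\<Prod>i\<in>{..<d} - {j}. inner (((f \<mu>)(j := p)) i) (((f \<nu>)(j := p')) i))
      = (\<Prod>i\<in>{..<d} - {j}. inner (((f \<mu>)(j := unit_vec undefined)) i) (((f \<nu>)(j := unit_vec undefined)) i))"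
      by (rule prod.cong) auto
    then show ?thesis unfolding \<rho>_def inner_tens using j
      by (simp add: prod.remove[of _ j] inner_unit_vec_left coord_unit_vec)
  qed
  have "0 \<le> (\<Sum>\<mu>\<in>G. \<Sum>\<nu>\<in>G. v \<mu> * v \<nu> *
      (inner (y (\<mu> j)) (y (\<nu> j)) - inner (x (\<mu> j)) (x (\<nu> j))) * inner (\<rho> \<mu>) (\<rho> \<nu>))"
  proof (rule schur_nonneg[where \<iota> = "\<lambda>\<mu>. \<mu> j" and Z = "\<lambda>a b. inner (y a) (y b) - inner (x a) (x b)"])
    fix a
    have "finite ((\<lambda>\<mu>. \<mu> j) ` G)" using G by simp
    from le[OF this, of a]
    show "0 \<le> (\<Sum>i\<in>(\<lambda>\<mu>. \<mu> j) ` G. \<Sum>k\<in>(\<lambda>\<mu>. \<mu> j) ` G. a i * a k * (inner (y i) (y k) - inner (x i) (x k)))"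
      by (simp add: norm_sum_sq right_diff_distrib sum_subtractf)
  qed (rule G)
  then show ?thesis unfolding norm_sum_sq split
    by (simp add: right_diff_distrib left_diff_distrib sum_subtractf mult.assoc)
qed

section \<open>Second order derivatives of tensor products in coordinates\<close>

text \<open>The form attains a positive minimum on the unit sphere; homogeneity extends the bound to
  all vectors.\<close>

lemma sym_pos_def_coercive:
  assumes "sym_pos_def d M"
  obtains \<gamma> where "0 < \<gamma>" "\<And>x :: nat \<Rightarrow> real. \<gamma> * (\<Sum>i<d. (x i)\<^sup>2) \<le> (\<Sum>i<d. \<Sum>j<d. x i * M i j * x j)"
proof -
  define Q where "Q x = (\<Sum>i<d. \<Sum>j<d. x i * M i j * x j)" for x :: "nat \<Rightarrow> real"
  define N where "N x = (\<Sum>i<d. (x i)\<^sup>2)" for x :: "nat \<Rightarrow> real"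
  \<comment> \<open>Coordinates from \<open>d\<close> on are pinned to 0, which makes the sphere
    compact in the product topology.\<close>
  define S where "S = (\<Pi>\<^sub>E i\<in>UNIV. if i < d then {-1..1} else {0::real}) \<inter> {x. N x = 1}"
  have pos: "0 < Q x" if "\<exists>i<d. x i \<noteq> 0" for x
    using assms that unfolding sym_pos_def_def Q_def by blast
  have coord_cont: "continuous_on A (\<lambda>x::nat \<Rightarrow> real. x i)" for A i
    by (rule continuous_on_subset[OF continuous_on_product_coordinates subset_UNIV])
  have contQ: "continuous_on A Q" for A
    unfolding Q_def by (intro continuous_intros coord_cont)
  have contN: "continuous_on UNIV N"
    unfolding N_def by (intro continuous_intros coord_cont)
  have "compact (\<Pi>\<^sub>E i\<in>UNIV. if i < d then {-1..1} else {0::real})"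
    unfolding compactin_euclidean_iff[symmetric] euclidean_product_topology[symmetric]
    by (subst compactin_PiE) auto
  moreover have "closed {x. N x = 1}"
    by (rule closed_Collect_eq[OF contN continuous_on_const])
  ultimately have cS: "compact S" unfolding S_def by (rule compact_Int_closed)
  have "\<exists>\<gamma>>0. \<forall>x\<in>S. \<gamma> \<le> Q x"
  \<comment> \<open>The sphere is empty when \<open>d = 0\<close>; any positive constant serves
    then.\<close>
  proof (cases "S = {}")
    case False
    then obtain z where z: "z \<in> S" "\<forall>x\<in>S. Q z \<le> Q x"
      using continuous_attains_inf[OF cS _ contQ] by blast
    then have "\<exists>i<d. z i \<noteq> 0" unfolding S_def N_def by (force intro: ccontr)
    then show ?thesis using pos z by blast
  qed (auto intro: exI[of _ 1])
  then obtain \<gamma> where \<gamma>: "0 < \<gamma>" "\<And>x. x \<in> S \<Longrightarrow> \<gamma> \<le> Q x" by blast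
  have "\<gamma> * N x \<le> Q x" for x
  proof (cases "N x = 0")
    case True
    then have "\<And>i. i < d \<Longrightarrow> x i = 0" unfolding N_def by (simp add: sum_nonneg_eq_0_iff)
    then have "Q x = 0" unfolding Q_def by simp
    then show ?thesis using True by simp
  next
    case False
    have N0: "0 \<le> N x" unfolding N_def by (intro sum_nonneg) auto
    define s where "s = sqrt (N x)"
    have s: "0 < s" "s\<^sup>2 = N x" using False N0 by (auto simp: s_def)
    define y where "y i = (if i < d then x i / s else 0)" for i
    have "N y = N x / s\<^sup>2" unfolding N_def y_def by (simp add: power_divide sum_divide_distrib)
    then have Ny: "N y = 1" using s False by simp
    have "y i \<in> {-1..1}" if "i < d" for i
    proof -
      have "(y i)\<^sup>2 \<le> N y" unfolding N_def using that by (intro member_le_sum) auto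
      then show ?thesis unfolding Ny by (simp add: abs_square_le_1 abs_le_iff)
    qed
    then have "y \<in> S" unfolding S_def using Ny by (auto simp: y_def)
    then have "\<gamma> \<le> Q y" by (rule \<gamma>(2))
    also have "Q y = Q x / s\<^sup>2" unfolding Q_def y_def by (simp add: sum_divide_distrib power2_eq_square)
    finally show ?thesis using s False N0 by (simp add: pos_le_divide_eq)
  qed
  with \<gamma>(1) show thesis unfolding Q_def N_def by (rule that)
qed

text \<open>\<open>r \<nu>\<close> and \<open>q \<nu>\<close> stand for the coordinates of \<open>\<psi>\<^sub>\<nu>'\<close> and \<open>- \<psi>\<^sub>\<nu>''\<close>. Then \<open>dd\<close> holds those of
  \<open>\<partial>\<^sub>i \<partial>\<^sub>j \<Psi>\<^sub>\<nu>\<close> and \<open>tvec\<close> those of \<open>A \<Psi>\<^sub>\<nu>\<close>; the pairs \<open>(s n, \<kappa> n)\<close> of the locale below are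
  eigenpairs of \<open>u \<mapsto> - u''\<close> with Dirichlet conditions.\<close>
definition dd :: "nat \<Rightarrow> ('i \<Rightarrow> 'i ell2) \<Rightarrow> ('i \<Rightarrow> 'i ell2) \<Rightarrow> nat \<Rightarrow> nat \<Rightarrow> (nat \<Rightarrow> 'i) \<Rightarrow> (nat \<Rightarrow> 'i) ell2" where
  "dd d r q i j \<nu> =
     (if i = j then - tens d ((\<lambda>k. unit_vec (\<nu> k))(i := q (\<nu> i)))
      else tens d ((\<lambda>k. unit_vec (\<nu> k))(i := r (\<nu> i), j := r (\<nu> j))))"

definition tvec :: "nat \<Rightarrow> ('i \<Rightarrow> 'i ell2) \<Rightarrow> ('i \<Rightarrow> 'i ell2) \<Rightarrow> (nat \<Rightarrow> nat \<Rightarrow> real) \<Rightarrow> (nat \<Rightarrow> 'i) \<Rightarrow> (nat \<Rightarrow> 'i) ell2" where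
  "tvec d r q M \<nu> = - (\<Sum>i<d. \<Sum>j<d. M i j *\<^sub>R dd d r q i j \<nu>)"

lemma dd_commute: "dd d r q i j = dd d r q j i"
  by (cases "i = j") (auto simp: dd_def fun_upd_twist)

lemma coord_dd_out: "\<kappa> \<notin> multi_idx d \<Longrightarrow> coord (dd d r q i j \<nu>) \<kappa> = 0"
  by (simp add: dd_def coord_tens_out)

lemma coord_tvec_out: "\<kappa> \<notin> multi_idx d \<Longrightarrow> coord (tvec d r q M \<nu>) \<kappa> = 0"
  by (simp add: tvec_def coord_sum coord_dd_out)

text \<open>Serves integration by parts in coordinate \<open>l\<close>, which changes the sign of
  one factor of a product of univariate integrals.\<close>

lemma prod_eq_uminus_at:
  fixes A B :: "'a \<Rightarrow> real"
  assumes "finite I" "l \<in> I" "A l = - B l" "\<And>m. m \<in> I \<Longrightarrow> m \<noteq> l \<Longrightarrow> A m = B m"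
  shows "prod A I = - prod B I"
proof -
  have "prod A (I - {l}) = prod B (I - {l})" by (rule prod.cong) (use assms in auto)
  then show ?thesis using assms by (simp add: prod.remove[of I l])
qed

text \<open>\<open>inner_r\<close> and \<open>r_antisym\<close> are the two integrations by parts
  available for Dirichlet functions, and \<open>l \<nu>\<close> plays the role of 4^|\<nu>|. In
  \<open>eigen\<close> the eigenfunctions are approximated in the graph norm, that is, with one set
  of coefficients for the function and for its second derivative; this replaces any mention of an
  operator domain.\<close>

locale second_order_system =
  fixes r q :: "'i \<Rightarrow> 'i ell2" and l :: "'i \<Rightarrow> real" and c C :: real
    and s :: "nat \<Rightarrow> 'i ell2" and \<kappa> :: "nat \<Rightarrow> real"
  assumes inner_r: "inner (r \<mu>) (r \<nu>) = coord (q \<nu>) \<mu>"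
    and r_antisym: "coord (r \<mu>) \<nu> = - coord (r \<nu>) \<mu>"
    and l_ge_1: "1 \<le> l \<nu>" and c_pos: "0 < c" and C_pos: "0 < C"
    and q_lower: "finite F \<Longrightarrow> c\<^sup>2 * (\<Sum>\<nu>\<in>F. (l \<nu> * a \<nu>)\<^sup>2) \<le> (norm (\<Sum>\<nu>\<in>F. a \<nu> *\<^sub>R q \<nu>))\<^sup>2"
    and q_upper: "finite F \<Longrightarrow> (norm (\<Sum>\<nu>\<in>F. a \<nu> *\<^sub>R q \<nu>))\<^sup>2 \<le> C\<^sup>2 * (\<Sum>\<nu>\<in>F. (l \<nu> * a \<nu>)\<^sup>2)"
    and \<kappa>_pos: "0 < \<kappa> n"
    and eigen: "(s n, \<kappa> n *\<^sub>R s n) \<in> closure (span (range (\<lambda>\<nu>. (unit_vec \<nu>, q \<nu>))))"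
    and s_total: "closure (span (range s)) = UNIV"
begin

lemma q_sym: "coord (q \<nu>) \<mu> = coord (q \<mu>) \<nu>"
  by (metis inner_r inner_commute)

lemma l_pos: "0 < l \<nu>"
  using l_ge_1[of \<nu>] by linarith

lemma s_total_orth:
  assumes "\<And>n. inner (s n) w = 0" shows "w = 0"
proof -
  have "span (range s) \<subseteq> {x. inner x w = 0}"
    by (rule span_minimal) (auto simp: subspace_def inner_add_left assms)
  moreover have "closed {x. inner x w = 0}"
    by (intro closed_Collect_eq continuous_intros)
  ultimately have "closure (span (range s)) \<subseteq> {x. inner x w = 0}" by (rule closure_minimal)
  then have "w \<in> {x. inner x w = 0}" unfolding s_total by blast
  then show ?thesis by simp
qed

text \<open>After rescaling only totality needs an argument: orthogonality to all
  \<open>q \<nu>\<close> is orthogonality to the second components of the graph, it passes to the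
  closure, and so reaches every multiple \<open>\<kappa> n\<close> of \<open>s n\<close>.\<close>

lemma riesz_1d: "riesz_family (\<lambda>\<nu>. inverse (l \<nu>) *\<^sub>R q \<nu>) c C"
proof
  fix F :: "'i set" and a :: "'i \<Rightarrow> real" assume F: "finite F"
  have "(l \<nu> * (a \<nu> * inverse (l \<nu>)))\<^sup>2 = (a \<nu>)\<^sup>2" for \<nu>
    using l_pos[of \<nu>] by (simp add: field_simps)
  with q_lower[OF F, of "\<lambda>\<nu>. a \<nu> * inverse (l \<nu>)"] q_upper[OF F, of "\<lambda>\<nu>. a \<nu> * inverse (l \<nu>)"]
  show "c\<^sup>2 * (\<Sum>\<nu>\<in>F. (a \<nu>)\<^sup>2) \<le> (norm (\<Sum>\<nu>\<in>F. a \<nu> *\<^sub>R inverse (l \<nu>) *\<^sub>R q \<nu>))\<^sup>2"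
    "(norm (\<Sum>\<nu>\<in>F. a \<nu> *\<^sub>R inverse (l \<nu>) *\<^sub>R q \<nu>))\<^sup>2 \<le> C\<^sup>2 * (\<Sum>\<nu>\<in>F. (a \<nu>)\<^sup>2)"
    by simp_all
next
  fix w assume w: "\<And>\<nu>. inner (inverse (l \<nu>) *\<^sub>R q \<nu>) w = 0"
  have w: "inner (q \<nu>) w = 0" for \<nu> using w[of \<nu>] l_pos[of \<nu>] by simp
  have "span (range (\<lambda>\<nu>. (unit_vec \<nu>, q \<nu>))) \<subseteq> {p. inner (snd p) w = 0}"
    by (rule span_minimal) (auto simp: subspace_def inner_add_left w)
  moreover have "closed {p::'i ell2 \<times> 'i ell2. inner (snd p) w = 0}"
    by (intro closed_Collect_eq continuous_intros)
  ultimately have "closure (span (range (\<lambda>\<nu>. (unit_vec \<nu>, q \<nu>)))) \<subseteq> {p. inner (snd p) w = 0}"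
    by (rule closure_minimal)
  then have "inner (\<kappa> n *\<^sub>R s n) w = 0" for n using eigen[of n] by auto
  then have "inner (s n) w = 0" for n
    using \<kappa>_pos[of n] by (metis inner_scaleR_left mult_eq_0_iff order_less_irrefl)
  then show "w = 0" by (rule s_total_orth)
qed (rule c_pos C_pos)+

lemma norm_sum_r:
  "(norm (\<Sum>\<nu>\<in>F. a \<nu> *\<^sub>R r \<nu>))\<^sup>2 = (\<Sum>\<mu>\<in>F. \<Sum>\<nu>\<in>F. a \<mu> * a \<nu> * coord (q \<nu>) \<mu>)"
  by (simp add: norm_sum_sq inner_r)

text \<open>The Gram matrix of \<open>r\<close> is the matrix with columns \<open>q\<close>, so
  \<open>form_bounds_of_riesz\<close> applies, its positivity premise being that of a squared norm.
  Compared with \<open>q_lower\<close> and \<open>q_upper\<close>, both the constants and the weight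
  lose their squares.\<close>

lemma r_bounds:
  assumes "finite F"
  shows "c * (\<Sum>\<nu>\<in>F. l \<nu> * (a \<nu>)\<^sup>2) \<le> (norm (\<Sum>\<nu>\<in>F. a \<nu> *\<^sub>R r \<nu>))\<^sup>2"
    and "(norm (\<Sum>\<nu>\<in>F. a \<nu> *\<^sub>R r \<nu>))\<^sup>2 \<le> C * (\<Sum>\<nu>\<in>F. l \<nu> * (a \<nu>)\<^sup>2)"
  unfolding norm_sum_r
  using form_bounds_of_riesz[OF l_ge_1 riesz_1d q_sym _ assms, of a]
  by (simp_all flip: norm_sum_r)

section \<open>Second derivatives of finite combinations: norm bounds and integration by
  parts\<close>

definition DD :: "nat \<Rightarrow> (nat \<Rightarrow> 'i) set \<Rightarrow> ((nat \<Rightarrow> 'i) \<Rightarrow> real) \<Rightarrow> nat \<Rightarrow> nat \<Rightarrow> (nat \<Rightarrow> 'i) ell2" where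
  "DD d G v i j = (\<Sum>\<nu>\<in>G. v \<nu> *\<^sub>R dd d r q i j \<nu>)"

lemma norm_sum_scaled_unit_vec:
  "finite F \<Longrightarrow> (norm (\<Sum>\<nu>\<in>F. a \<nu> *\<^sub>R b \<nu> *\<^sub>R unit_vec \<nu>))\<^sup>2 = (\<Sum>\<nu>\<in>F. (b \<nu> * a \<nu>)\<^sup>2)"
  using norm_sum_unit_vec[of F "\<lambda>\<nu>. b \<nu> * a \<nu>"] by (simp add: mult.commute)

text \<open>Slot \<open>i\<close> is compared with the unit vectors scaled by \<open>c * l\<close>
  or \<open>C * l\<close>; the resulting tensors are orthogonal and their combination has an
  explicit norm.\<close>

lemma DD_diag_bounds:
  assumes G: "finite G" "G \<subseteq> multi_idx d" and i: "i < d"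
  shows "c\<^sup>2 * (\<Sum>\<nu>\<in>G. (l (\<nu> i) * v \<nu>)\<^sup>2) \<le> (norm (DD d G v i i))\<^sup>2"
    and "(norm (DD d G v i i))\<^sup>2 \<le> C\<^sup>2 * (\<Sum>\<nu>\<in>G. (l (\<nu> i) * v \<nu>)\<^sup>2)"
proof -
  have eq: "(norm (DD d G v i i))\<^sup>2
      = (norm (\<Sum>\<nu>\<in>G. v \<nu> *\<^sub>R tens d ((\<lambda>k. unit_vec (\<nu> k))(i := q (\<nu> i)))))\<^sup>2"
    by (simp add: DD_def dd_def sum_negf)
  have unit: "(norm (\<Sum>\<nu>\<in>G. v \<nu> *\<^sub>R tens d ((\<lambda>k. unit_vec (\<nu> k))(i := (b * l (\<nu> i)) *\<^sub>R unit_vec (\<nu> i)))))\<^sup>2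
      = b\<^sup>2 * (\<Sum>\<nu>\<in>G. (l (\<nu> i) * v \<nu>)\<^sup>2)" for b
  proof -
    have "tens d ((\<lambda>k. unit_vec (\<nu> k))(i := (b * l (\<nu> i)) *\<^sub>R unit_vec (\<nu> i))) = (b * l (\<nu> i)) *\<^sub>R unit_vec \<nu>"
      if "\<nu> \<in> G" for \<nu>
      using that G(2) by (auto simp: tens_scaleR[OF i] fun_upd_idem tens_unit_vec)
    then have "(\<Sum>\<nu>\<in>G. v \<nu> *\<^sub>R tens d ((\<lambda>k. unit_vec (\<nu> k))(i := (b * l (\<nu> i)) *\<^sub>R unit_vec (\<nu> i))))
        = (\<Sum>\<nu>\<in>G. v \<nu> *\<^sub>R (b * l (\<nu> i)) *\<^sub>R unit_vec \<nu>)" by (intro sum.cong) auto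
    then show ?thesis unfolding norm_sum_scaled_unit_vec[OF G(1)]
      by (simp only: norm_sum_scaled_unit_vec[OF G(1)]) (simp add: sum_distrib_left power_mult_distrib mult.assoc)
  qed
  show "c\<^sup>2 * (\<Sum>\<nu>\<in>G. (l (\<nu> i) * v \<nu>)\<^sup>2) \<le> (norm (DD d G v i i))\<^sup>2"
    unfolding eq unit[of c, symmetric]
  proof (rule norm_sum_tens_mono[OF _ i G(1)])
    fix F :: "'i set" and a assume F: "finite F"
    show "(norm (\<Sum>\<nu>\<in>F. a \<nu> *\<^sub>R (c * l \<nu>) *\<^sub>R unit_vec \<nu>))\<^sup>2 \<le> (norm (\<Sum>\<nu>\<in>F. a \<nu> *\<^sub>R q \<nu>))\<^sup>2"
      unfolding norm_sum_scaled_unit_vec[OF F] using q_lower[OF F, of a]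
      by (simp add: sum_distrib_left power_mult_distrib mult.assoc)
  qed
  show "(norm (DD d G v i i))\<^sup>2 \<le> C\<^sup>2 * (\<Sum>\<nu>\<in>G. (l (\<nu> i) * v \<nu>)\<^sup>2)"
    unfolding eq unit[of C, symmetric]
  proof (rule norm_sum_tens_mono[OF _ i G(1)])
    fix F :: "'i set" and a assume F: "finite F"
    show "(norm (\<Sum>\<nu>\<in>F. a \<nu> *\<^sub>R q \<nu>))\<^sup>2 \<le> (norm (\<Sum>\<nu>\<in>F. a \<nu> *\<^sub>R (C * l \<nu>) *\<^sub>R unit_vec \<nu>))\<^sup>2"
      unfolding norm_sum_scaled_unit_vec[OF F] using q_upper[OF F, of a]
      by (simp add: sum_distrib_left power_mult_distrib mult.assoc)
  qed
qed

text \<open>The two slots are exchanged one after the other. Each exchange costs one factor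
  \<open>c\<close> or \<open>C\<close> in the squared norm, so together they cost
  \<open>c\<^sup>2\<close> or \<open>C\<^sup>2\<close>, as a pure second derivative does.\<close>

lemma DD_offdiag_bounds:
  assumes G: "finite G" "G \<subseteq> multi_idx d" and i: "i < d" and j: "j < d" and ij: "i \<noteq> j"
  shows "c\<^sup>2 * (\<Sum>\<nu>\<in>G. l (\<nu> i) * l (\<nu> j) * (v \<nu>)\<^sup>2) \<le> (norm (DD d G v i j))\<^sup>2"
    and "(norm (DD d G v i j))\<^sup>2 \<le> C\<^sup>2 * (\<Sum>\<nu>\<in>G. l (\<nu> i) * l (\<nu> j) * (v \<nu>)\<^sup>2)"
proof -
  \<comment> \<open>Comparison vectors whose squared norm carries the weight
    \<open>b * l \<nu>\<close> of \<open>r_bounds\<close>.\<close>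
  define y where "y b \<nu> = sqrt (b * l \<nu>) *\<^sub>R (unit_vec \<nu> :: 'i ell2)" for b \<nu>
  define f where "f x y \<nu> = tens d ((\<lambda>k. unit_vec (\<nu> k))(i := x (\<nu> i), j := y (\<nu> j)))"
    for x y :: "'i \<Rightarrow> 'i ell2" and \<nu>
  \<comment> \<open>\<open>norm_sum_tens_mono\<close> acts on the outermost update, so both orders
    of the two updates are needed.\<close>
  have f_swap: "f x y' \<nu> = tens d ((\<lambda>k. unit_vec (\<nu> k))(j := y' (\<nu> j), i := x (\<nu> i)))" for x y' \<nu>
    unfolding f_def using ij by (simp add: fun_upd_twist)
  have eq: "(norm (DD d G v i j))\<^sup>2 = (norm (\<Sum>\<nu>\<in>G. v \<nu> *\<^sub>R f r r \<nu>))\<^sup>2"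
    using ij by (simp add: DD_def dd_def f_def)
  have norm_y: "(norm (\<Sum>\<nu>\<in>F. a \<nu> *\<^sub>R y b \<nu>))\<^sup>2 = b * (\<Sum>\<nu>\<in>F. l \<nu> * (a \<nu>)\<^sup>2)"
    if "finite F" "0 < b" for F a b
    unfolding y_def norm_sum_scaled_unit_vec[OF that(1)]
    using that l_pos by (simp add: power_mult_distrib sum_distrib_left mult.assoc less_imp_le)
  have unit: "(norm (\<Sum>\<nu>\<in>G. v \<nu> *\<^sub>R f (y b) (y b) \<nu>))\<^sup>2 = b\<^sup>2 * (\<Sum>\<nu>\<in>G. l (\<nu> i) * l (\<nu> j) * (v \<nu>)\<^sup>2)"
    if b: "0 < b" for b
  proof -
    have "f (y b) (y b) \<nu> = (sqrt (b * l (\<nu> j)) * sqrt (b * l (\<nu> i))) *\<^sub>R unit_vec \<nu>"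
      if "\<nu> \<in> G" for \<nu>
    proof -
      have "f (y b) (y b) \<nu> = sqrt (b * l (\<nu> i)) *\<^sub>R
          tens d ((\<lambda>k. unit_vec (\<nu> k))(j := sqrt (b * l (\<nu> j)) *\<^sub>R unit_vec (\<nu> j), i := unit_vec (\<nu> i)))"
        unfolding f_swap y_def tens_scaleR[OF i] ..
      also have "\<dots> = sqrt (b * l (\<nu> i)) *\<^sub>R sqrt (b * l (\<nu> j)) *\<^sub>R
          tens d ((\<lambda>k. unit_vec (\<nu> k))(i := unit_vec (\<nu> i), j := unit_vec (\<nu> j)))"
        unfolding fun_upd_twist[OF ij[symmetric]] tens_scaleR[OF j] ..
      also have "(\<lambda>k. unit_vec (\<nu> k))(i := unit_vec (\<nu> i), j := unit_vec (\<nu> j)) = (\<lambda>k. unit_vec (\<nu> k))"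
        by auto
      moreover have "tens d (\<lambda>k. unit_vec (\<nu> k)) = unit_vec \<nu>"
        using that G(2) by (auto intro: tens_unit_vec)
      ultimately show ?thesis by (simp add: mult.commute)
    qed
    then have "(\<Sum>\<nu>\<in>G. v \<nu> *\<^sub>R f (y b) (y b) \<nu>)
        = (\<Sum>\<nu>\<in>G. v \<nu> *\<^sub>R (sqrt (b * l (\<nu> j)) * sqrt (b * l (\<nu> i))) *\<^sub>R unit_vec \<nu>)"
      by (intro sum.cong) auto
    then show ?thesis
      using b l_pos by (simp only: norm_sum_scaled_unit_vec[OF G(1)])
        (simp add: sum_distrib_left power_mult_distrib mult_ac less_imp_le power2_eq_square[of b])
  qed
  show "c\<^sup>2 * (\<Sum>\<nu>\<in>G. l (\<nu> i) * l (\<nu> j) * (v \<nu>)\<^sup>2) \<le> (norm (DD d G v i j))\<^sup>2"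
  proof -
    have le: "(norm (\<Sum>\<nu>\<in>F. a \<nu> *\<^sub>R y c \<nu>))\<^sup>2 \<le> (norm (\<Sum>\<nu>\<in>F. a \<nu> *\<^sub>R r \<nu>))\<^sup>2" if "finite F" for F a
      unfolding norm_y[OF that c_pos] by (rule r_bounds(1)[OF that])
    have "(norm (\<Sum>\<nu>\<in>G. v \<nu> *\<^sub>R f (y c) (y c) \<nu>))\<^sup>2 \<le> (norm (\<Sum>\<nu>\<in>G. v \<nu> *\<^sub>R f (y c) r \<nu>))\<^sup>2"
      unfolding f_def by (rule norm_sum_tens_mono[OF le j G(1)])
    also have "\<dots> \<le> (norm (\<Sum>\<nu>\<in>G. v \<nu> *\<^sub>R f r r \<nu>))\<^sup>2"
      unfolding f_swap by (rule norm_sum_tens_mono[OF le i G(1)])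
    finally show ?thesis unfolding eq unit[OF c_pos] .
  qed
  show "(norm (DD d G v i j))\<^sup>2 \<le> C\<^sup>2 * (\<Sum>\<nu>\<in>G. l (\<nu> i) * l (\<nu> j) * (v \<nu>)\<^sup>2)"
  proof -
    have le: "(norm (\<Sum>\<nu>\<in>F. a \<nu> *\<^sub>R r \<nu>))\<^sup>2 \<le> (norm (\<Sum>\<nu>\<in>F. a \<nu> *\<^sub>R y C \<nu>))\<^sup>2" if "finite F" for F a
      unfolding norm_y[OF that C_pos] by (rule r_bounds(2)[OF that])
    have "(norm (\<Sum>\<nu>\<in>G. v \<nu> *\<^sub>R f r r \<nu>))\<^sup>2 \<le> (norm (\<Sum>\<nu>\<in>G. v \<nu> *\<^sub>R f r (y C) \<nu>))\<^sup>2"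
      unfolding f_def by (rule norm_sum_tens_mono[OF le j G(1)])
    also have "\<dots> \<le> (norm (\<Sum>\<nu>\<in>G. v \<nu> *\<^sub>R f (y C) (y C) \<nu>))\<^sup>2"
      unfolding f_swap by (rule norm_sum_tens_mono[OF le i G(1)])
    finally show ?thesis unfolding eq unit[OF C_pos] .
  qed
qed

text \<open>One pair of constants for all \<open>i\<close> and \<open>j\<close>, pure or mixed: the
  source of the independence of \<open>d\<close>.\<close>

lemma DD_bounds:
  assumes G: "finite G" "G \<subseteq> multi_idx d" and i: "i < d" and j: "j < d"
  shows "c\<^sup>2 * (\<Sum>\<nu>\<in>G. l (\<nu> i) * l (\<nu> j) * (v \<nu>)\<^sup>2) \<le> (norm (DD d G v i j))\<^sup>2"
    and "(norm (DD d G v i j))\<^sup>2 \<le> C\<^sup>2 * (\<Sum>\<nu>\<in>G. l (\<nu> i) * l (\<nu> j) * (v \<nu>)\<^sup>2)"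
  using DD_diag_bounds[OF G i, of v] DD_offdiag_bounds[OF G i j, of v]
  by (cases "i = j"; simp add: power_mult_distrib power2_eq_square[of "l _"])+

text \<open>Integration by parts, the boundary terms of which vanish on the tensor products.\<close>
lemma inner_dd:
  assumes "i < d" "k < d" "m < d" and that: "k \<noteq> i" "m \<noteq> i"
  shows "inner (dd d r q k m \<mu>) (dd d r q i i \<nu>) = inner (dd d r q k i \<mu>) (dd d r q m i \<nu>)"
proof -
  have qr: "inner (unit_vec \<mu>) (q \<nu>) = inner (r \<mu>) (r \<nu>)" "inner (q \<mu>) (unit_vec \<nu>) = inner (r \<mu>) (r \<nu>)" for \<mu> \<nu>
    by (simp_all add: inner_unit_vec_left inner_unit_vec_right inner_r q_sym[of \<mu>])
  have re: "inner (r \<mu>) (unit_vec \<nu>) = - inner (unit_vec \<mu>) (r \<nu>)" for \<mu> \<nu>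
    by (simp add: inner_unit_vec_left inner_unit_vec_right r_antisym[of \<mu>])
  show ?thesis
  proof (cases "k = m")
    case True
    then show ?thesis using that
      by (auto simp: dd_def inner_tens qr intro!: prod.cong)
  next
    case False
    \<comment> \<open>In coordinate \<open>m\<close> the derivative moves to the other factor and
      changes the sign. In coordinate \<open>i\<close> one of two derivatives moves, without a sign
      because \<open>q\<close> stands for minus the second derivative. The sign on the right cancels
      against the one in \<open>dd d r q i i\<close>.\<close>
    have "(\<Prod>n<d. inner (((\<lambda>k. unit_vec (\<mu> k))(k := r (\<mu> k), m := r (\<mu> m))) n) (((\<lambda>k. unit_vec (\<nu> k))(i := q (\<nu> i))) n))
      = - (\<Prod>n<d. inner (((\<lambda>k. unit_vec (\<mu> k))(k := r (\<mu> k), i := r (\<mu> i))) n) (((\<lambda>k. unit_vec (\<nu> k))(m := r (\<nu> m), i := r (\<nu> i))) n))"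
      by (rule prod_eq_uminus_at[where l = m]) (use assms that False in \<open>auto simp: qr re\<close>)
    then show ?thesis using that False by (simp add: dd_def inner_tens)
  qed
qed

lemma inner_DD:
  assumes "i < d" "k < d" "m < d"
  shows "inner (DD d G v k m) (DD d G v i i) = inner (DD d G v k i) (DD d G v m i)"
proof (cases "k = i \<or> m = i")
  case True
  then show ?thesis
  proof
    assume "k = i"
    then show ?thesis by (simp add: DD_def dd_commute[of d r q m i] inner_commute)
  qed simp
next
  case False
  then show ?thesis
    unfolding DD_def inner_sum_left unfolding inner_sum_right by (simp add: inner_dd assms)
qed

lemma sum_tvec: "(\<Sum>\<nu>\<in>G. v \<nu> *\<^sub>R tvec d r q M \<nu>) = - (\<Sum>i<d. \<Sum>j<d. M i j *\<^sub>R DD d G v i j)"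
proof -
  have "(\<Sum>\<nu>\<in>G. v \<nu> *\<^sub>R tvec d r q M \<nu>) = - (\<Sum>\<nu>\<in>G. \<Sum>i<d. \<Sum>j<d. M i j *\<^sub>R v \<nu> *\<^sub>R dd d r q i j \<nu>)"
    unfolding tvec_def by (simp add: scaleR_sum_right sum_negf mult.commute)
  also have "(\<Sum>\<nu>\<in>G. \<Sum>i<d. \<Sum>j<d. M i j *\<^sub>R v \<nu> *\<^sub>R dd d r q i j \<nu>)
      = (\<Sum>i<d. \<Sum>\<nu>\<in>G. \<Sum>j<d. M i j *\<^sub>R v \<nu> *\<^sub>R dd d r q i j \<nu>)" by (rule sum.swap)
  also have "\<dots> = (\<Sum>i<d. \<Sum>j<d. M i j *\<^sub>R DD d G v i j)"
    unfolding DD_def scaleR_sum_right by (rule sum.cong[OF refl], rule sum.swap)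
  finally show ?thesis .
qed

lemma sum_tvec_diagonal:
  assumes "is_diagonal d M"
  shows "(\<Sum>\<nu>\<in>G. v \<nu> *\<^sub>R tvec d r q M \<nu>) = - (\<Sum>i<d. M i i *\<^sub>R DD d G v i i)"
proof -
  have "(\<Sum>j<d. M i j *\<^sub>R DD d G v i j) = M i i *\<^sub>R DD d G v i i" if "i < d" for i
  proof -
    have "(\<Sum>j<d. M i j *\<^sub>R DD d G v i j) = (\<Sum>j\<in>{i}. M i j *\<^sub>R DD d G v i j)"
      by (rule sum.mono_neutral_right) (use that assms in \<open>auto simp: is_diagonal_def\<close>)
    then show ?thesis by simp
  qed
  then show ?thesis unfolding sum_tvec by (intro arg_cong[where f = uminus] sum.cong) auto
qed

lemma diagonal_bounds:
  assumes M: "is_diagonal d M" "\<And>i. i < d \<Longrightarrow> 0 \<le> M i i" and G: "finite G" "G \<subseteq> multi_idx d"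
  shows "c\<^sup>2 * (\<Sum>\<nu>\<in>G. ((\<Sum>i<d. M i i * l (\<nu> i)) * v \<nu>)\<^sup>2) \<le> (norm (\<Sum>\<nu>\<in>G. v \<nu> *\<^sub>R tvec d r q M \<nu>))\<^sup>2"
    and "(norm (\<Sum>\<nu>\<in>G. v \<nu> *\<^sub>R tvec d r q M \<nu>))\<^sup>2 \<le> C\<^sup>2 * (\<Sum>\<nu>\<in>G. ((\<Sum>i<d. M i i * l (\<nu> i)) * v \<nu>)\<^sup>2)"
proof -
  have eq: "(norm (\<Sum>\<nu>\<in>G. v \<nu> *\<^sub>R tvec d r q M \<nu>))\<^sup>2
      = (\<Sum>i<d. \<Sum>j<d. M i i * M j j * (norm (DD d G v i j))\<^sup>2)"
    unfolding sum_tvec_diagonal[OF M(1)] norm_minus_cancel norm_sum_sq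
  proof (intro sum.cong refl)
    fix i j assume "i \<in> {..<d}" "j \<in> {..<d}"
    then show "M i i * M j j * inner (DD d G v i i) (DD d G v j j) = M i i * M j j * (norm (DD d G v i j))\<^sup>2"
      using inner_DD[of j d i i G v] by (simp add: power2_norm_eq_inner)
  qed
  \<comment> \<open>The squared weight is a double sum over the same pairs as \<open>eq\<close>, so
    the comparison can be made term by term with nonnegative coefficients
    \<open>M i i * M j j\<close>.\<close>
  have expand: "b * (\<Sum>\<nu>\<in>G. ((\<Sum>i<d. M i i * l (\<nu> i)) * v \<nu>)\<^sup>2)
      = (\<Sum>i<d. \<Sum>j<d. M i i * M j j * (b * (\<Sum>\<nu>\<in>G. l (\<nu> i) * l (\<nu> j) * (v \<nu>)\<^sup>2)))" for b
  proof -
    have "b * (\<Sum>\<nu>\<in>G. ((\<Sum>i<d. M i i * l (\<nu> i)) * v \<nu>)\<^sup>2)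
        = (\<Sum>\<nu>\<in>G. \<Sum>i<d. \<Sum>j<d. M i i * M j j * (b * (l (\<nu> i) * l (\<nu> j) * (v \<nu>)\<^sup>2)))"
      unfolding sum_distrib_left power_mult_distrib power2_eq_square[of "sum _ _"] sum_product
      by (simp add: sum_distrib_left sum_distrib_right mult_ac)
    also have "\<dots> = (\<Sum>i<d. \<Sum>\<nu>\<in>G. \<Sum>j<d. M i i * M j j * (b * (l (\<nu> i) * l (\<nu> j) * (v \<nu>)\<^sup>2)))"
      by (rule sum.swap)
    also have "\<dots> = (\<Sum>i<d. \<Sum>j<d. M i i * M j j * (b * (\<Sum>\<nu>\<in>G. l (\<nu> i) * l (\<nu> j) * (v \<nu>)\<^sup>2)))"
      unfolding sum_distrib_left by (rule sum.cong[OF refl], rule sum.swap)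
    finally show ?thesis .
  qed
  show "c\<^sup>2 * (\<Sum>\<nu>\<in>G. ((\<Sum>i<d. M i i * l (\<nu> i)) * v \<nu>)\<^sup>2) \<le> (norm (\<Sum>\<nu>\<in>G. v \<nu> *\<^sub>R tvec d r q M \<nu>))\<^sup>2"
    unfolding eq expand using M(2) by (intro sum_mono mult_left_mono DD_bounds G) auto
  show "(norm (\<Sum>\<nu>\<in>G. v \<nu> *\<^sub>R tvec d r q M \<nu>))\<^sup>2 \<le> C\<^sup>2 * (\<Sum>\<nu>\<in>G. ((\<Sum>i<d. M i i * l (\<nu> i)) * v \<nu>)\<^sup>2)"
    unfolding eq expand using M(2) by (intro sum_mono mult_left_mono DD_bounds G) auto
qed

end

section \<open>Comparison of the general operator with the Laplacian\<close>

context second_order_system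
begin

lemma sum_tvec_laplacian:
  "(\<Sum>\<nu>\<in>G. v \<nu> *\<^sub>R tvec d r q (\<lambda>i j. if i = j then 1 else 0) \<nu>) = - (\<Sum>i<d. DD d G v i i)"
  by (subst sum_tvec_diagonal) (auto simp: is_diagonal_def)

text \<open>Moving one derivative across shows that the Laplacian has exactly the norm of the full
  Hessian.\<close>

lemma norm_laplacian_sq:
  "(norm (\<Sum>i<d. DD d G v i i))\<^sup>2 = (\<Sum>i<d. \<Sum>k<d. (norm (DD d G v k i))\<^sup>2)"
proof -
  have "(norm (\<Sum>i<d. DD d G v i i))\<^sup>2 = (\<Sum>k<d. \<Sum>i<d. inner (DD d G v k k) (DD d G v i i))"
    unfolding power2_norm_eq_inner inner_sum_left unfolding inner_sum_right ..
  also have "\<dots> = (\<Sum>k<d. \<Sum>i<d. (norm (DD d G v k i))\<^sup>2)"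
  proof (intro sum.cong refl)
    fix k i assume "k \<in> {..<d}" "i \<in> {..<d}"
    then show "inner (DD d G v k k) (DD d G v i i) = (norm (DD d G v k i))\<^sup>2"
      using inner_DD[of i d k k G v] by (simp add: power2_norm_eq_inner)
  qed
  also have "\<dots> = (\<Sum>i<d. \<Sum>k<d. (norm (DD d G v k i))\<^sup>2)" by (rule sum.swap)
  finally show ?thesis .
qed

text \<open>\<open>M\<close> minus \<open>\<gamma>\<close> times the identity is positive
  semidefinite, and so is its Schur product with the Gram matrix of \<open>x\<close>. In the
  instance of \<open>schur_nonneg\<close> all coefficients are 1 and \<open>\<iota>\<close> is the
  identity.\<close>

lemma coercive_vectors:
  fixes x :: "nat \<Rightarrow> 'k ell2"
  assumes "\<And>y :: nat \<Rightarrow> real. \<gamma> * (\<Sum>i<d. (y i)\<^sup>2) \<le> (\<Sum>i<d. \<Sum>j<d. y i * M i j * y j)"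
  shows "\<gamma> * (\<Sum>k<d. (norm (x k))\<^sup>2) \<le> (\<Sum>k<d. \<Sum>m<d. M k m * inner (x k) (x m))"
proof -
  have delta: "(\<Sum>i<d. \<Sum>j<d. f i j * (if i = j then \<gamma> else 0)) = \<gamma> * (\<Sum>i<d. f i i)" for f :: "nat \<Rightarrow> nat \<Rightarrow> real"
    by (simp add: sum_distrib_left mult.commute if_distrib[of "\<lambda>z. _ * z"] cong: if_cong)
  have "0 \<le> (\<Sum>k<d. \<Sum>m<d. 1 * 1 * (M (id k) (id m) - (if id k = id m then \<gamma> else 0)) * inner (x k) (x m))"
  proof (rule schur_nonneg)
    fix y :: "nat \<Rightarrow> real"
    have "(\<Sum>i<d. \<Sum>j<d. y i * y j * (M i j - (if i = j then \<gamma> else 0)))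
        = (\<Sum>i<d. \<Sum>j<d. y i * M i j * y j) - (\<Sum>i<d. \<Sum>j<d. (y i * y j) * (if i = j then \<gamma> else 0))"
      unfolding right_diff_distrib sum_subtractf by (simp add: mult_ac)
    then show "0 \<le> (\<Sum>i\<in>id ` {..<d}. \<Sum>j\<in>id ` {..<d}. y i * y j * (M i j - (if i = j then \<gamma> else 0)))"
      unfolding delta using assms[of y] by (simp add: power2_eq_square)
  qed simp
  moreover have "(\<Sum>k<d. \<Sum>m<d. 1 * 1 * (M (id k) (id m) - (if id k = id m then \<gamma> else 0)) * inner (x k) (x m))
     = (\<Sum>k<d. \<Sum>m<d. M k m * inner (x k) (x m)) - (\<Sum>k<d. \<Sum>m<d. inner (x k) (x m) * (if k = m then \<gamma> else 0))"
    by (simp add: left_diff_distrib right_diff_distrib sum_subtractf mult_ac)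
  ultimately show ?thesis unfolding delta by (simp add: power2_norm_eq_inner)
qed

text \<open>For each fixed \<open>i\<close>, \<open>coercive_vectors\<close> is applied to the
  column \<open>DD d G v k i\<close> of the Hessian; \<open>inner_DD\<close> then reassembles the
  sum over \<open>i\<close> into the inner product with the Laplacian.\<close>

lemma tvec_coercive:
  assumes "\<And>y :: nat \<Rightarrow> real. \<gamma> * (\<Sum>i<d. (y i)\<^sup>2) \<le> (\<Sum>i<d. \<Sum>j<d. y i * M i j * y j)"
  shows "\<gamma> * (norm (\<Sum>i<d. DD d G v i i))\<^sup>2
     \<le> inner (\<Sum>k<d. \<Sum>m<d. M k m *\<^sub>R DD d G v k m) (\<Sum>i<d. DD d G v i i)"
proof -
  have "\<gamma> * (norm (\<Sum>i<d. DD d G v i i))\<^sup>2 = (\<Sum>i<d. \<gamma> * (\<Sum>k<d. (norm (DD d G v k i))\<^sup>2))"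
    by (simp add: norm_laplacian_sq sum_distrib_left)
  also have "\<dots> \<le> (\<Sum>i<d. \<Sum>k<d. \<Sum>m<d. M k m * inner (DD d G v k i) (DD d G v m i))"
    by (intro sum_mono coercive_vectors assms)
  also have "\<dots> = (\<Sum>i<d. \<Sum>k<d. \<Sum>m<d. M k m * inner (DD d G v k m) (DD d G v i i))"
    by (intro sum.cong refl arg_cong2[where f = times] inner_DD[symmetric]) auto
  also have "\<dots> = inner (\<Sum>k<d. \<Sum>m<d. M k m *\<^sub>R DD d G v k m) (\<Sum>i<d. DD d G v i i)"
    by (simp add: inner_sum_left inner_sum_right)
  finally show ?thesis .
qed

text \<open>Every single entry of the Hessian is dominated by the Laplacian, by
  \<open>norm_laplacian_sq\<close>.\<close>

lemma tvec_le_laplacian: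
  "norm (\<Sum>k<d. \<Sum>m<d. M k m *\<^sub>R DD d G v k m) \<le> (\<Sum>k<d. \<Sum>m<d. \<bar>M k m\<bar>) * norm (\<Sum>i<d. DD d G v i i)"
proof -
  have le: "norm (DD d G v k m) \<le> norm (\<Sum>i<d. DD d G v i i)" if "k < d" "m < d" for k m
  proof (rule power2_le_imp_le)
    have "(norm (DD d G v k m))\<^sup>2 \<le> (\<Sum>k<d. (norm (DD d G v k m))\<^sup>2)"
      using that by (intro member_le_sum[where f = "\<lambda>k. (norm (DD d G v k m))\<^sup>2"]) auto
    also have "\<dots> \<le> (\<Sum>i<d. \<Sum>k<d. (norm (DD d G v k i))\<^sup>2)"
      using that by (intro member_le_sum[where f = "\<lambda>i. \<Sum>k<d. (norm (DD d G v k i))\<^sup>2"] sum_nonneg) auto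
    finally show "(norm (DD d G v k m))\<^sup>2 \<le> (norm (\<Sum>i<d. DD d G v i i))\<^sup>2" unfolding norm_laplacian_sq .
  qed simp
  have "norm (\<Sum>k<d. \<Sum>m<d. M k m *\<^sub>R DD d G v k m) \<le> (\<Sum>k<d. \<Sum>m<d. norm (M k m *\<^sub>R DD d G v k m))"
    by (intro order_trans[OF norm_sum] sum_mono norm_sum)
  also have "\<dots> \<le> (\<Sum>k<d. \<Sum>m<d. \<bar>M k m\<bar> * norm (\<Sum>i<d. DD d G v i i))"
    by (intro sum_mono) (auto intro!: mult_left_mono le)
  finally show ?thesis by (simp add: sum_distrib_right)
qed

text \<open>The bounds for the Laplacian are \<open>diagonal_bounds\<close> for the identity matrix.
  Coercivity, with one norm of the Laplacian cancelled, transfers the lower one to \<open>M\<close>,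
  and \<open>tvec_le_laplacian\<close> the upper one.\<close>

lemma general_bounds:
  assumes \<gamma>: "0 < \<gamma>" "\<And>y :: nat \<Rightarrow> real. \<gamma> * (\<Sum>i<d. (y i)\<^sup>2) \<le> (\<Sum>i<d. \<Sum>j<d. y i * M i j * y j)"
    and G: "finite G" "G \<subseteq> multi_idx d"
  shows "(\<gamma> * c)\<^sup>2 * (\<Sum>\<nu>\<in>G. ((\<Sum>i<d. l (\<nu> i)) * v \<nu>)\<^sup>2) \<le> (norm (\<Sum>\<nu>\<in>G. v \<nu> *\<^sub>R tvec d r q M \<nu>))\<^sup>2"
    and "(norm (\<Sum>\<nu>\<in>G. v \<nu> *\<^sub>R tvec d r q M \<nu>))\<^sup>2
      \<le> ((\<Sum>k<d. \<Sum>m<d. \<bar>M k m\<bar>) * C)\<^sup>2 * (\<Sum>\<nu>\<in>G. ((\<Sum>i<d. l (\<nu> i)) * v \<nu>)\<^sup>2)"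
proof -
  let ?L = "\<Sum>i<d. DD d G v i i" and ?T = "\<Sum>k<d. \<Sum>m<d. M k m *\<^sub>R DD d G v k m"
  have lap: "c\<^sup>2 * (\<Sum>\<nu>\<in>G. ((\<Sum>i<d. l (\<nu> i)) * v \<nu>)\<^sup>2) \<le> (norm ?L)\<^sup>2"
    "(norm ?L)\<^sup>2 \<le> C\<^sup>2 * (\<Sum>\<nu>\<in>G. ((\<Sum>i<d. l (\<nu> i)) * v \<nu>)\<^sup>2)"
    using diagonal_bounds[OF _ _ G, of "\<lambda>i j. if i = j then 1 else 0" v]
    unfolding sum_tvec_laplacian by (auto simp: is_diagonal_def)
  have eq: "norm (\<Sum>\<nu>\<in>G. v \<nu> *\<^sub>R tvec d r q M \<nu>) = norm ?T" unfolding sum_tvec by simp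
  have "\<gamma> * norm ?L \<le> norm ?T"
  proof (cases "norm ?L = 0")
    case False
    have "\<gamma> * (norm ?L)\<^sup>2 \<le> norm ?T * norm ?L"
      by (rule order_trans[OF tvec_coercive[OF \<gamma>(2)] norm_cauchy_schwarz])
    then show ?thesis using False by (simp add: power2_eq_square flip: mult.assoc)
  qed simp
  then have "(\<gamma> * norm ?L)\<^sup>2 \<le> (norm ?T)\<^sup>2" using \<gamma>(1) by (intro power_mono) auto
  then show "(\<gamma> * c)\<^sup>2 * (\<Sum>\<nu>\<in>G. ((\<Sum>i<d. l (\<nu> i)) * v \<nu>)\<^sup>2) \<le> (norm (\<Sum>\<nu>\<in>G. v \<nu> *\<^sub>R tvec d r q M \<nu>))\<^sup>2"
    unfolding eq using mult_left_mono[OF lap(1), of "\<gamma>\<^sup>2"] by (simp add: power_mult_distrib mult.assoc)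
  have "(norm ?T)\<^sup>2 \<le> ((\<Sum>k<d. \<Sum>m<d. \<bar>M k m\<bar>) * norm ?L)\<^sup>2"
    by (intro power_mono tvec_le_laplacian) simp
  then show "(norm (\<Sum>\<nu>\<in>G. v \<nu> *\<^sub>R tvec d r q M \<nu>))\<^sup>2
      \<le> ((\<Sum>k<d. \<Sum>m<d. \<bar>M k m\<bar>) * C)\<^sup>2 * (\<Sum>\<nu>\<in>G. ((\<Sum>i<d. l (\<nu> i)) * v \<nu>)\<^sup>2)"
    unfolding eq using mult_left_mono[OF lap(2), of "(\<Sum>k<d. \<Sum>m<d. \<bar>M k m\<bar>)\<^sup>2"]
    by (simp add: power_mult_distrib mult.assoc)
qed

text \<open>Orthogonality to the range of the Laplacian passes from the basis to tensor products of
  eigenfunctions, where the Laplacian is a positive multiple of the identity.\<close>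
lemma laplacian_total:
  assumes d: "1 \<le> d" and w: "\<And>\<nu>. \<nu> \<in> multi_idx d \<Longrightarrow> inner (tvec d r q (\<lambda>i j. if i = j then 1 else 0) \<nu>) w = 0"
    and out: "\<And>\<nu>. \<nu> \<notin> multi_idx d \<Longrightarrow> coord w \<nu> = 0"
  shows "w = 0"
proof -
  \<comment> \<open>Each slot holds a pair of a function and minus its second derivative. In such
    pairs the Laplacian tested with \<open>w\<close> is multilinear and bounded, so the closure of
    the graph can be used slot by slot.\<close>
  define \<Phi> where "\<Phi> p = (\<Sum>i<d. inner (tens d ((\<lambda>k. fst (p k))(i := snd (p i)))) w)"
    for p :: "nat \<Rightarrow> 'i ell2 \<times> 'i ell2"
  have \<Phi>_bl: "bounded_linear (\<lambda>x. \<Phi> (p(m := x)))" if m: "m < d" for m p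
    unfolding \<Phi>_def
  proof (intro bounded_linear_sum bounded_linear_compose[OF bounded_linear_inner_left])
    fix i assume i: "i \<in> {..<d}"
    show "bounded_linear (\<lambda>x. tens d ((\<lambda>k. fst ((p(m := x)) k))(i := snd ((p(m := x)) i))))"
    proof (cases "i = m")
      case True
      have "(\<lambda>k. fst ((p(m := x)) k))(i := snd ((p(m := x)) i)) = (\<lambda>k. fst (p k))(m := snd x)" for x
        using True by auto
      then show ?thesis
        using bounded_linear_compose[OF bounded_linear_tens[OF m] bounded_linear_snd] by simp
    next
      case False
      have "(\<lambda>k. fst ((p(m := x)) k))(i := snd ((p(m := x)) i)) = ((\<lambda>k. fst (p k))(i := snd (p i)))(m := fst x)" for x
        using False by auto
      then show ?thesis
        using bounded_linear_compose[OF bounded_linear_tens[OF m] bounded_linear_fst] by simp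
    qed
  qed
  have \<Phi>_zero: "\<Phi> p = 0" if p: "\<And>i. i < d \<Longrightarrow> p i \<in> range (\<lambda>\<nu>. (unit_vec \<nu>, q \<nu>))" for p
  proof -
    have "\<forall>i. \<exists>n. i < d \<longrightarrow> p i = (unit_vec n, q n)" using p by blast
    then obtain n where n: "\<And>i. i < d \<Longrightarrow> p i = (unit_vec (n i), q (n i))" by metis
    define \<nu> where "\<nu> = restrict n {..<d}"
    have \<nu>: "\<nu> \<in> multi_idx d" by (simp add: \<nu>_def multi_idx_def)
    have tens_cong: "tens d f = tens d g" if "\<And>i. i < d \<Longrightarrow> f i = g i" for f g :: "nat \<Rightarrow> 'i ell2"
      by (rule ell2_eqI) (auto simp: coord_tens that intro!: prod.cong)
    have "\<Phi> p = (\<Sum>i<d. inner (tens d ((\<lambda>k. unit_vec (\<nu> k))(i := q (\<nu> i)))) w)"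
      unfolding \<Phi>_def by (intro sum.cong refl arg_cong2[where f = inner] tens_cong) (auto simp: n \<nu>_def)
    also have "\<dots> = inner (tvec d r q (\<lambda>i j. if i = j then 1 else 0) \<nu>) w"
      by (simp add: tvec_def dd_def if_distrib[of "\<lambda>x. x *\<^sub>R _"] sum_negf inner_sum_left cong: if_cong)
    finally show ?thesis using w[OF \<nu>] by simp
  qed
  have s0: "inner (tens d (\<lambda>k. s (n k))) w = 0" for n
  proof -
    have "\<Phi> (\<lambda>i. (s (n i), \<kappa> (n i) *\<^sub>R s (n i))) = 0"
      by (rule multilinear_vanish[OF \<Phi>_bl \<Phi>_zero eigen])
    moreover have "tens d ((\<lambda>k. s (n k))(i := \<kappa> (n i) *\<^sub>R s (n i))) = \<kappa> (n i) *\<^sub>R tens d (\<lambda>k. s (n k))"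
      if "i < d" for i
      using tens_scaleR[OF that, of "\<lambda>k. s (n k)" "\<kappa> (n i)" "s (n i)"] by (simp add: fun_upd_idem)
    ultimately have "(\<Sum>i<d. \<kappa> (n i)) * inner (tens d (\<lambda>k. s (n k))) w = 0"
      by (simp add: \<Phi>_def sum_distrib_right)
    \<comment> \<open>The eigenvalue of a product is the sum of the univariate eigenvalues;
      \<open>1 \<le> d\<close> keeps this sum from being empty.\<close>
    moreover have "0 < (\<Sum>i<d. \<kappa> (n i))"
      by (rule sum_pos) (use d \<kappa>_pos in \<open>auto simp: lessThan_empty_iff\<close>)
    ultimately show ?thesis by simp
  qed
  \<comment> \<open>Second use of \<open>multilinear_vanish\<close>: products of eigenfunctions are
    replaced by arbitrary products, in particular by unit vectors.\<close>
  have "inner (tens d p) w = 0" for p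
  proof (rule multilinear_vanish[where d = d and S = "range s"])
    show "bounded_linear (\<lambda>x. inner (tens d (p(i := x))) w)" if "i < d" for i p
      by (rule bounded_linear_compose[OF bounded_linear_inner_left bounded_linear_tens[OF that]])
    fix p assume "\<And>i. i < d \<Longrightarrow> p i \<in> range s"
    then have "\<forall>i. \<exists>n. i < d \<longrightarrow> p i = s n" by blast
    then obtain n where n: "\<And>i. i < d \<Longrightarrow> p i = s (n i)" by metis
    have "tens d p = tens d (\<lambda>k. s (n k))"
      by (rule ell2_eqI) (auto simp: coord_tens n intro!: prod.cong)
    then show "inner (tens d p) w = 0" using s0[of n] by simp
  qed (simp add: s_total)
  then have "coord w \<nu> = 0" if "\<nu> \<in> multi_idx d" for \<nu>
    using tens_unit_vec[OF that] by (metis inner_unit_vec_left)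
  with out show ?thesis by (intro ell2_eqI) (metis coord_simps(1))
qed

end

section \<open>Riesz families and matrices on \<open>\<ell>\<^sub>2(J)\<close>\<close>

text \<open>Unit vectors outside \<open>J\<close> complete the family, so that no separate type for \<open>J\<close> is needed.\<close>
lemma extended_riesz_family:
  fixes t :: "'n \<Rightarrow> 'n ell2"
  assumes \<Omega>: "\<And>\<nu>. \<nu> \<in> J \<Longrightarrow> 0 < \<Omega> \<nu>" and c: "0 < c" "c \<le> 1" and C: "1 \<le> C"
    and lower: "\<And>G v. finite G \<Longrightarrow> G \<subseteq> J \<Longrightarrow> c\<^sup>2 * (\<Sum>\<nu>\<in>G. (\<Omega> \<nu> * v \<nu>)\<^sup>2) \<le> (norm (\<Sum>\<nu>\<in>G. v \<nu> *\<^sub>R t \<nu>))\<^sup>2"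
    and upper: "\<And>G v. finite G \<Longrightarrow> G \<subseteq> J \<Longrightarrow> (norm (\<Sum>\<nu>\<in>G. v \<nu> *\<^sub>R t \<nu>))\<^sup>2 \<le> C\<^sup>2 * (\<Sum>\<nu>\<in>G. (\<Omega> \<nu> * v \<nu>)\<^sup>2)"
    and out: "\<And>\<nu> \<kappa>. \<nu> \<in> J \<Longrightarrow> \<kappa> \<notin> J \<Longrightarrow> coord (t \<nu>) \<kappa> = 0"
    and total: "\<And>w. (\<And>\<nu>. \<nu> \<in> J \<Longrightarrow> inner (t \<nu>) w = 0) \<Longrightarrow> (\<And>\<nu>. \<nu> \<notin> J \<Longrightarrow> coord w \<nu> = 0) \<Longrightarrow> w = 0"
  shows "riesz_family (\<lambda>\<nu>. if \<nu> \<in> J then inverse (\<Omega> \<nu>) *\<^sub>R t \<nu> else unit_vec \<nu>) c C"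
proof
  fix F :: "'n set" and a :: "'n \<Rightarrow> real" assume F: "finite F"
  define v where "v \<nu> = a \<nu> * inverse (\<Omega> \<nu>)" for \<nu>
  let ?x = "\<Sum>\<nu>\<in>F \<inter> J. v \<nu> *\<^sub>R t \<nu>" and ?y = "\<Sum>\<nu>\<in>F - J. a \<nu> *\<^sub>R unit_vec \<nu> :: 'n ell2"
  have split: "(\<Sum>\<nu>\<in>F. f \<nu>) = (\<Sum>\<nu>\<in>F \<inter> J. f \<nu>) + (\<Sum>\<nu>\<in>F - J. f \<nu>)" for f :: "'n \<Rightarrow> 'z::comm_monoid_add"
    using sum.Int_Diff[OF F] .
  have eq: "(\<Sum>\<nu>\<in>F. a \<nu> *\<^sub>R (if \<nu> \<in> J then inverse (\<Omega> \<nu>) *\<^sub>R t \<nu> else unit_vec \<nu>)) = ?x + ?y"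
    unfolding split by (simp add: v_def)
  \<comment> \<open>The vectors \<open>t \<nu>\<close> are supported in \<open>J\<close>, the added
    unit vectors outside it.\<close>
  have "inner ?x ?y = 0"
    by (auto simp: inner_sum_left inner_sum_right inner_unit_vec_right coord_sum out intro!: sum.neutral)
  then have "(norm (?x + ?y))\<^sup>2 = (norm ?x)\<^sup>2 + (norm ?y)\<^sup>2"
    by (simp add: power2_norm_eq_inner inner_add_left inner_add_right inner_commute)
  then have norm: "(norm (?x + ?y))\<^sup>2 = (norm ?x)\<^sup>2 + (\<Sum>\<nu>\<in>F - J. (a \<nu>)\<^sup>2)"
    using F by (simp add: norm_sum_unit_vec)
  have \<Omega>v: "(\<Sum>\<nu>\<in>F \<inter> J. (\<Omega> \<nu> * v \<nu>)\<^sup>2) = (\<Sum>\<nu>\<in>F \<inter> J. (a \<nu>)\<^sup>2)"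
  proof (rule sum.cong[OF refl])
    fix \<nu> assume "\<nu> \<in> F \<inter> J"
    then have "\<Omega> \<nu> * v \<nu> = a \<nu>" using \<Omega>[of \<nu>] by (auto simp: v_def field_simps)
    then show "(\<Omega> \<nu> * v \<nu>)\<^sup>2 = (a \<nu>)\<^sup>2" by simp
  qed
  have nn: "0 \<le> (\<Sum>\<nu>\<in>F - J. (a \<nu>)\<^sup>2)" by (intro sum_nonneg) auto
  \<comment> \<open>The added vectors have norm 1, so the constants must enclose 1; the later
    \<open>min\<close> and \<open>max\<close> with 1 originate here.\<close>
  have c2: "c\<^sup>2 \<le> 1" "1 \<le> C\<^sup>2" using c C by (auto simp: abs_square_le_1)
  show "c\<^sup>2 * (\<Sum>\<nu>\<in>F. (a \<nu>)\<^sup>2)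
      \<le> (norm (\<Sum>\<nu>\<in>F. a \<nu> *\<^sub>R (if \<nu> \<in> J then inverse (\<Omega> \<nu>) *\<^sub>R t \<nu> else unit_vec \<nu>)))\<^sup>2"
    unfolding eq norm split[of "\<lambda>\<nu>. (a \<nu>)\<^sup>2"] distrib_left
    using lower[of "F \<inter> J" v] F mult_right_mono[OF c2(1) nn] by (simp add: \<Omega>v)
  show "(norm (\<Sum>\<nu>\<in>F. a \<nu> *\<^sub>R (if \<nu> \<in> J then inverse (\<Omega> \<nu>) *\<^sub>R t \<nu> else unit_vec \<nu>)))\<^sup>2
      \<le> C\<^sup>2 * (\<Sum>\<nu>\<in>F. (a \<nu>)\<^sup>2)"
    unfolding eq norm split[of "\<lambda>\<nu>. (a \<nu>)\<^sup>2"] distrib_left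
    using upper[of "F \<inter> J" v] F mult_right_mono[OF c2(2) nn] by (simp add: \<Omega>v)
next
  fix w assume w: "\<And>\<nu>. inner (if \<nu> \<in> J then inverse (\<Omega> \<nu>) *\<^sub>R t \<nu> else unit_vec \<nu>) w = 0"
  show "w = 0"
  proof (rule total)
    show "inner (t \<nu>) w = 0" if "\<nu> \<in> J" for \<nu> using w[of \<nu>] that \<Omega>[OF that] by simp
    show "coord w \<nu> = 0" if "\<nu> \<notin> J" for \<nu> using w[of \<nu>] that by (simp add: inner_unit_vec_left)
  qed
qed (use c C in auto)

text \<open>The rows of \<open>A\<close> are the members of the family, so on vectors supported in
  \<open>J\<close> the matrix acts as \<open>analysis\<close>. Off \<open>J\<close> the analysis map
  copies coordinates, hence it respects \<open>l2 J\<close> in both directions.\<close>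

lemma l2_isomorphism_of_riesz_family:
  fixes t :: "'n \<Rightarrow> 'n ell2"
  assumes "riesz_family (\<lambda>\<nu>. if \<nu> \<in> J then inverse (\<Omega> \<nu>) *\<^sub>R t \<nu> else unit_vec \<nu>) c C"
    and A: "\<And>\<mu> \<nu>. \<mu> \<in> J \<Longrightarrow> \<nu> \<in> J \<Longrightarrow> A \<mu> \<nu> = inverse (\<Omega> \<mu>) * coord (t \<mu>) \<nu>"
  shows "l2_isomorphism J A" and "l2_bounds J A c C"
proof -
  interpret riesz_family "\<lambda>\<nu>. if \<nu> \<in> J then inverse (\<Omega> \<nu>) *\<^sub>R t \<nu> else unit_vec \<nu>" c C by fact
  have ell2_of: "coord (Abs_ell2 v) = v" if "v \<in> l2 J" for v :: "'n \<Rightarrow> real"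
  proof (rule coord_Abs)
    have "(\<lambda>\<nu>. (v \<nu>)\<^sup>2) summable_on J" using that by (simp add: l2_def)
    then show "(\<lambda>\<nu>. (v \<nu>)\<^sup>2) summable_on UNIV"
      by (rule summable_on_cong_neutral[THEN iffD1, rotated -1]) (use that in \<open>auto simp: l2_def\<close>)
  qed
  have mem: "coord x \<in> l2 J" if "\<And>\<nu>. \<nu> \<notin> J \<Longrightarrow> coord x \<nu> = 0" for x :: "'n ell2"
    using that by (simp add: l2_def summable_coord_sq)
  have nrm: "l2_nrm J (coord x) = norm x" if "\<And>\<nu>. \<nu> \<notin> J \<Longrightarrow> coord x \<nu> = 0" for x :: "'n ell2"
  proof -
    have "(\<Sum>\<^sub>\<infinity>\<nu>\<in>J. (coord x \<nu>)\<^sup>2) = (norm x)\<^sup>2"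
      unfolding norm_ell2_sq by (rule infsum_cong_neutral) (use that in auto)
    then show ?thesis by (simp add: l2_nrm_def)
  qed
  have out: "coord (analysis x) \<nu> = coord x \<nu>" if "\<nu> \<notin> J" for x \<nu>
    using that by (simp add: coord_analysis inner_unit_vec_left)
  have supp: "coord x \<nu> = 0" if "coord x \<in> l2 J" "\<nu> \<notin> J" for x :: "'n ell2" and \<nu>
    using that by (simp add: l2_def)
  have Ax: "A \<mu> \<nu> * coord x \<nu> = coord (inverse (\<Omega> \<mu>) *\<^sub>R t \<mu>) \<nu> * coord x \<nu>" if "\<mu> \<in> J" "\<nu> \<in> J" for \<mu> \<nu> x
    using that by (simp add: A)
  have act: "imat_vec J A (coord x) = coord (analysis x)" if x: "coord x \<in> l2 J" for x
  proof
    fix \<mu>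
    show "imat_vec J A (coord x) \<mu> = coord (analysis x) \<mu>"
    proof (cases "\<mu> \<in> J")
      case True
      have "imat_vec J A (coord x) \<mu> = (\<Sum>\<^sub>\<infinity>\<nu>. coord (inverse (\<Omega> \<mu>) *\<^sub>R t \<mu>) \<nu> * coord x \<nu>)"
        unfolding imat_vec_def using True
        by (simp only: if_True, intro infsum_cong_neutral) (auto simp: Ax supp[OF x])
      then show ?thesis using True by (simp add: coord_analysis inner_ell2_def)
    next
      case False
      then show ?thesis using out[OF False] supp[OF x False] by (simp add: imat_vec_def)
    qed
  qed
  have out0: "coord (analysis x) \<nu> = 0" if "coord x \<in> l2 J" "\<nu> \<notin> J" for x \<nu>
    using out supp that by simp
  show bounds: "l2_bounds J A c C"
    unfolding l2_bounds_def
  proof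
    fix v assume v: "v \<in> l2 J"
    define x where "x = Abs_ell2 v"
    have x: "v = coord x" using ell2_of[OF v] by (simp add: x_def)
    have "l2_nrm J v = norm x" unfolding x by (rule nrm) (use v supp x in auto)
    moreover have "l2_nrm J (imat_vec J A v) = norm (analysis x)"
      unfolding x using v x by (subst act) (auto intro!: nrm out0)
    ultimately show "c * l2_nrm J v \<le> l2_nrm J (imat_vec J A v) \<and> l2_nrm J (imat_vec J A v) \<le> C * l2_nrm J v"
      using norm_analysis_le norm_analysis_ge by simp
  qed
  have "bij_betw (imat_vec J A) (l2 J) (l2 J)"
  proof (rule bij_betw_imageI)
    show "inj_on (imat_vec J A) (l2 J)"
    proof (rule inj_onI)
      fix v v' assume v: "v \<in> l2 J" "v' \<in> l2 J" and "imat_vec J A v = imat_vec J A v'"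
      then have "coord (analysis (Abs_ell2 v)) = coord (analysis (Abs_ell2 v'))"
        using act[of "Abs_ell2 v"] act[of "Abs_ell2 v'"] by (simp add: ell2_of)
      then have "Abs_ell2 v = Abs_ell2 v'" by (simp add: coord_inject analysis_eqD)
      then show "v = v'" using ell2_of v by metis
    qed
    show "imat_vec J A ` l2 J = l2 J"
    proof safe
      fix v assume v: "v \<in> l2 J"
      have eq: "imat_vec J A v = coord (analysis (Abs_ell2 v))"
        using act[of "Abs_ell2 v"] v by (simp add: ell2_of)
      show "imat_vec J A v \<in> l2 J"
        unfolding eq by (rule mem, rule out0) (use v ell2_of[OF v] in simp_all)
    next
      fix f assume f: "f \<in> l2 J"
      obtain x where x: "analysis x = Abs_ell2 f" using bij_analysis by (metis bij_is_surj surjD)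
      \<comment> \<open>The preimage has no choice off \<open>J\<close>: there its coordinates are
        those of \<open>f\<close>.\<close>
      have "coord x \<nu> = 0" if "\<nu> \<notin> J" for \<nu>
        using out[OF that, of x] f that by (simp add: x ell2_of l2_def)
      then have "coord x \<in> l2 J" by (rule mem)
      moreover from this have "imat_vec J A (coord x) = f" by (simp add: act x ell2_of f)
      ultimately show "f \<in> imat_vec J A ` l2 J" by blast
    qed
  qed
  moreover have "(\<lambda>\<nu>. A \<mu> \<nu> * v \<nu>) summable_on J" if v: "v \<in> l2 J" and \<mu>: "\<mu> \<in> J" for v \<mu>
  proof -
    have "(\<lambda>\<nu>. coord (inverse (\<Omega> \<mu>) *\<^sub>R t \<mu>) \<nu> * coord (Abs_ell2 v) \<nu>) summable_on J"
      by (rule summable_coord_mult)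
    also have "?this \<longleftrightarrow> (\<lambda>\<nu>. A \<mu> \<nu> * v \<nu>) summable_on J"
      using \<mu> by (intro summable_on_cong) (simp add: A ell2_of[OF v])
    finally show ?thesis .
  qed
  ultimately show "l2_isomorphism J A"
    unfolding l2_isomorphism_def using bounds c_pos c_le_C by blast
qed

section \<open>Totality for general coefficient matrices\<close>

context second_order_system
begin

lemma multi_weight_pos: "1 \<le> (d::nat) \<Longrightarrow> 0 < (\<Sum>i<d. l (\<nu> i))"
  by (rule sum_pos) (auto simp: l_pos lessThan_empty_iff)

text \<open>Since the scaled Laplacians of the basis form a Riesz family, \<open>w\<close> is a
  limit of Laplacians of finite combinations. For such a combination, coercivity bounds the squared
  norm of its Laplacian by an inner product that would tend to 0 if \<open>w\<close> were orthogonal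
  to the range of the operator.\<close>

lemma general_total:
  assumes d: "1 \<le> d"
    and \<gamma>: "0 < \<gamma>" "\<And>y :: nat \<Rightarrow> real. \<gamma> * (\<Sum>i<d. (y i)\<^sup>2) \<le> (\<Sum>i<d. \<Sum>j<d. y i * M i j * y j)"
    and w: "\<And>\<nu>. \<nu> \<in> multi_idx d \<Longrightarrow> inner (tvec d r q M \<nu>) w = 0"
    and out: "\<And>\<nu>. \<nu> \<notin> multi_idx d \<Longrightarrow> coord w \<nu> = 0"
  shows "w = 0"
proof -
  let ?J = "multi_idx d :: (nat \<Rightarrow> 'i) set"
  let ?I = "\<lambda>i j::nat. if i = j then 1 else 0 :: real"
  define \<Omega> where "\<Omega> \<nu> = (\<Sum>i<d. l (\<nu> i))" for \<nu>
  have \<Omega>_eq: "(\<Sum>i<d. ?I i i * l (\<nu> i)) = \<Omega> \<nu>" for \<nu> by (simp add: \<Omega>_def)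
  have rf: "riesz_family (\<lambda>\<nu>. if \<nu> \<in> ?J then inverse (\<Omega> \<nu>) *\<^sub>R tvec d r q ?I \<nu> else unit_vec \<nu>)
      (min c 1) (max C 1)"
  proof (rule extended_riesz_family)
    fix G :: "(nat \<Rightarrow> 'i) set" and v assume G: "finite G" "G \<subseteq> ?J"
    have nn: "0 \<le> (\<Sum>\<nu>\<in>G. (\<Omega> \<nu> * v \<nu>)\<^sup>2)" by (intro sum_nonneg) auto
    note b = diagonal_bounds[OF _ _ G, of ?I v, unfolded \<Omega>_eq]
    have "(min c 1)\<^sup>2 \<le> c\<^sup>2" "C\<^sup>2 \<le> (max C 1)\<^sup>2" using c_pos C_pos by (auto intro!: power_mono)
    note m = mult_right_mono[OF this(1) nn] mult_right_mono[OF this(2) nn]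
    show "(min c 1)\<^sup>2 * (\<Sum>\<nu>\<in>G. (\<Omega> \<nu> * v \<nu>)\<^sup>2) \<le> (norm (\<Sum>\<nu>\<in>G. v \<nu> *\<^sub>R tvec d r q ?I \<nu>))\<^sup>2"
      using order_trans[OF m(1) b(1)] by (simp add: is_diagonal_def)
    show "(norm (\<Sum>\<nu>\<in>G. v \<nu> *\<^sub>R tvec d r q ?I \<nu>))\<^sup>2 \<le> (max C 1)\<^sup>2 * (\<Sum>\<nu>\<in>G. (\<Omega> \<nu> * v \<nu>)\<^sup>2)"
      using order_trans[OF b(2) m(2)] by (simp add: is_diagonal_def)
  qed (use d c_pos in \<open>auto simp: \<Omega>_def multi_weight_pos coord_tvec_out intro: laplacian_total\<close>)
  interpret R: riesz_family "\<lambda>\<nu>. if \<nu> \<in> ?J then inverse (\<Omega> \<nu>) *\<^sub>R tvec d r q ?I \<nu> else unit_vec \<nu>"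
    "min c 1" "max C 1" by (rule rf)
  obtain x where x: "R.synth x = w" using R.synth_surj by blast
  \<comment> \<open>The added unit vectors are fixed by the analysis map, so \<open>x\<close> and
    \<open>w\<close> agree off \<open>J\<close>, where \<open>w\<close> vanishes. The approximants
    of \<open>w\<close> thus contain no added vectors.\<close>
  have x_out: "coord x \<mu> = 0" if \<mu>: "\<mu> \<notin> ?J" for \<mu>
  proof -
    have "R.analysis (unit_vec \<mu>) = unit_vec \<mu>"
    proof (rule ell2_eqI)
      fix \<nu> show "coord (R.analysis (unit_vec \<mu>)) \<nu> = coord (unit_vec \<mu>) \<nu>"
        using \<mu> by (auto simp: R.coord_analysis inner_unit_vec_right coord_tvec_out coord_unit_vec)
    qed
    then have "coord w \<mu> = coord x \<mu>"
      using R.inner_synth[of x "unit_vec \<mu>"] by (simp add: x inner_unit_vec_right)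
    then show ?thesis using out[OF \<mu>] by simp
  qed
  define v where "v \<nu> = coord x \<nu> * inverse (\<Omega> \<nu>)" for \<nu>
  define S where "S F = (\<Sum>\<nu>\<in>F \<inter> ?J. v \<nu> *\<^sub>R tvec d r q ?I \<nu>)" for F
  have "(\<Sum>\<nu>\<in>F. coord x \<nu> *\<^sub>R (if \<nu> \<in> ?J then inverse (\<Omega> \<nu>) *\<^sub>R tvec d r q ?I \<nu> else unit_vec \<nu>)) = S F"
    if "finite F" for F
    unfolding S_def by (rule sum.mono_neutral_cong_right) (use that in \<open>auto simp: x_out v_def\<close>)
  from tendsto_cong[OF eventually_finite_subsets_at_top_weakI[OF this]]
  have "(S \<longlongrightarrow> w) (finite_subsets_at_top UNIV)"
    by (rule iffD1[OF _ R.synth_has_sum[of x, unfolded has_sum_def x]])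
  then have lim: "((\<lambda>F. norm (S F)) \<longlongrightarrow> norm w) (finite_subsets_at_top UNIV)"
      "((\<lambda>F. norm (S F - w)) \<longlongrightarrow> norm (w - w)) (finite_subsets_at_top UNIV)"
    by (intro tendsto_intros; assumption)+
  define B where "B = (\<Sum>k<d. \<Sum>m<d. \<bar>M k m\<bar>)"
  \<comment> \<open>As \<open>T\<close> is orthogonal to \<open>w\<close>, the factor
    \<open>S F\<close> in the coercivity estimate may be replaced by \<open>S F - w\<close>, which
    tends to 0.\<close>
  have est: "\<gamma> * (norm (S F))\<^sup>2 \<le> B * norm (S F) * norm (S F - w)" if F: "finite F" for F
  proof -
    define T where "T = (\<Sum>\<nu>\<in>F \<inter> ?J. v \<nu> *\<^sub>R tvec d r q M \<nu>)"
    have "\<gamma> * (norm (S F))\<^sup>2 \<le> inner T (S F)"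
      using tvec_coercive[OF \<gamma>(2), of "F \<inter> ?J" v] unfolding S_def T_def sum_tvec_laplacian sum_tvec[of _ _ M] by simp
    also have "inner T w = 0" unfolding T_def by (simp add: inner_sum_left w)
    then have "inner T (S F) = inner T (S F - w)" by (simp add: inner_diff_right)
    also have "\<dots> \<le> norm T * norm (S F - w)" by (rule norm_cauchy_schwarz)
    also have "norm T \<le> B * norm (S F)"
      using tvec_le_laplacian[of M d "F \<inter> ?J" v] unfolding S_def T_def B_def sum_tvec_laplacian sum_tvec[of _ _ M] by simp
    finally show ?thesis by (simp add: mult_right_mono)
  qed
  have "\<gamma> * (norm w)\<^sup>2 \<le> B * norm w * norm (w - w)"
  proof (rule tendsto_le)
    show "((\<lambda>F. B * norm (S F) * norm (S F - w)) \<longlongrightarrow> B * norm w * norm (w - w)) (finite_subsets_at_top UNIV)"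
      by (intro tendsto_intros lim)
    show "((\<lambda>F. \<gamma> * (norm (S F))\<^sup>2) \<longlongrightarrow> \<gamma> * (norm w)\<^sup>2) (finite_subsets_at_top UNIV)"
      by (intro tendsto_intros lim)
    show "\<forall>\<^sub>F F in finite_subsets_at_top UNIV. \<gamma> * (norm (S F))\<^sup>2 \<le> B * norm (S F) * norm (S F - w)"
      by (rule eventually_finite_subsets_at_top_weakI[OF est])
  qed simp
  then show ?thesis using \<gamma>(1) by (simp add: mult_le_0_iff)
qed

end

section \<open>Smooth functions and test functions on the unit interval\<close>

definition smooth :: "(real \<Rightarrow> real) \<Rightarrow> bool" where
  "smooth f \<longleftrightarrow> (\<forall>k x. ((deriv ^^ k) f) differentiable (at x))"

text \<open>It suffices to exhibit a class of differentiable functions that is closed under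
  \<open>deriv\<close>; no formula for higher derivatives is needed.\<close>

lemma smooth_coinduct:
  assumes "f \<in> X" and "\<And>g. g \<in> X \<Longrightarrow> (\<forall>x. g differentiable (at x)) \<and> deriv g \<in> X"
  shows "smooth f"
proof -
  have "(deriv ^^ k) f \<in> X" for k by (induction k) (use assms in auto)
  then show ?thesis unfolding smooth_def using assms(2) by blast
qed

lemma smooth_deriv: "smooth f \<Longrightarrow> smooth (deriv f)"
  unfolding smooth_def by (metis funpow_Suc_right o_apply)

lemma smooth_differentiable: "smooth f \<Longrightarrow> f differentiable (at x)"
  unfolding smooth_def by (metis funpow_0)

lemma smooth_has_deriv: "smooth f \<Longrightarrow> (f has_real_derivative deriv f x) (at x)"
  using smooth_differentiable DERIV_deriv_iff_real_differentiable by blast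

lemma smooth_continuous: "smooth f \<Longrightarrow> continuous_on A f"
  by (meson continuous_at_imp_continuous_on differentiable_imp_continuous_within smooth_differentiable)

lemma smooth_const: "smooth (\<lambda>_. c)"
  by (rule smooth_coinduct[of _ "range (\<lambda>c _. c)"]) auto

lemma smooth_mult:
  assumes "smooth f" "smooth g" shows "smooth (\<lambda>x. f x * g x)"
proof (rule smooth_coinduct)
  \<comment> \<open>The product rule doubles the number of terms, so the closed class consists of
    finite sums of products, encoded as lists of pairs of factors.\<close>
  let ?X = "{h. \<exists>ps. (\<forall>p\<in>set ps. smooth (fst p) \<and> smooth (snd p)) \<and> h = (\<lambda>x. \<Sum>p\<leftarrow>ps. fst p x * snd p x)}"
  show "(\<lambda>x. f x * g x) \<in> ?X"
    by (rule CollectI, rule exI[of _ "[(f, g)]"]) (use assms in auto)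
  fix h assume "h \<in> ?X"
  then obtain ps where ps: "\<forall>p\<in>set ps. smooth (fst p) \<and> smooth (snd p)"
    and h: "h = (\<lambda>x. \<Sum>p\<leftarrow>ps. fst p x * snd p x)" by blast
  define qs where "qs = concat (map (\<lambda>p. [(deriv (fst p), snd p), (fst p, deriv (snd p))]) ps)"
  have "((\<lambda>x. \<Sum>p\<leftarrow>ps. fst p x * snd p x) has_real_derivative (\<Sum>p\<leftarrow>qs. fst p x * snd p x)) (at x)" for x
    using ps unfolding qs_def
  proof (induction ps)
    case (Cons p ps)
    have "((\<lambda>x. fst p x * snd p x) has_real_derivative deriv (fst p) x * snd p x + fst p x * deriv (snd p) x) (at x)"
      by (rule derivative_eq_intros smooth_has_deriv | use Cons.prems in force)+
    from DERIV_add[OF this Cons.IH] Cons.prems show ?case by (simp add: algebra_simps)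
  qed simp
  then have D: "(h has_real_derivative (\<Sum>p\<leftarrow>qs. fst p x * snd p x)) (at x)" for x by (simp add: h)
  then have "deriv h = (\<lambda>x. \<Sum>p\<leftarrow>qs. fst p x * snd p x)" by (intro ext DERIV_imp_deriv)
  moreover have "\<forall>p\<in>set qs. smooth (fst p) \<and> smooth (snd p)"
    using ps by (auto simp: qs_def smooth_deriv)
  ultimately show "(\<forall>x. h differentiable (at x)) \<and> deriv h \<in> ?X"
    using D real_differentiable_def by blast
qed

lemma smooth_affine:
  assumes "smooth f" shows "smooth (\<lambda>x. f (a * x + b))"
proof (rule smooth_coinduct)
  let ?X = "{h. \<exists>f c. smooth f \<and> h = (\<lambda>x. c * f (a * x + b))}"
  show "(\<lambda>x. f (a * x + b)) \<in> ?X"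
    by (rule CollectI, rule exI[of _ f], rule exI[of _ 1]) (use assms in auto)
  fix h assume "h \<in> ?X"
  then obtain f c where f: "smooth f" and h: "h = (\<lambda>x. c * f (a * x + b))" by blast
  have D: "(h has_real_derivative (c * a) * deriv f (a * x + b)) (at x)" for x
  proof -
    have "((\<lambda>x. f (a * x + b)) has_real_derivative deriv f (a * x + b) * a) (at x)"
      by (rule DERIV_chain2[OF smooth_has_deriv[OF f]]) (auto intro!: derivative_eq_intros)
    from DERIV_cmult[OF this, of c] show ?thesis by (simp add: h mult_ac)
  qed
  then have "deriv h = (\<lambda>x. (c * a) * deriv f (a * x + b))" by (intro ext DERIV_imp_deriv)
  then show "(\<forall>x. h differentiable (at x)) \<and> deriv h \<in> ?X"
    using D real_differentiable_def smooth_deriv[OF f] by blast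
qed

lemma smooth_sin: "smooth (\<lambda>x. sin (a * x))"
proof (rule smooth_coinduct)
  let ?X = "{h. \<exists>b c. h = (\<lambda>x. b * sin (a * x) + c * cos (a * x))}"
  show "(\<lambda>x. sin (a * x)) \<in> ?X"
    by (rule CollectI, rule exI[of _ 1], rule exI[of _ 0]) auto
  fix h assume "h \<in> ?X"
  then obtain b c where h: "h = (\<lambda>x. b * sin (a * x) + c * cos (a * x))" by blast
  have D: "(h has_real_derivative (- c * a) * sin (a * x) + (b * a) * cos (a * x)) (at x)" for x
    unfolding h by (auto intro!: derivative_eq_intros)
  then have "deriv h = (\<lambda>x. (- c * a) * sin (a * x) + (b * a) * cos (a * x))" by (intro ext DERIV_imp_deriv)
  then show "(\<forall>x. h differentiable (at x)) \<and> deriv h \<in> ?X"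
    using D real_differentiable_def by blast
qed

definition flat :: "real \<Rightarrow> real" where
  "flat y = (if 0 < y then exp (- 1 / y) else 0)"

lemma flat_bounds: "0 \<le> flat y" "flat y \<le> 1"
  by (auto simp: flat_def)

lemma poly_inverse_exp_tendsto_0:
  fixes p :: "real poly"
  shows "((\<lambda>y. poly p (1 / y) * exp (- 1 / y)) \<longlongrightarrow> 0) (at_right 0)"
proof -
  have "((\<lambda>x. poly p x * exp (- x)) \<longlongrightarrow> 0) at_top"
  proof -
    have "((\<lambda>x. \<Sum>i\<le>degree p. coeff p i * (x ^ i / exp x)) \<longlongrightarrow> (\<Sum>i\<le>degree p. coeff p i * 0)) at_top"
      by (intro tendsto_intros tendsto_power_div_exp_0)
    then show ?thesis
      by (simp add: poly_altdef sum_distrib_right exp_minus divide_inverse mult.assoc)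
  qed
  from filterlim_compose[OF this filterlim_inverse_at_top_right]
  show ?thesis by (simp add: inverse_eq_divide)
qed

lemma smooth_flat: "smooth flat"
proof (rule smooth_coinduct)
  define g where "g p y = (if 0 < y then poly p (1 / y) * exp (- 1 / y) else 0)" for p :: "real poly" and y :: real
  show "flat \<in> range g" by (rule image_eqI[of _ _ 1]) (auto simp: flat_def g_def)
  fix h assume "h \<in> range g"
  then obtain p where h: "h = g p" by blast
  \<comment> \<open>With z = 1/y, differentiating p(z) exp(-z) in y multiplies by z^2 and replaces
    \<open>p\<close> by \<open>p - pderiv p\<close>.\<close>
  define p' where "p' = [:0, 0, 1:] * (p - pderiv p)"
  have p': "poly p' z = z\<^sup>2 * (poly p z - poly (pderiv p) z)" for z
    by (simp add: p'_def power2_eq_square algebra_simps)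
  have D: "(g p has_real_derivative g p' y) (at y)" for y
  proof -
    consider "0 < y" | "y < 0" | "y = 0" by linarith
    then show ?thesis
    proof cases
      case 1
      have "((\<lambda>y. poly p (1 / y) * exp (- 1 / y)) has_real_derivative
          (poly (pderiv p) (1 / y) * (- 1 / y\<^sup>2)) * exp (- 1 / y) + (exp (- 1 / y) * (1 / y\<^sup>2)) * poly p (1 / y)) (at y)"
      proof (rule DERIV_mult)
        show "((\<lambda>y. poly p (1 / y)) has_real_derivative poly (pderiv p) (1 / y) * (- 1 / y\<^sup>2)) (at y)"
          by (rule DERIV_chain2[OF poly_DERIV])
            (use 1 in \<open>auto intro!: derivative_eq_intros simp: power2_eq_square\<close>)
        show "((\<lambda>y. exp (- 1 / y)) has_real_derivative exp (- 1 / y) * (1 / y\<^sup>2)) (at y)"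
          by (rule DERIV_chain2[OF DERIV_exp])
            (use 1 in \<open>auto intro!: derivative_eq_intros simp: power2_eq_square\<close>)
      qed
      also have "(poly (pderiv p) (1 / y) * (- 1 / y\<^sup>2)) * exp (- 1 / y) + (exp (- 1 / y) * (1 / y\<^sup>2)) * poly p (1 / y) = g p' y"
        using 1 by (simp add: g_def p' algebra_simps power2_eq_square)
      finally have d: "((\<lambda>y. poly p (1 / y) * exp (- 1 / y)) has_real_derivative g p' y) (at y)" .
      have "\<forall>\<^sub>F z in nhds y. poly p (1 / z) * exp (- 1 / z) = g p z"
        using eventually_nhds_in_open[of "{0<..}" y] 1 by (auto elim!: eventually_mono simp: g_def)
      from iffD1[OF DERIV_cong_ev[OF refl this refl] d] show ?thesis .
    next
      case 2
      have d: "((\<lambda>_. 0) has_real_derivative g p' y) (at y)" using 2 by (simp add: g_def)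
      have "\<forall>\<^sub>F z in nhds y. 0 = g p z"
        using eventually_nhds_in_open[of "{..<0}" y] 2 by (auto elim!: eventually_mono simp: g_def)
      from iffD1[OF DERIV_cong_ev[OF refl this refl] d] show ?thesis .
    next
      \<comment> \<open>At 0 the right difference quotient is again a polynomial in 1/y times
        exp(-1/y), and this tends to 0.\<close>
      case 3
      have "((\<lambda>y. g p y / y) \<longlongrightarrow> 0) (at_right 0)"
      proof -
        have "((\<lambda>y. poly (p * [:0, 1:]) (1 / y) * exp (- 1 / y)) \<longlongrightarrow> 0) (at_right 0)"
          by (rule poly_inverse_exp_tendsto_0)
        moreover have "\<forall>\<^sub>F y in at_right (0::real). poly (p * [:0, 1:]) (1 / y) * exp (- 1 / y) = g p y / y"
          using eventually_at_right_less by (rule eventually_mono) (simp add: g_def field_simps)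
        ultimately show ?thesis by (rule Lim_transform_eventually)
      qed
      moreover have "((\<lambda>y. g p y / y) \<longlongrightarrow> 0) (at_left 0)"
      proof (rule Lim_transform_eventually[OF tendsto_const])
        show "\<forall>\<^sub>F y in at_left (0::real). 0 = g p y / y"
          unfolding eventually_at_filter by (simp add: g_def)
      qed
      ultimately have "((\<lambda>y. g p y / y) \<longlongrightarrow> 0) (at 0)"
        by (simp add: filterlim_split_at)
      then have "((\<lambda>h. (g p (0 + h) - g p 0) / h) \<longlongrightarrow> 0) (at 0)" by (simp add: g_def)
      then have "(g p has_real_derivative 0) (at 0)" unfolding DERIV_def .
      then show ?thesis using 3 by (simp add: g_def)
    qed
  qed
  then have "deriv (g p) = g p'" by (intro ext DERIV_imp_deriv)
  then show "(\<forall>x. h differentiable (at x)) \<and> deriv h \<in> range g"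
    unfolding h using D real_differentiable_def by blast
qed

section \<open>Test functions and bumps on the interval\<close>

lemma test_fun1_iff:
  "\<phi> \<in> test_fun1 \<longleftrightarrow> smooth \<phi> \<and> (\<exists>K. compact K \<and> K \<subseteq> {0<..<1} \<and> (\<forall>x. x \<notin> K \<longrightarrow> \<phi> x = 0))"
  by (simp add: test_fun1_def smooth_def)

lemma test_fun1_smooth: "\<phi> \<in> test_fun1 \<Longrightarrow> smooth \<phi>"
  by (simp add: test_fun1_iff)

lemma test_fun1_supp:
  assumes "\<phi> \<in> test_fun1"
  obtains K where "compact K" "K \<subseteq> {0<..<1}" "\<And>x. x \<notin> K \<Longrightarrow> \<phi> x = 0" "\<And>x. x \<notin> K \<Longrightarrow> deriv \<phi> x = 0"
proof -
  obtain K where K: "compact K" "K \<subseteq> {0<..<1}" "\<And>x. x \<notin> K \<Longrightarrow> \<phi> x = 0"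
    using assms by (auto simp: test_fun1_iff)
  have "deriv \<phi> x = 0" if x: "x \<notin> K" for x
  proof (rule DERIV_imp_deriv)
    have "\<forall>\<^sub>F y in nhds x. y \<in> - K"
      using K(1) x by (intro eventually_nhds_in_open) (auto intro: compact_imp_closed)
    then have "\<forall>\<^sub>F y in nhds x. \<phi> y = 0" by (rule eventually_mono) (use K in auto)
    then show "(\<phi> has_real_derivative 0) (at x)"
      by (subst DERIV_cong_ev[OF refl _ refl]) auto
  qed
  with K that show thesis by blast
qed

lemma test_fun1_deriv: "\<phi> \<in> test_fun1 \<Longrightarrow> deriv \<phi> \<in> test_fun1"
  using test_fun1_supp[of \<phi>] unfolding test_fun1_iff by (metis smooth_deriv)

lemma test_fun1_mult_smooth:
  assumes "smooth f" "\<phi> \<in> test_fun1" shows "(\<lambda>x. f x * \<phi> x) \<in> test_fun1"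
  using assms smooth_mult[of f \<phi>] unfolding test_fun1_iff by (metis mult_zero_right)

lemma test_fun1_01:
  assumes "\<phi> \<in> test_fun1" "x \<notin> {0<..<1}" shows "\<phi> x = 0"
  using assms unfolding test_fun1_iff by blast

text \<open>For fixed end points the functions stay in [0, 1] and tend, as \<open>n\<close> grows,
  to the indicator of the open interval; the support does not move with \<open>n\<close>.\<close>

definition bump :: "nat \<Rightarrow> real \<Rightarrow> real \<Rightarrow> real \<Rightarrow> real" where
  "bump n a b x = flat (real n * (x - a)) * flat (real n * (b - x))"

lemma bump_bounds: "0 \<le> bump n a b x" "bump n a b x \<le> 1"
  unfolding bump_def using flat_bounds by (auto intro: mult_le_one)

lemma smooth_bump: "smooth (bump n a b)"
proof -
  have "smooth (\<lambda>x. flat (real n * x + (- real n * a)) * flat ((- real n) * x + real n * b))"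
    by (intro smooth_mult smooth_affine smooth_flat)
  then show ?thesis unfolding bump_def[abs_def] by (simp add: algebra_simps)
qed

lemma bump_test_fun1:
  assumes "0 < a" "b < 1" shows "bump n a b \<in> test_fun1"
  unfolding test_fun1_iff
proof (intro conjI exI[of _ "{a..b}"] smooth_bump)
  show "\<forall>x. x \<notin> {a..b} \<longrightarrow> bump n a b x = 0"
    by (auto simp: bump_def flat_def zero_less_mult_iff)
qed (use assms in auto)

lemma flat_tendsto_1:
  assumes "0 < y" shows "(\<lambda>n. flat (real n * y)) \<longlonglongrightarrow> 1"
proof -
  have "(\<lambda>n. exp (- 1 / (real n * y))) \<longlonglongrightarrow> exp 0"
  proof (intro tendsto_exp)
    have "(\<lambda>n. (- 1 / y) * (1 / real n)) \<longlonglongrightarrow> (- 1 / y) * 0"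
      by (intro tendsto_mult tendsto_const lim_1_over_n)
    then show "(\<lambda>n. - 1 / (real n * y)) \<longlonglongrightarrow> 0" by (simp add: mult.commute)
  qed
  moreover have "\<forall>\<^sub>F n in sequentially. exp (- 1 / (real n * y)) = flat (real n * y)"
    using eventually_gt_at_top[of 0] by (rule eventually_mono) (use assms in \<open>simp add: flat_def\<close>)
  ultimately show ?thesis using Lim_transform_eventually by fastforce
qed

lemma bump_tendsto: "(\<lambda>n. bump n a b x) \<longlonglongrightarrow> indicator {a<..<b} x"
proof (cases "a < x \<and> x < b")
  case True
  have "(\<lambda>n. bump n a b x) \<longlonglongrightarrow> 1 * 1"
    unfolding bump_def by (intro tendsto_mult flat_tendsto_1) (use True in auto)
  then show ?thesis using True by simp
next
  case False
  then have "bump n a b x = 0" for n by (auto simp: bump_def flat_def zero_less_mult_iff)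
  then show ?thesis using False by auto
qed

section \<open>Square integrable functions on finite measure spaces\<close>

lemma sq_integrableD: "f \<in> sq_integrable M \<Longrightarrow> f \<in> borel_measurable M"
  "f \<in> sq_integrable M \<Longrightarrow> integrable M (\<lambda>x. (f x)\<^sup>2)"
  by (simp_all add: sq_integrable_def)

lemma sq_integrable_mult:
  assumes "f \<in> sq_integrable M" "g \<in> sq_integrable M"
  shows "integrable M (\<lambda>x. f x * g x)"
proof (rule Bochner_Integration.integrable_bound)
  show "integrable M (\<lambda>x. (f x)\<^sup>2 + (g x)\<^sup>2)"
    using assms by (intro Bochner_Integration.integrable_add sq_integrableD)
  show "(\<lambda>x. f x * g x) \<in> borel_measurable M"
    using assms by (intro borel_measurable_times sq_integrableD)
  have "\<bar>a * b\<bar> \<le> a\<^sup>2 + b\<^sup>2" for a b :: real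
    using sum_squares_bound[of "\<bar>a\<bar>" "\<bar>b\<bar>"] mult_nonneg_nonneg[of "\<bar>a\<bar>" "\<bar>b\<bar>"]
    unfolding abs_mult power2_abs by linarith
  then show "AE x in M. norm (f x * g x) \<le> norm ((f x)\<^sup>2 + (g x)\<^sup>2)"
    by (intro AE_I2) (auto intro: order_trans[OF _ abs_ge_self])
qed

lemma sq_integrable_cmult: "f \<in> sq_integrable M \<Longrightarrow> (\<lambda>x. c * f x) \<in> sq_integrable M"
  by (auto simp: sq_integrable_def power_mult_distrib)

lemma sq_integrable_add:
  assumes "f \<in> sq_integrable M" "g \<in> sq_integrable M"
  shows "(\<lambda>x. f x + g x) \<in> sq_integrable M"
proof -
  have "integrable M (\<lambda>x. (f x)\<^sup>2 + (g x)\<^sup>2 + 2 * (f x * g x))"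
    using assms by (intro Bochner_Integration.integrable_add integrable_mult_right sq_integrableD sq_integrable_mult)
  then show ?thesis
    using assms by (auto simp: sq_integrable_def power2_sum algebra_simps)
qed

lemma sq_integrable_diff:
  "f \<in> sq_integrable M \<Longrightarrow> g \<in> sq_integrable M \<Longrightarrow> (\<lambda>x. f x - g x) \<in> sq_integrable M"
  using sq_integrable_add[OF _ sq_integrable_cmult[of g M "-1"]] by simp

lemma sq_integrable_zero: "(\<lambda>_. 0) \<in> sq_integrable M"
  by (simp add: sq_integrable_def)

lemma sq_integrable_sum:
  "(\<And>i. i \<in> F \<Longrightarrow> f i \<in> sq_integrable M) \<Longrightarrow> (\<lambda>x. \<Sum>i\<in>F. f i x) \<in> sq_integrable M"
  by (induction F rule: infinite_finite_induct) (auto intro: sq_integrable_add sq_integrable_zero)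

lemma sq_integrable_lin_comb:
  "(\<And>i. b i \<in> sq_integrable M) \<Longrightarrow> lin_comb F a b \<in> sq_integrable M"
  unfolding lin_comb_def by (intro sq_integrable_sum sq_integrable_cmult)

lemma (in finite_measure) sq_integrable_bounded:
  assumes "f \<in> borel_measurable M" "\<And>x. x \<in> space M \<Longrightarrow> \<bar>f x\<bar> \<le> B"
  shows "f \<in> sq_integrable M"
proof -
  have "integrable M (\<lambda>x. (f x)\<^sup>2)"
  proof (rule integrable_const_bound[of _ "B\<^sup>2"])
    show "AE x in M. norm ((f x)\<^sup>2) \<le> B\<^sup>2"
      using assms(2) by (intro AE_I2) (auto simp: abs_le_square_iff[symmetric] intro: order_trans[OF _ abs_ge_self])
  qed (use assms in measurable)
  then show ?thesis using assms by (simp add: sq_integrable_def)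
qed

lemma (in finite_measure) sq_integrable_integrable:
  assumes "f \<in> sq_integrable M" shows "integrable M f"
proof -
  have "(\<lambda>_. 1) \<in> sq_integrable M" by (rule sq_integrable_bounded[of _ 1]) auto
  from sq_integrable_mult[OF assms this] show ?thesis by simp
qed

lemma L2_inner_commute: "L2_inner M f g = L2_inner M g f"
  by (simp add: L2_inner_def mult.commute)

lemma L2_inner_add:
  assumes "f \<in> sq_integrable M" "g \<in> sq_integrable M" "h \<in> sq_integrable M"
  shows "L2_inner M (\<lambda>x. f x + g x) h = L2_inner M f h + L2_inner M g h"
  unfolding L2_inner_def using assms by (simp add: distrib_right sq_integrable_mult)

lemma L2_inner_add_right:
  assumes "f \<in> sq_integrable M" "g \<in> sq_integrable M" "h \<in> sq_integrable M"
  shows "L2_inner M h (\<lambda>x. f x + g x) = L2_inner M h f + L2_inner M h g"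
  unfolding L2_inner_def using assms by (simp add: distrib_left sq_integrable_mult)

lemma L2_inner_cmult_right: "L2_inner M h (\<lambda>x. c * f x) = c * L2_inner M h f"
  unfolding L2_inner_def by (simp add: mult.left_commute[of _ c])

lemma L2_inner_diff:
  assumes "f \<in> sq_integrable M" "g \<in> sq_integrable M" "h \<in> sq_integrable M"
  shows "L2_inner M (\<lambda>x. f x - g x) h = L2_inner M f h - L2_inner M g h"
  unfolding L2_inner_def using assms by (simp add: left_diff_distrib sq_integrable_mult)

lemma L2_inner_cmult: "L2_inner M (\<lambda>x. c * f x) h = c * L2_inner M f h"
  unfolding L2_inner_def by (simp add: mult.assoc)

lemma L2_inner_sum:
  assumes "\<And>i. i \<in> F \<Longrightarrow> f i \<in> sq_integrable M" "h \<in> sq_integrable M"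
  shows "L2_inner M (\<lambda>x. \<Sum>i\<in>F. f i x) h = (\<Sum>i\<in>F. L2_inner M (f i) h)"
  unfolding L2_inner_def sum_distrib_right using assms
  by (intro Bochner_Integration.integral_sum sq_integrable_mult)

lemma L2_inner_cong_AE:
  assumes "f \<in> sq_integrable M" "g \<in> sq_integrable M" "AE x in M. f x = g x" "h \<in> sq_integrable M"
  shows "L2_inner M f h = L2_inner M g h"
  unfolding L2_inner_def
proof (rule integral_cong_AE)
  show "(\<lambda>x. f x * h x) \<in> borel_measurable M" "(\<lambda>x. g x * h x) \<in> borel_measurable M"
    using assms by (auto simp: sq_integrable_def)
  show "AE x in M. f x * h x = g x * h x" using assms(3) by (auto elim!: eventually_mono)
qed

lemma L2_inner_self_nonneg: "0 \<le> L2_inner M f f"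
  unfolding L2_inner_def by (intro integral_nonneg_AE) auto

lemma L2_nrm_sq: "(L2_nrm M f)\<^sup>2 = L2_inner M f f"
  by (simp add: L2_nrm_def L2_inner_self_nonneg)

lemma L2_nrm_nonneg: "0 \<le> L2_nrm M f"
  by (simp add: L2_nrm_def L2_inner_self_nonneg)

text \<open>Functions that agree almost everywhere are not identified, so the form is only
  semidefinite; the discriminant argument covers this.\<close>

lemma L2_cauchy_schwarz:
  assumes f: "f \<in> sq_integrable M" and g: "g \<in> sq_integrable M"
  shows "\<bar>L2_inner M f g\<bar> \<le> L2_nrm M f * L2_nrm M g"
proof -
  have expand: "L2_inner M (\<lambda>x. f x + t * g x) (\<lambda>x. f x + t * g x)
      = L2_inner M f f + 2 * t * L2_inner M f g + t\<^sup>2 * L2_inner M g g" for t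
  proof -
    let ?h = "\<lambda>x. f x + t * g x"
    have h: "?h \<in> sq_integrable M" "(\<lambda>x. t * g x) \<in> sq_integrable M"
      using f g by (auto intro: sq_integrable_add sq_integrable_cmult)
    have "L2_inner M ?h ?h = L2_inner M f ?h + t * L2_inner M g ?h"
      using L2_inner_add[OF f h(2) h(1)] by (simp add: L2_inner_cmult)
    moreover have "L2_inner M f ?h = L2_inner M f f + t * L2_inner M f g"
      using L2_inner_add_right[OF f h(2) f] by (simp add: L2_inner_cmult_right)
    moreover have "L2_inner M g ?h = L2_inner M f g + t * L2_inner M g g"
      using L2_inner_add_right[OF f h(2) g] L2_inner_commute[of M g f] by (simp add: L2_inner_cmult_right)
    ultimately show ?thesis by (simp add: power2_eq_square algebra_simps)
  qed
  have "(L2_inner M f g)\<^sup>2 \<le> L2_inner M f f * L2_inner M g g"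
    by (rule sq_le_of_quadratic_nonneg[OF _ L2_inner_self_nonneg]) (metis expand L2_inner_self_nonneg)
  also have "\<dots> = (L2_nrm M f * L2_nrm M g)\<^sup>2" by (simp add: power_mult_distrib L2_nrm_sq)
  finally show ?thesis
    using L2_nrm_nonneg[of M f] L2_nrm_nonneg[of M g] by (simp add: abs_le_square_iff[symmetric])
qed

lemma L2_nrm_add_sq:
  assumes f: "f \<in> sq_integrable M" and g: "g \<in> sq_integrable M"
  shows "(L2_nrm M (\<lambda>x. f x + g x))\<^sup>2 = (L2_nrm M f)\<^sup>2 + 2 * L2_inner M f g + (L2_nrm M g)\<^sup>2"
proof -
  have h: "(\<lambda>x. f x + g x) \<in> sq_integrable M" using f g by (rule sq_integrable_add)
  show ?thesis unfolding L2_nrm_sq L2_inner_add[OF f g h]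
    using L2_inner_add_right[OF f g f] L2_inner_add_right[OF f g g] L2_inner_commute[of M g f] by simp
qed

lemma L2_nrm_triangle:
  assumes f: "f \<in> sq_integrable M" and g: "g \<in> sq_integrable M"
  shows "L2_nrm M (\<lambda>x. f x + g x) \<le> L2_nrm M f + L2_nrm M g"
proof (rule power2_le_imp_le)
  show "(L2_nrm M (\<lambda>x. f x + g x))\<^sup>2 \<le> (L2_nrm M f + L2_nrm M g)\<^sup>2"
    using L2_cauchy_schwarz[OF f g] by (simp add: L2_nrm_add_sq[OF f g] power2_sum)
qed (simp add: L2_nrm_nonneg)

lemma L2_nrm_cmult: "L2_nrm M (\<lambda>x. c * f x) = \<bar>c\<bar> * L2_nrm M f"
proof -
  have "L2_inner M (\<lambda>x. c * f x) (\<lambda>x. c * f x) = c\<^sup>2 * L2_inner M f f"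
    unfolding L2_inner_def by (simp add: power2_eq_square algebra_simps flip: Bochner_Integration.integral_mult_right_zero)
  then show ?thesis by (simp add: L2_nrm_def real_sqrt_mult)
qed

lemma L2_nrm_diff_commute: "L2_nrm M (\<lambda>x. f x - g x) = L2_nrm M (\<lambda>x. g x - f x)"
  unfolding L2_nrm_def L2_inner_def by (simp add: algebra_simps)

lemma L2_nrm_triangle_diff:
  assumes f: "f \<in> sq_integrable M" and g: "g \<in> sq_integrable M"
  shows "L2_nrm M f \<le> L2_nrm M (\<lambda>x. f x - g x) + L2_nrm M g"
  using L2_nrm_triangle[OF sq_integrable_diff[OF f g] g] by simp

lemma L2_nrm_cong_AE:
  assumes "f \<in> sq_integrable M" "g \<in> sq_integrable M" "AE x in M. f x = g x"
  shows "L2_nrm M f = L2_nrm M g"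
  unfolding L2_nrm_def using L2_inner_cong_AE[OF assms assms(1)] L2_inner_cong_AE[OF assms assms(2)]
  by (simp add: L2_inner_commute)

section \<open>The unit interval and the fundamental lemma\<close>

lemma space_unit_ivl: "space unit_ivl = {0<..<1}"
  by (simp add: unit_ivl_def space_restrict_space)

lemma sets_unit_ivl: "A \<in> sets unit_ivl \<longleftrightarrow> A \<in> sets borel \<and> A \<subseteq> {0<..<1}"
  by (auto simp: unit_ivl_def sets_restrict_space)

lemma prob_unit_ivl: "emeasure unit_ivl (space unit_ivl) = 1"
  by (simp add: unit_ivl_def space_restrict_space emeasure_restrict_space)

interpretation unit_ivl: finite_measure unit_ivl
  by standard (simp add: prob_unit_ivl)

lemma measurable_unit_ivl: "f \<in> borel_measurable borel \<Longrightarrow> f \<in> borel_measurable unit_ivl"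
  unfolding unit_ivl_def by (rule measurable_restrict_space1) simp

lemma continuous_bounded_unit_ivl:
  assumes "continuous_on UNIV f"
  obtains B where "\<And>x. x \<in> {0<..<1::real} \<Longrightarrow> \<bar>f x :: real\<bar> \<le> B"
proof -
  have "compact (f ` {0..1})"
    by (rule compact_continuous_image) (use assms continuous_on_subset in auto)
  then obtain B where "\<forall>y\<in>f ` {0..1}. norm y \<le> B" using compact_imp_bounded bounded_iff by blast
  then show thesis by (intro that[of B]) auto
qed

lemma sq_integrable_continuous:
  assumes "continuous_on UNIV f" shows "f \<in> sq_integrable unit_ivl"
proof -
  obtain B where "\<And>x. x \<in> {0<..<1} \<Longrightarrow> \<bar>f x\<bar> \<le> B" using continuous_bounded_unit_ivl[OF assms] by blast
  then show ?thesis
    by (intro unit_ivl.sq_integrable_bounded[of _ B] measurable_unit_ivl borel_measurable_continuous_onI assms)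
      (simp add: space_unit_ivl)
qed

lemma sq_integrable_smooth: "smooth f \<Longrightarrow> f \<in> sq_integrable unit_ivl"
  by (intro sq_integrable_continuous smooth_continuous)

lemma sq_integrable_test_fun1: "\<phi> \<in> test_fun1 \<Longrightarrow> \<phi> \<in> sq_integrable unit_ivl"
  by (intro sq_integrable_smooth test_fun1_smooth)

lemma integrable_mult_indicator_comp:
  fixes G :: "'a \<Rightarrow> real"
  assumes G: "integrable N G" and [measurable]: "X \<in> measurable N K" "A \<in> sets K"
  shows "integrable N (\<lambda>\<omega>. G \<omega> * indicator A (X \<omega>))"
proof (rule Bochner_Integration.integrable_bound[OF G])
  have [measurable]: "G \<in> borel_measurable N" using G by (rule borel_measurable_integrable)
  show "(\<lambda>\<omega>. G \<omega> * indicator A (X \<omega>)) \<in> borel_measurable N" by measurable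
qed (intro AE_I2, simp add: indicator_def)

text \<open>Annihilating all test functions of a coordinate is the same as annihilating all Borel sets
  of that coordinate; stated for a random coordinate so that it applies to the interval and, one
  coordinate at a time, to the cube.\<close>
lemma integral_indicator_of_test_fun1:
  fixes G X :: "'a \<Rightarrow> real"
  assumes G: "integrable N G" and X [measurable]: "X \<in> borel_measurable N"
    and X01: "\<And>\<omega>. \<omega> \<in> space N \<Longrightarrow> X \<omega> \<in> {0<..<1}"
    and test: "\<And>\<phi>. \<phi> \<in> test_fun1 \<Longrightarrow> (\<integral>\<omega>. G \<omega> * \<phi> (X \<omega>) \<partial>N) = 0"
    and A: "A \<in> sets borel"
  shows "(\<integral>\<omega>. G \<omega> * indicator A (X \<omega>) \<partial>N) = 0"
proof -
  have Gm [measurable]: "G \<in> borel_measurable N" using G by (rule borel_measurable_integrable)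
  \<comment> \<open>Dominated convergence with majorant |G|; all passages to the limit below go
    through it.\<close>
  have lim: "(\<integral>\<omega>. G \<omega> * h (X \<omega>) \<partial>N) = 0"
    if h: "\<And>n. h' n \<in> borel_measurable borel" "h \<in> borel_measurable borel"
      and b: "\<And>n x. \<bar>h' n x\<bar> \<le> 1" and conv: "\<And>x. x \<in> {0<..<1} \<Longrightarrow> (\<lambda>n. h' n x) \<longlonglongrightarrow> h x"
      and z: "\<And>n. (\<integral>\<omega>. G \<omega> * h' n (X \<omega>) \<partial>N) = 0" for h :: "real \<Rightarrow> real" and h'
  proof -
    note [measurable] = h
    have "(\<lambda>n. \<integral>\<omega>. G \<omega> * h' n (X \<omega>) \<partial>N) \<longlonglongrightarrow> (\<integral>\<omega>. G \<omega> * h (X \<omega>) \<partial>N)"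
    proof (rule integral_dominated_convergence[where w = "\<lambda>\<omega>. \<bar>G \<omega>\<bar>"])
      show "AE \<omega> in N. norm (G \<omega> * h' n (X \<omega>)) \<le> \<bar>G \<omega>\<bar>" for n
        using b by (intro AE_I2) (simp add: abs_mult mult_left_le)
      show "AE \<omega> in N. (\<lambda>n. G \<omega> * h' n (X \<omega>)) \<longlonglongrightarrow> G \<omega> * h (X \<omega>)"
        using conv X01 by (intro AE_I2 tendsto_mult tendsto_const) blast
    qed (use G in \<open>simp_all add: Bochner_Integration.integrable_abs\<close>)
    then show ?thesis using z by (simp add: LIMSEQ_const_iff)
  qed
  have open_ivl: "(\<integral>\<omega>. G \<omega> * indicator {a<..<b} (X \<omega>) \<partial>N) = 0" if "0 < a" "b < 1" for a b
  proof (rule lim[where h' = "\<lambda>n. bump n a b"])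
    show "bump n a b \<in> borel_measurable borel" for n
      by (intro borel_measurable_continuous_onI smooth_continuous smooth_bump)
    show "\<bar>bump n a b x\<bar> \<le> 1" for n x using bump_bounds[of n a b x] by simp
    show "(\<lambda>n. bump n a b x) \<longlonglongrightarrow> indicator {a<..<b} x" for x by (rule bump_tendsto)
    show "(\<integral>\<omega>. G \<omega> * bump n a b (X \<omega>) \<partial>N) = 0" for n
      by (rule test[OF bump_test_fun1[OF that]])
  qed simp
  have closed_ivl: "(\<integral>\<omega>. G \<omega> * indicator {a..b} (X \<omega>) \<partial>N) = 0" for a b
  proof -
    define e where "e n = inverse (real (Suc n))" for n
    \<comment> \<open>Open intervals converging to the part of \<open>{a..b}\<close> inside (0, 1),
      clipped at distance \<open>e n\<close> from the end points so that their bumps are test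
      functions. The values of \<open>X\<close> avoid 0 and 1, so the clipping disappears in the
      limit.\<close>
    define a' where "a' n = max (a - e n) (e n)" for n
    define b' where "b' n = min (b + e n) (1 - e n)" for n
    show ?thesis
    proof (rule lim[where h' = "\<lambda>n. indicator {a' n<..<b' n}"])
      have inv0: "0 < e n" for n by (simp add: e_def)
      show "(\<integral>\<omega>. G \<omega> * indicator {a' n<..<b' n} (X \<omega>) \<partial>N) = 0" for n
        using inv0[of n] unfolding a'_def b'_def by (intro open_ivl) (auto simp: less_max_iff_disj min_less_iff_disj)
      fix x :: real assume x: "x \<in> {0<..<1}"
      have ev: "\<forall>\<^sub>F n in sequentially. e n < \<delta>" if "0 < \<delta>" for \<delta>
        using order_tendstoD(2)[OF LIMSEQ_inverse_real_of_nat that] unfolding e_def .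
      show "(\<lambda>n. indicator {a' n<..<b' n} x :: real) \<longlonglongrightarrow> indicator {a..b} x"
      proof (rule Lim_transform_eventually[OF tendsto_const])
        show "\<forall>\<^sub>F n in sequentially. indicator {a..b} x = (indicator {a' n<..<b' n} x :: real)"
        proof (cases "x \<in> {a..b}")
          case True
          have "\<forall>\<^sub>F n in sequentially. e n < x \<and> e n < 1 - x"
            using x by (intro eventually_conj ev) auto
          then show ?thesis
          proof (rule eventually_mono)
            fix n assume "e n < x \<and> e n < 1 - x"
            then have "x \<in> {a' n<..<b' n}" using True inv0[of n] by (simp add: a'_def b'_def)
            then show "indicator {a..b} x = (indicator {a' n<..<b' n} x :: real)" using True by simp
          qed
        next
          case False
          then consider "0 < a - x" | "0 < x - b" by force
          then show ?thesis
          proof cases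
            case 1
            from ev[OF this] show ?thesis
              by (rule eventually_mono) (use 1 in \<open>auto simp: a'_def indicator_def\<close>)
          next
            case 2
            from ev[OF this] show ?thesis
              by (rule eventually_mono) (use 2 in \<open>auto simp: b'_def indicator_def\<close>)
          qed
        qed
      qed
    qed (auto simp: indicator_def)
  qed
  from A show ?thesis
  proof (induction rule: borel_set_induct)
    case empty show ?case by simp
  next
    case (interval a b) show ?case by (rule closed_ivl)
  next
    case (compl A)
    have iA: "integrable N (\<lambda>\<omega>. G \<omega> * indicator A (X \<omega>))"
      by (rule integrable_mult_indicator_comp[OF G X compl(1)])
    \<comment> \<open>\<open>{0..1}\<close> acts as the whole space, since \<open>X\<close> takes
      its values in (0, 1).\<close>
    have "(\<integral>\<omega>. G \<omega> * indicator (- A) (X \<omega>) \<partial>N) = (\<integral>\<omega>. G \<omega> * indicator {0..1} (X \<omega>) - G \<omega> * indicator A (X \<omega>) \<partial>N)"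
      by (rule Bochner_Integration.integral_cong[OF refl]) (use X01 in \<open>force simp: indicator_def\<close>)
    also have "\<dots> = (\<integral>\<omega>. G \<omega> * indicator {0..1} (X \<omega>) \<partial>N) - (\<integral>\<omega>. G \<omega> * indicator A (X \<omega>) \<partial>N)"
      by (rule Bochner_Integration.integral_diff[OF integrable_mult_indicator_comp[OF G X] iA]) simp
    finally show ?case using compl closed_ivl by simp
  next
    case (union f)
    note [measurable] = union(2)
    have part: "(\<integral>\<omega>. G \<omega> * indicator (\<Union>i<n. f i) (X \<omega>) \<partial>N) = 0" for n :: nat
    proof (induction n)
      case (Suc n)
      note int = integrable_mult_indicator_comp[OF G X]
      have disj: "(\<Union>i<n. f i) \<inter> f n = {}"
        using union(1) by (auto simp: disjoint_family_on_def) (metis IntI UNIV_I empty_iff less_irrefl)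
      have "(\<integral>\<omega>. G \<omega> * indicator (\<Union>i<Suc n. f i) (X \<omega>) \<partial>N)
          = (\<integral>\<omega>. G \<omega> * indicator (\<Union>i<n. f i) (X \<omega>) + G \<omega> * indicator (f n) (X \<omega>) \<partial>N)"
        using disj by (intro Bochner_Integration.integral_cong refl)
          (auto simp: lessThan_Suc indicator_def)
      also have "\<dots> = 0"
        using Suc union(3)[of n] by (subst Bochner_Integration.integral_add) (auto intro!: int)
      finally show ?case .
    qed simp
    show ?case
    proof (rule lim[where h' = "\<lambda>n. indicator (\<Union>i<n. f i)"])
      show "(\<lambda>n. indicator (\<Union>i<n. f i) x :: real) \<longlonglongrightarrow> indicator (\<Union>i. f i) x" for x
      proof (cases "x \<in> (\<Union>i. f i)")
        case True
        then obtain i where i: "x \<in> f i" by blast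
        have "\<forall>\<^sub>F n in sequentially. 1 = (indicator (\<Union>i<n. f i) x :: real)"
          using eventually_gt_at_top[of i] by (rule eventually_mono) (use i in \<open>auto simp: indicator_def\<close>)
        then show ?thesis using True by (intro Lim_transform_eventually[OF tendsto_const]) simp
      qed (auto simp: indicator_def)
      show "\<bar>indicator (\<Union>i<n. f i) x :: real\<bar> \<le> 1" for n x by (simp add: indicator_def)
    qed (use part in \<open>auto intro: borel_measurable_indicator sets.countable_UN union(2)\<close>)
  qed
qed

lemma AE_zero_of_set_integrals:
  assumes g: "integrable M g"
    and zero: "\<And>A. A \<in> sets M \<Longrightarrow> (\<integral>x. g x * indicator A x \<partial>M) = 0"
  shows "AE x in M. g x = (0::real)"
proof -
  have gm [measurable]: "g \<in> borel_measurable M" using g by (rule borel_measurable_integrable)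
  have part: "AE x in M. f x \<le> 0" if f: "integrable M f" and
    fz: "\<And>A. A \<in> sets M \<Longrightarrow> (\<integral>x. f x * indicator A x \<partial>M) = 0" for f :: "'a \<Rightarrow> real"
  proof -
    have fm [measurable]: "f \<in> borel_measurable M" using f by (rule borel_measurable_integrable)
    let ?A = "{x \<in> space M. 0 < f x}"
    have "integrable M (\<lambda>x. f x * indicator ?A x)"
      by (intro integrable_real_mult_indicator f) measurable
    from integral_nonneg_eq_0_iff_AE[OF this] fz[of ?A]
    have "AE x in M. f x * indicator ?A x = 0" by (auto simp: indicator_def)
    then show ?thesis by (rule AE_mp) (auto intro!: AE_I2 simp: indicator_def split: if_splits)
  qed
  have "AE x in M. g x \<le> 0" by (rule part[OF g zero])
  moreover have "AE x in M. - g x \<le> 0" by (rule part) (use g zero in auto)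
  ultimately show ?thesis by eventually_elim simp
qed

lemma fundamental_lemma_unit_ivl:
  assumes g: "g \<in> sq_integrable unit_ivl"
    and zero: "\<And>\<phi>. \<phi> \<in> test_fun1 \<Longrightarrow> (\<integral>x. g x * \<phi> x \<partial>unit_ivl) = 0"
  shows "AE x in unit_ivl. g x = 0"
proof (rule AE_zero_of_set_integrals[OF unit_ivl.sq_integrable_integrable[OF g]])
  fix A assume "A \<in> sets unit_ivl"
  then have "A \<in> sets borel" by (simp add: sets_unit_ivl)
  then show "(\<integral>x. g x * indicator A x \<partial>unit_ivl) = 0"
    by (rule integral_indicator_of_test_fun1[OF unit_ivl.sq_integrable_integrable[OF g], of "\<lambda>x. x", rotated -1])
      (auto simp: space_unit_ivl zero measurable_unit_ivl)
qed

section \<open>Weak derivatives on the unit interval\<close>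

abbreviation "L2I \<equiv> sq_integrable unit_ivl"
abbreviation "inI \<equiv> L2_inner unit_ivl"
abbreviation "nrI \<equiv> L2_nrm unit_ivl"

lemma is_weak_deriv_iff:
  "is_weak_deriv u g \<longleftrightarrow> (\<forall>\<phi>\<in>test_fun1. inI u (deriv \<phi>) = - inI g \<phi>)"
  by (simp add: is_weak_deriv_def L2_inner_def)

text \<open>A relation between a function and a derivative instead of the choice made by
  \<open>weak_deriv\<close>: it is linear in the pair and insensitive to representatives.
  \<open>weak_deriv_eq\<close> links the two.\<close>

definition wd :: "(real \<Rightarrow> real) \<Rightarrow> (real \<Rightarrow> real) \<Rightarrow> bool" where
  "wd u g \<longleftrightarrow> u \<in> L2I \<and> g \<in> L2I \<and> is_weak_deriv u g"

lemma wdD: "wd u g \<Longrightarrow> u \<in> L2I" "wd u g \<Longrightarrow> g \<in> L2I"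
  "wd u g \<Longrightarrow> \<phi> \<in> test_fun1 \<Longrightarrow> inI u (deriv \<phi>) = - inI g \<phi>"
  by (auto simp: wd_def is_weak_deriv_iff)

lemma wd_unique:
  assumes "wd u g" "wd u h" shows "AE x in unit_ivl. g x = h x"
proof -
  have gh: "(\<lambda>x. g x - h x) \<in> L2I" using assms by (intro sq_integrable_diff wdD)
  have "AE x in unit_ivl. g x - h x = 0"
  proof (rule fundamental_lemma_unit_ivl[OF gh])
    fix \<phi> assume \<phi>: "\<phi> \<in> test_fun1"
    have "inI (\<lambda>x. g x - h x) \<phi> = inI g \<phi> - inI h \<phi>"
      using assms by (intro L2_inner_diff wdD sq_integrable_test_fun1 \<phi>)
    also have "\<dots> = 0" using wdD(3)[OF assms(1) \<phi>] wdD(3)[OF assms(2) \<phi>] by simp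
    finally show "(\<integral>x. (g x - h x) * \<phi> x \<partial>unit_ivl) = 0" by (simp add: L2_inner_def)
  qed
  then show ?thesis by simp
qed

lemma wd_cong_AE:
  assumes "wd u g" "u' \<in> L2I" "AE x in unit_ivl. u x = u' x"
  shows "wd u' g"
  using assms L2_inner_cong_AE[OF wdD(1)[OF assms(1)] assms(2,3) sq_integrable_test_fun1[OF test_fun1_deriv]]
  by (simp add: wd_def is_weak_deriv_iff)

lemma wd_add: "wd u g \<Longrightarrow> wd v h \<Longrightarrow> wd (\<lambda>x. u x + v x) (\<lambda>x. g x + h x)"
  by (auto simp: wd_def is_weak_deriv_iff L2_inner_add sq_integrable_test_fun1 test_fun1_deriv
      intro!: sq_integrable_add)

lemma wd_cmult: "wd u g \<Longrightarrow> wd (\<lambda>x. c * u x) (\<lambda>x. c * g x)"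
  by (auto simp: wd_def is_weak_deriv_iff L2_inner_cmult intro!: sq_integrable_cmult)

lemma wd_diff: "wd u g \<Longrightarrow> wd v h \<Longrightarrow> wd (\<lambda>x. u x - v x) (\<lambda>x. g x - h x)"
  using wd_add[OF _ wd_cmult[of v h "-1"]] by simp

lemma weak_deriv_eq:
  assumes "wd u g"
  shows "wd u (weak_deriv u)" and "AE x in unit_ivl. weak_deriv u x = g x"
proof -
  have "\<exists>g. g \<in> L2I \<and> is_weak_deriv u g" using assms by (auto simp: wd_def)
  from someI_ex[OF this] show w: "wd u (weak_deriv u)"
    using assms by (auto simp: weak_deriv_def wd_def)
  show "AE x in unit_ivl. weak_deriv u x = g x" by (rule wd_unique[OF w assms])
qed

lemma H1_ivl_iff: "u \<in> H1_ivl \<longleftrightarrow> (\<exists>g. wd u g)"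
  by (auto simp: H1_ivl_def wd_def)

lemma smooth_isCont: "smooth f \<Longrightarrow> isCont f x"
  by (intro differentiable_imp_continuous_within smooth_differentiable)

lemma integral_deriv_unit_ivl:
  assumes "smooth F" shows "(\<integral>x. deriv F x \<partial>unit_ivl) = F 1 - F 0"
proof -
  have m: "deriv F \<in> borel_measurable borel"
    by (intro borel_measurable_continuous_onI smooth_continuous smooth_deriv assms)
  have "(\<integral>x. deriv F x \<partial>unit_ivl) = (\<integral>x. indicator {0<..<1} x *\<^sub>R deriv F x \<partial>lborel)"
    unfolding unit_ivl_def by (rule integral_restrict_space) simp
  also have "\<dots> = (\<integral>x. deriv F x * indicator {0..1} x \<partial>lborel)"
  proof (rule integral_cong_AE)
    have "AE x in lborel. x \<noteq> (0::real) \<and> x \<noteq> 1"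
      by (intro AE_conjI AE_lborel_singleton)
    then show "AE x in lborel. indicator {0<..<1} x *\<^sub>R deriv F x = deriv F x * indicator {0..1} x"
      by (rule AE_mp) (auto intro!: AE_I2 simp: indicator_def)
  qed (use m in measurable)
  also have "\<dots> = F 1 - F 0"
    by (rule integral_FTC_Icc_real) (auto intro: smooth_has_deriv smooth_isCont smooth_deriv assms)
  finally show ?thesis .
qed

lemma deriv_mult_smooth:
  assumes "smooth f" "smooth g"
  shows "deriv (\<lambda>x. f x * g x) = (\<lambda>x. deriv f x * g x + f x * deriv g x)"
  by (intro ext DERIV_imp_deriv)
    (use DERIV_mult[OF smooth_has_deriv[OF assms(1)] smooth_has_deriv[OF assms(2)]] in \<open>simp add: mult.commute add.commute\<close>)

lemma wd_smooth:
  assumes u: "smooth u" shows "wd u (deriv u)"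
  unfolding wd_def is_weak_deriv_iff
proof (intro conjI ballI)
  fix \<phi> assume \<phi>: "\<phi> \<in> test_fun1"
  note s = test_fun1_smooth[OF \<phi>]
  have "(\<integral>x. deriv u x * \<phi> x + u x * deriv \<phi> x \<partial>unit_ivl) = 0"
    using integral_deriv_unit_ivl[OF smooth_mult[OF u s]] test_fun1_01[OF \<phi>, of 0] test_fun1_01[OF \<phi>, of 1]
    by (simp add: deriv_mult_smooth[OF u s])
  moreover have "(\<integral>x. deriv u x * \<phi> x + u x * deriv \<phi> x \<partial>unit_ivl) = inI (deriv u) \<phi> + inI u (deriv \<phi>)"
    unfolding L2_inner_def using u s
    by (intro Bochner_Integration.integral_add sq_integrable_mult sq_integrable_smooth smooth_deriv)
  ultimately show "inI u (deriv \<phi>) = - inI (deriv u) \<phi>" by simp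
qed (intro sq_integrable_smooth smooth_deriv u)+

section \<open>Functions with vanishing boundary values\<close>

text \<open>The space \<open>H10_ivl\<close>, again as a relation to a derivative, with function and
  derivative approximated separately; \<open>h10_iff\<close> is the equivalence with the norm-based
  definition.\<close>

definition h10 :: "(real \<Rightarrow> real) \<Rightarrow> (real \<Rightarrow> real) \<Rightarrow> bool" where
  "h10 u g \<longleftrightarrow> wd u g \<and>
     (\<forall>\<epsilon>>0. \<exists>\<phi>\<in>test_fun1. nrI (\<lambda>x. u x - \<phi> x) < \<epsilon> \<and> nrI (\<lambda>x. g x - deriv \<phi> x) < \<epsilon>)"

lemma H1_nrm_sq:
  assumes "wd u g" shows "(H1_nrm u)\<^sup>2 = (nrI u)\<^sup>2 + (nrI g)\<^sup>2" "0 \<le> H1_nrm u"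
proof -
  have "nrI (weak_deriv u) = nrI g"
    using weak_deriv_eq[OF assms] assms by (intro L2_nrm_cong_AE wdD)
  then show "(H1_nrm u)\<^sup>2 = (nrI u)\<^sup>2 + (nrI g)\<^sup>2" "0 \<le> H1_nrm u"
    by (simp_all add: H1_nrm_def)
qed

lemma h10_iff: "h10 u g \<longleftrightarrow> wd u g \<and> u \<in> H10_ivl"
proof (cases "wd u g")
  case u: True
  have wd\<phi>: "wd (\<lambda>x. u x - \<phi> x) (\<lambda>x. g x - deriv \<phi> x)" if "\<phi> \<in> test_fun1" for \<phi>
    by (intro wd_diff wd_smooth test_fun1_smooth that u)
  note sq = H1_nrm_sq[OF wd\<phi>]
  show ?thesis
  proof
    assume h: "h10 u g"
    have "\<exists>\<phi>\<in>test_fun1. H1_nrm (\<lambda>x. u x - \<phi> x) < \<epsilon>" if \<epsilon>: "\<epsilon> > 0" for \<epsilon>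
    proof -
      obtain \<phi> where \<phi>: "\<phi> \<in> test_fun1" "nrI (\<lambda>x. u x - \<phi> x) < \<epsilon> / 2" "nrI (\<lambda>x. g x - deriv \<phi> x) < \<epsilon> / 2"
        using h \<epsilon> unfolding h10_def by (meson half_gt_zero)
      have "(H1_nrm (\<lambda>x. u x - \<phi> x))\<^sup>2 < (\<epsilon> / 2)\<^sup>2 + (\<epsilon> / 2)\<^sup>2"
        unfolding sq(1)[OF \<phi>(1)] using \<phi> by (intro add_strict_mono power_strict_mono L2_nrm_nonneg) auto
      also have "\<dots> \<le> \<epsilon>\<^sup>2" by (simp add: power_divide)
      finally have "H1_nrm (\<lambda>x. u x - \<phi> x) < \<epsilon>" by (rule power2_less_imp_less) (use \<epsilon> in simp)
      with \<phi>(1) show ?thesis by blast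
    qed
    then show "wd u g \<and> u \<in> H10_ivl" using u by (auto simp: H10_ivl_def H1_ivl_iff)
  next
    assume h: "wd u g \<and> u \<in> H10_ivl"
    have "\<exists>\<phi>\<in>test_fun1. nrI (\<lambda>x. u x - \<phi> x) < \<epsilon> \<and> nrI (\<lambda>x. g x - deriv \<phi> x) < \<epsilon>" if \<epsilon>: "\<epsilon> > 0" for \<epsilon>
    proof -
      obtain \<phi> where \<phi>: "\<phi> \<in> test_fun1" "H1_nrm (\<lambda>x. u x - \<phi> x) < \<epsilon>"
        using h \<epsilon> unfolding H10_ivl_def by blast
      have "(H1_nrm (\<lambda>x. u x - \<phi> x))\<^sup>2 < \<epsilon>\<^sup>2"
        using \<phi> sq(2)[OF \<phi>(1)] by (intro power_strict_mono) auto
      then have *: "(nrI (\<lambda>x. u x - \<phi> x))\<^sup>2 + (nrI (\<lambda>x. g x - deriv \<phi> x))\<^sup>2 < \<epsilon>\<^sup>2"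
        unfolding sq(1)[OF \<phi>(1)] .
      have "(nrI (\<lambda>x. u x - \<phi> x))\<^sup>2 < \<epsilon>\<^sup>2" "(nrI (\<lambda>x. g x - deriv \<phi> x))\<^sup>2 < \<epsilon>\<^sup>2"
        using * zero_le_power2[of "nrI (\<lambda>x. u x - \<phi> x)"] zero_le_power2[of "nrI (\<lambda>x. g x - deriv \<phi> x)"] by linarith+
      then show ?thesis using \<phi>(1) \<epsilon> by (auto intro!: bexI[of _ \<phi>] elim!: power2_less_imp_less)
    qed
    then show "h10 u g" using u by (auto simp: h10_def)
  qed
qed (auto simp: h10_def)

lemma h10_cmult:
  assumes "h10 u g" shows "h10 (\<lambda>x. c * u x) (\<lambda>x. c * g x)"
  unfolding h10_def
proof (intro conjI allI impI)
  show "wd (\<lambda>x. c * u x) (\<lambda>x. c * g x)" using assms by (auto simp: h10_def intro: wd_cmult)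
  fix \<epsilon> :: real assume \<epsilon>: "\<epsilon> > 0"
  define \<delta> where "\<delta> = \<epsilon> / (\<bar>c\<bar> + 1)"
  have \<delta>: "\<delta> > 0" "\<bar>c\<bar> * \<delta> < \<epsilon>" using \<epsilon> by (auto simp: \<delta>_def field_simps)
  obtain \<phi> where \<phi>: "\<phi> \<in> test_fun1" "nrI (\<lambda>x. u x - \<phi> x) < \<delta>" "nrI (\<lambda>x. g x - deriv \<phi> x) < \<delta>"
    using assms \<delta>(1) unfolding h10_def by blast
  have s: "smooth \<phi>" by (rule test_fun1_smooth[OF \<phi>(1)])
  have d: "deriv (\<lambda>x. c * \<phi> x) = (\<lambda>x. c * deriv \<phi> x)"
    by (intro ext deriv_cmult) (use s smooth_has_deriv in \<open>auto simp: field_differentiable_def\<close>)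
  have lt: "\<bar>c\<bar> * t < \<epsilon>" if "t < \<delta>" for t
    using mult_left_mono[of t \<delta> "\<bar>c\<bar>"] that \<delta>(2) by simp
  show "\<exists>\<phi>\<in>test_fun1. nrI (\<lambda>x. c * u x - \<phi> x) < \<epsilon> \<and> nrI (\<lambda>x. c * g x - deriv \<phi> x) < \<epsilon>"
  proof (intro bexI[of _ "\<lambda>x. c * \<phi> x"] conjI)
    show "nrI (\<lambda>x. c * u x - c * \<phi> x) < \<epsilon>" "nrI (\<lambda>x. c * g x - deriv (\<lambda>x. c * \<phi> x) x) < \<epsilon>"
      using lt[OF \<phi>(2)] lt[OF \<phi>(3)] L2_nrm_cmult[of unit_ivl c "\<lambda>x. u x - \<phi> x"]
        L2_nrm_cmult[of unit_ivl c "\<lambda>x. g x - deriv \<phi> x"] by (simp_all add: d right_diff_distrib)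
  qed (rule test_fun1_mult_smooth[OF smooth_const \<phi>(1)])
qed

lemma test_fun1_add:
  assumes "\<phi> \<in> test_fun1" "\<xi> \<in> test_fun1"
  shows "(\<lambda>x. \<phi> x + \<xi> x) \<in> test_fun1" "deriv (\<lambda>x. \<phi> x + \<xi> x) = (\<lambda>x. deriv \<phi> x + deriv \<xi> x)"
proof -
  have D: "deriv (\<lambda>x. f x + g x) = (\<lambda>x. deriv f x + deriv g x)" if "smooth f" "smooth g" for f g
    by (intro ext deriv_add) (use that smooth_has_deriv in \<open>auto simp: field_differentiable_def\<close>)
  have "smooth (\<lambda>x. \<phi> x + \<xi> x)"
  proof (rule smooth_coinduct)
    let ?X = "{h. \<exists>f g. smooth f \<and> smooth g \<and> h = (\<lambda>x. f x + g x)}"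
    show "(\<lambda>x. \<phi> x + \<xi> x) \<in> ?X" using assms test_fun1_smooth by blast
    fix h assume "h \<in> ?X"
    then obtain f g where fg: "smooth f" "smooth g" "h = (\<lambda>x. f x + g x)" by blast
    have "h differentiable (at x)" for x
      unfolding fg(3) by (intro differentiable_add smooth_differentiable fg)
    moreover have "deriv h \<in> ?X"
      unfolding fg(3) D[OF fg(1,2)] using smooth_deriv[OF fg(1)] smooth_deriv[OF fg(2)] by blast
    ultimately show "(\<forall>x. h differentiable (at x)) \<and> deriv h \<in> ?X" by blast
  qed
  moreover obtain K where K: "compact K" "K \<subseteq> {0<..<1}" "\<And>x. x \<notin> K \<Longrightarrow> \<phi> x = 0"
    using assms(1) by (auto simp: test_fun1_iff)
  moreover obtain K' where K': "compact K'" "K' \<subseteq> {0<..<1}" "\<And>x. x \<notin> K' \<Longrightarrow> \<xi> x = 0"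
    using assms(2) by (auto simp: test_fun1_iff)
  ultimately show "(\<lambda>x. \<phi> x + \<xi> x) \<in> test_fun1"
    unfolding test_fun1_iff by (intro conjI exI[of _ "K \<union> K'"]) (force intro: compact_Un)+
  show "deriv (\<lambda>x. \<phi> x + \<xi> x) = (\<lambda>x. deriv \<phi> x + deriv \<xi> x)"
    using assms by (intro D test_fun1_smooth)
qed

lemma h10_add:
  assumes "h10 u g" "h10 v h" shows "h10 (\<lambda>x. u x + v x) (\<lambda>x. g x + h x)"
  unfolding h10_def
proof (intro conjI allI impI)
  have w: "wd u g" "wd v h" using assms by (auto simp: h10_def)
  show "wd (\<lambda>x. u x + v x) (\<lambda>x. g x + h x)" by (rule wd_add[OF w])
  fix \<epsilon> :: real assume "\<epsilon> > 0"
  then have "\<epsilon> / 2 > 0" by simp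
  obtain \<phi> where \<phi>: "\<phi> \<in> test_fun1" "nrI (\<lambda>x. u x - \<phi> x) < \<epsilon> / 2" "nrI (\<lambda>x. g x - deriv \<phi> x) < \<epsilon> / 2"
    using assms(1) \<open>\<epsilon> / 2 > 0\<close> unfolding h10_def by blast
  obtain \<xi> where \<xi>: "\<xi> \<in> test_fun1" "nrI (\<lambda>x. v x - \<xi> x) < \<epsilon> / 2" "nrI (\<lambda>x. h x - deriv \<xi> x) < \<epsilon> / 2"
    using assms(2) \<open>\<epsilon> / 2 > 0\<close> unfolding h10_def by blast
  have tri: "nrI (\<lambda>x. (a x + b x) - (a' x + b' x)) < \<epsilon>"
    if "a \<in> L2I" "b \<in> L2I" "a' \<in> L2I" "b' \<in> L2I" "nrI (\<lambda>x. a x - a' x) < \<epsilon> / 2" "nrI (\<lambda>x. b x - b' x) < \<epsilon> / 2" for a b a' b'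
    using L2_nrm_triangle[OF sq_integrable_diff[OF that(1,3)] sq_integrable_diff[OF that(2,4)]] that(5,6)
    by (simp add: algebra_simps)
  show "\<exists>\<phi>\<in>test_fun1. nrI (\<lambda>x. u x + v x - \<phi> x) < \<epsilon> \<and> nrI (\<lambda>x. g x + h x - deriv \<phi> x) < \<epsilon>"
  proof (intro bexI[of _ "\<lambda>x. \<phi> x + \<xi> x"] conjI)
    show "nrI (\<lambda>x. u x + v x - (\<phi> x + \<xi> x)) < \<epsilon>"
      by (intro tri wdD(1)[OF w(1)] wdD(1)[OF w(2)] sq_integrable_test_fun1 \<phi> \<xi>)
    show "nrI (\<lambda>x. g x + h x - deriv (\<lambda>x. \<phi> x + \<xi> x) x) < \<epsilon>"
      unfolding test_fun1_add(2)[OF \<phi>(1) \<xi>(1)]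
      by (intro tri wdD(2)[OF w(1)] wdD(2)[OF w(2)] sq_integrable_test_fun1 test_fun1_deriv \<phi> \<xi>)
  qed (rule test_fun1_add(1)[OF \<phi>(1) \<xi>(1)])
qed

lemma h10_zero: "h10 (\<lambda>_. 0) (\<lambda>_. 0)"
proof -
  have t: "(\<lambda>_. 0) \<in> test_fun1" by (auto simp: test_fun1_iff smooth_const intro!: exI[of _ "{}"])
  show ?thesis unfolding h10_def using wd_smooth[OF smooth_const[of 0]] t
    by (auto intro!: bexI[OF _ t] simp: L2_nrm_def L2_inner_def)
qed

lemma h10_sum: "(\<And>i. i \<in> F \<Longrightarrow> h10 (u i) (g i)) \<Longrightarrow> h10 (\<lambda>x. \<Sum>i\<in>F. u i x) (\<lambda>x. \<Sum>i\<in>F. g i x)"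
  by (induction F rule: infinite_finite_induct) (auto intro: h10_zero h10_add)

lemma wd_sum: "(\<And>i. i \<in> F \<Longrightarrow> wd (u i) (g i)) \<Longrightarrow> wd (\<lambda>x. \<Sum>i\<in>F. u i x) (\<lambda>x. \<Sum>i\<in>F. g i x)"
  using wd_smooth[OF smooth_const[of 0]]
  by (induction F rule: infinite_finite_induct) (auto intro: wd_add)

text \<open>Only one factor needs vanishing boundary values. Replacing it by a test function
  \<open>\<phi>\<close> leaves an error of at most \<epsilon> times the two norms of the other
  factor, and for \<open>\<phi>\<close> the identity is the definition of the weak
  derivative.\<close>

lemma h10_parts:
  assumes u: "h10 u g" and v: "wd v h" shows "inI g v = - inI u h"
proof -
  have wu: "wd u g" using u by (simp add: h10_def)
  have "\<bar>inI g v + inI u h\<bar> \<le> \<epsilon> * (nrI v + nrI h)" if \<epsilon>: "\<epsilon> > 0" for \<epsilon>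
  proof -
    obtain \<phi> where \<phi>: "\<phi> \<in> test_fun1" "nrI (\<lambda>x. u x - \<phi> x) < \<epsilon>" "nrI (\<lambda>x. g x - deriv \<phi> x) < \<epsilon>"
      using u \<epsilon> unfolding h10_def by blast
    note [simp] = wdD[OF wu] wdD[OF v] sq_integrable_test_fun1[OF \<phi>(1)]
      sq_integrable_test_fun1[OF test_fun1_deriv[OF \<phi>(1)]]
    have eq: "inI g v + inI u h = inI (\<lambda>x. g x - deriv \<phi> x) v + inI (\<lambda>x. u x - \<phi> x) h"
      using wdD(3)[OF v \<phi>(1)] by (simp add: L2_inner_diff L2_inner_commute[of _ v] L2_inner_commute[of _ h])
    have "\<bar>inI g v + inI u h\<bar> \<le> nrI (\<lambda>x. g x - deriv \<phi> x) * nrI v + nrI (\<lambda>x. u x - \<phi> x) * nrI h"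
      unfolding eq by (intro order_trans[OF abs_triangle_ineq] add_mono L2_cauchy_schwarz sq_integrable_diff) auto
    also have "\<dots> \<le> \<epsilon> * nrI v + \<epsilon> * nrI h"
      using \<phi> by (intro add_mono mult_right_mono L2_nrm_nonneg) auto
    finally show ?thesis by (simp add: distrib_left)
  qed
  then have "\<bar>inI g v + inI u h\<bar> \<le> 0"
    by (intro tendsto_lowerbound[where f = "\<lambda>\<epsilon>. \<epsilon> * (nrI v + nrI h)" and F = "at_right 0"])
      (auto intro!: tendsto_eq_intros eventually_at_right_less[THEN eventually_mono])
  then show ?thesis by simp
qed

text \<open>Integrating x' \<phi>^2 by parts gives the integral of \<phi>^2 as -2 times that of x
  \<phi> \<phi>'; with |x| at most 1, Cauchy-Schwarz yields the constant 2.\<close>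

lemma poincare_test:
  assumes \<phi>: "\<phi> \<in> test_fun1" shows "nrI \<phi> \<le> 2 * nrI (deriv \<phi>)"
proof -
  have s: "smooth \<phi>" by (rule test_fun1_smooth[OF \<phi>])
  have sid: "smooth (\<lambda>x. x)"
    by (rule smooth_coinduct[of _ "insert (\<lambda>x. x) (range (\<lambda>c _. c))"]) auto
  have sx: "smooth (\<lambda>x. x * \<phi> x)" by (rule smooth_mult[OF sid s])
  have "deriv (\<lambda>x. x * \<phi> x) = (\<lambda>x. \<phi> x + x * deriv \<phi> x)"
    unfolding deriv_mult_smooth[OF sid s] by simp
  note [simp] = sq_integrable_smooth[OF s] sq_integrable_smooth[OF sx] sq_integrable_smooth[OF smooth_deriv[OF s]]
    sq_integrable_smooth[OF smooth_mult[OF sid smooth_deriv[OF s]]]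
  have "inI (\<lambda>x. x * \<phi> x) (deriv \<phi>) = - inI (\<lambda>x. \<phi> x + x * deriv \<phi> x) \<phi>"
    using wdD(3)[OF wd_smooth[OF sx] \<phi>] \<open>deriv (\<lambda>x. x * \<phi> x) = _\<close> by simp
  also have "\<dots> = - inI \<phi> \<phi> - inI (\<lambda>x. x * deriv \<phi> x) \<phi>" by (simp add: L2_inner_add)
  also have "inI (\<lambda>x. x * deriv \<phi> x) \<phi> = inI (\<lambda>x. x * \<phi> x) (deriv \<phi>)"
    by (simp add: L2_inner_def mult_ac)
  finally have "inI \<phi> \<phi> = - 2 * inI (\<lambda>x. x * \<phi> x) (deriv \<phi>)" by simp
  also have "\<dots> \<le> 2 * (nrI (\<lambda>x. x * \<phi> x) * nrI (deriv \<phi>))"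
  proof -
    have "\<bar>inI (\<lambda>x. x * \<phi> x) (deriv \<phi>)\<bar> \<le> nrI (\<lambda>x. x * \<phi> x) * nrI (deriv \<phi>)"
      by (rule L2_cauchy_schwarz) simp_all
    then show ?thesis by linarith
  qed
  also have "\<dots> \<le> 2 * (nrI \<phi> * nrI (deriv \<phi>))"
  proof -
    have "inI (\<lambda>x. x * \<phi> x) (\<lambda>x. x * \<phi> x) \<le> inI \<phi> \<phi>"
      unfolding L2_inner_def
    proof (rule integral_mono)
      fix x assume "x \<in> space unit_ivl"
      then have "x\<^sup>2 \<le> 1" by (simp add: space_unit_ivl abs_square_le_1)
      then have "x\<^sup>2 * (\<phi> x)\<^sup>2 \<le> (\<phi> x)\<^sup>2" by (intro mult_left_le_one_le) auto
      then show "x * \<phi> x * (x * \<phi> x) \<le> \<phi> x * \<phi> x" by (simp add: power2_eq_square mult_ac)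
    qed (auto intro!: sq_integrable_mult)
    then have "nrI (\<lambda>x. x * \<phi> x) \<le> nrI \<phi>" by (simp add: L2_nrm_def)
    then show ?thesis using L2_nrm_nonneg by (intro mult_left_mono mult_right_mono) auto
  qed
  finally have "nrI \<phi> * nrI \<phi> \<le> nrI \<phi> * (2 * nrI (deriv \<phi>))"
    using L2_nrm_sq[of unit_ivl \<phi>] by (simp add: power2_eq_square)
  then show ?thesis using L2_nrm_nonneg[of unit_ivl \<phi>] L2_nrm_nonneg[of unit_ivl "deriv \<phi>"]
    by (cases "nrI \<phi> = 0") auto
qed

lemma poincare:
  assumes u: "h10 u g" shows "nrI u \<le> 2 * nrI g"
proof (rule field_le_epsilon)
  fix e :: real assume "e > 0"
  then have "e / 3 > 0" by simp
  then obtain \<phi> where \<phi>: "\<phi> \<in> test_fun1" "nrI (\<lambda>x. u x - \<phi> x) < e / 3" "nrI (\<lambda>x. g x - deriv \<phi> x) < e / 3"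
    using u unfolding h10_def by blast
  have wu: "u \<in> L2I" "g \<in> L2I" using u by (auto simp: h10_def intro: wdD)
  have t: "\<phi> \<in> L2I" "deriv \<phi> \<in> L2I" using \<phi>(1) by (auto intro: sq_integrable_test_fun1 test_fun1_deriv)
  have "nrI u \<le> e / 3 + nrI \<phi>" using L2_nrm_triangle_diff[OF wu(1) t(1)] \<phi>(2) by simp
  also have "nrI \<phi> \<le> 2 * nrI (deriv \<phi>)" by (rule poincare_test[OF \<phi>(1)])
  also have "nrI (deriv \<phi>) \<le> e / 3 + nrI g"
    using L2_nrm_triangle_diff[OF t(2) wu(2)] \<phi>(3) L2_nrm_diff_commute[of unit_ivl g "deriv \<phi>"] by simp
  finally show "nrI u \<le> 2 * nrI g + e" by simp
qed

text \<open>The second derivative alone is an equivalent norm. Integration by parts and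
  \<open>poincare\<close> give that \<open>nrI g\<close> is at most \<open>2 * nrI h\<close>, hence
  \<open>nrI u\<close> at most \<open>4 * nrI h\<close>, and 21 = 16 + 4 + 1.\<close>

lemma h2_bounds:
  assumes u: "h10 u g" and g: "wd g h"
  shows "nrI h \<le> H2_nrm u" and "(H2_nrm u)\<^sup>2 \<le> 21 * (nrI h)\<^sup>2" and "nrI u \<le> H2_nrm u"
proof -
  have wu: "wd u g" using u by (simp add: h10_def)
  have L: "u \<in> L2I" "g \<in> L2I" "h \<in> L2I" using wu g by (auto intro: wdD)
  note wu' = weak_deriv_eq[OF wu]
  have g': "wd (weak_deriv u) h"
    by (rule wd_cong_AE[OF g]) (use wu' in \<open>auto intro: wdD elim: eventually_mono\<close>)
  have n: "nrI (weak_deriv u) = nrI g" "nrI (weak_deriv (weak_deriv u)) = nrI h"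
    using wu' weak_deriv_eq[OF g'] L by (auto intro!: L2_nrm_cong_AE wdD)
  have H: "H2_nrm u = sqrt ((nrI u)\<^sup>2 + (nrI g)\<^sup>2 + (nrI h)\<^sup>2)" by (simp add: H2_nrm_def n)
  show "nrI h \<le> H2_nrm u" "nrI u \<le> H2_nrm u" unfolding H by (rule real_le_rsqrt, simp)+
  have "(nrI g)\<^sup>2 = - inI u h" using h10_parts[OF u g] by (simp add: L2_nrm_sq)
  also have "\<dots> \<le> nrI u * nrI h" using L2_cauchy_schwarz[OF L(1,3)] by simp
  also have "\<dots> \<le> (2 * nrI g) * nrI h" using poincare[OF u] L2_nrm_nonneg by (intro mult_right_mono) auto
  finally have "nrI g * nrI g \<le> nrI g * (2 * nrI h)" by (simp add: power2_eq_square mult_ac)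
  then have gh: "nrI g \<le> 2 * nrI h"
    using L2_nrm_nonneg[of unit_ivl g] L2_nrm_nonneg[of unit_ivl h] by (cases "nrI g = 0") auto
  have "(nrI g)\<^sup>2 \<le> (2 * nrI h)\<^sup>2" "(nrI u)\<^sup>2 \<le> (4 * nrI h)\<^sup>2"
    using gh poincare[OF u] by (intro power_mono L2_nrm_nonneg; linarith)+
  then show "(H2_nrm u)\<^sup>2 \<le> 21 * (nrI h)\<^sup>2" unfolding H by (simp add: power_mult_distrib)
qed

lemma H2_H10_iff: "u \<in> H2_ivl \<inter> H10_ivl \<longleftrightarrow> (\<exists>g h. h10 u g \<and> wd g h)"
proof
  assume u: "u \<in> H2_ivl \<inter> H10_ivl"
  then obtain g where g: "wd u g" by (auto simp: H2_ivl_def H1_ivl_iff)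
  have "h10 u (weak_deriv u)" using weak_deriv_eq(1)[OF g] u by (simp add: h10_iff)
  moreover obtain h where "wd (weak_deriv u) h" using u by (auto simp: H2_ivl_def H1_ivl_iff)
  ultimately show "\<exists>g h. h10 u g \<and> wd g h" by blast
next
  assume "\<exists>g h. h10 u g \<and> wd g h"
  then obtain g h where u: "h10 u g" and g: "wd g h" by blast
  then have wu: "wd u g" by (simp add: h10_def)
  have "wd (weak_deriv u) h"
    by (rule wd_cong_AE[OF g]) (use weak_deriv_eq[OF wu] in \<open>auto intro: wdD elim: eventually_mono\<close>)
  then show "u \<in> H2_ivl \<inter> H10_ivl" using u wu by (auto simp: h10_iff H2_ivl_def H1_ivl_iff)
qed

section \<open>The Dirichlet eigenfunctions of the second derivative\<close>

lemma deriv_flat: "deriv flat y = (if 0 < y then exp (- 1 / y) / y\<^sup>2 else 0)"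
proof (cases "0 < y")
  case True
  have d: "((\<lambda>y. exp (- 1 / y)) has_real_derivative exp (- 1 / y) * (1 / y\<^sup>2)) (at y)"
    by (rule DERIV_chain2[OF DERIV_exp])
      (use True in \<open>auto intro!: derivative_eq_intros simp: power2_eq_square\<close>)
  have "\<forall>\<^sub>F z in nhds y. exp (- 1 / z) = flat z"
    using eventually_nhds_in_open[of "{0<..}" y] True by (auto elim!: eventually_mono simp: flat_def)
  from iffD1[OF DERIV_cong_ev[OF refl this refl] d] show ?thesis
    using True by (simp add: DERIV_imp_deriv)
next
  case False
  have "deriv flat y = 0"
  proof (rule ccontr)
    assume ne: "deriv flat y \<noteq> 0"
    have d: "(flat has_real_derivative deriv flat y) (at y)" by (rule smooth_has_deriv[OF smooth_flat])
    have "deriv flat y = 0"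
    \<comment> \<open>For \<open>y \<le> 0\<close> the value 0 is the minimum of
      \<open>flat\<close>.\<close>
    proof (rule DERIV_local_min[OF d])
      show "\<forall>z. \<bar>y - z\<bar> < 1 \<longrightarrow> flat y \<le> flat z"
        using False flat_bounds(1) by (simp add: flat_def)
    qed simp
    with ne show False by simp
  qed
  then show ?thesis using False by simp
qed

text \<open>To be used with y = n x - 1, so that y + 1 = n x: the slope of a cut-off at scale 1/n,
  weighted by the distance to the end point, stays bounded in \<open>n\<close> and tends to 0 for
  fixed x. The uniform bound compares (y + 1) / y^2 with the quadratic Taylor polynomial of
  exp(1/y).\<close>

lemma flat_growth_bounds:
  fixes y :: real
  shows "0 \<le> deriv flat y" and "(y + 1) * deriv flat y \<le> 2" and "1 \<le> y \<Longrightarrow> (y + 1) * deriv flat y \<le> 2 / y"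
proof -
  show "0 \<le> deriv flat y" by (simp add: deriv_flat)
  have "(y + 1) / y\<^sup>2 * exp (- 1 / y) \<le> 2" if y: "0 < y"
  proof -
    have "1 + 1 / y + (1 / y)\<^sup>2 / 2 \<le> exp (1 / y)" using y by (intro exp_lower_Taylor_quadratic) simp
    moreover have "(y + 1) / y\<^sup>2 = 1 / y + (1 / y)\<^sup>2" using y by (simp add: field_simps power2_eq_square)
    moreover have "0 < 1 / y" using y by simp
    ultimately have "(y + 1) / y\<^sup>2 \<le> 2 * exp (1 / y)" by linarith
    then have "(y + 1) / y\<^sup>2 * exp (- 1 / y) \<le> 2 * exp (1 / y) * exp (- 1 / y)"
      by (intro mult_right_mono) auto
    then show ?thesis by (simp add: mult.assoc flip: exp_add)
  qed
  then show "(y + 1) * deriv flat y \<le> 2" by (simp add: deriv_flat)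
  show "(y + 1) * deriv flat y \<le> 2 / y" if y: "1 \<le> y"
  proof -
    have "(y + 1) / y\<^sup>2 * exp (- 1 / y) \<le> (y + 1) / y\<^sup>2 * 1" using y by (intro mult_left_mono) auto
    also have "\<dots> \<le> 2 / y" using y by (simp add: field_simps power2_eq_square)
    finally show ?thesis using y by (simp add: deriv_flat)
  qed
qed

lemma L2_tendsto_0:
  assumes g: "\<And>n. f n \<in> borel_measurable unit_ivl"
    and b: "\<And>n x. x \<in> {0<..<1} \<Longrightarrow> \<bar>f n x\<bar> \<le> B"
    and lim: "\<And>x. x \<in> {0<..<1} \<Longrightarrow> (\<lambda>n. f n x) \<longlonglongrightarrow> 0"
  shows "(\<lambda>n. nrI (f n)) \<longlonglongrightarrow> 0"
proof -
  have "(\<lambda>n. \<integral>x. f n x * f n x \<partial>unit_ivl) \<longlonglongrightarrow> (\<integral>x. 0 \<partial>unit_ivl)"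
  proof (rule integral_dominated_convergence[where w = "\<lambda>_. B\<^sup>2"])
    show "AE x in unit_ivl. (\<lambda>n. f n x * f n x) \<longlonglongrightarrow> 0"
      using tendsto_mult[OF lim lim] by (intro AE_I2) (simp add: space_unit_ivl)
    show "AE x in unit_ivl. norm (f n x * f n x) \<le> B\<^sup>2" for n
    proof (rule AE_I2)
      fix x assume "x \<in> space unit_ivl"
      then have "\<bar>f n x\<bar> * \<bar>f n x\<bar> \<le> B * B" using b[of x n] by (intro mult_mono) (auto simp: space_unit_ivl)
      then show "norm (f n x * f n x) \<le> B\<^sup>2" by (simp add: abs_mult power2_eq_square)
    qed
  qed (use g in auto)
  then have "(\<lambda>n. sqrt (inI (f n) (f n))) \<longlonglongrightarrow> sqrt 0"
    unfolding L2_inner_def by (intro tendsto_real_sqrt) simp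
  then show ?thesis by (simp add: L2_nrm_def)
qed

text \<open>The index is shifted by one: \<open>k = 0\<close> is sin(pi x), so that no member is
  zero and all eigenvalues are positive.\<close>

definition dir_sin :: "nat \<Rightarrow> real \<Rightarrow> real" where
  "dir_sin k x = sin (real (Suc k) * pi * x)"

lemma smooth_dir_sin: "smooth (dir_sin k)"
  unfolding dir_sin_def[abs_def] by (rule smooth_sin)

lemma deriv_dir_sin: "deriv (dir_sin k) = (\<lambda>x. (real (Suc k) * pi) * cos (real (Suc k) * pi * x))"
  unfolding dir_sin_def[abs_def]
  by (intro ext DERIV_imp_deriv) (auto intro!: derivative_eq_intros)

lemma deriv2_dir_sin: "deriv (deriv (dir_sin k)) = (\<lambda>x. - ((real (Suc k) * pi)\<^sup>2) * dir_sin k x)"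
  unfolding deriv_dir_sin unfolding dir_sin_def
  by (intro ext DERIV_imp_deriv) (auto intro!: derivative_eq_intros simp: power2_eq_square)

text \<open>Linear decay at both end points compensates for the slope of order \<open>n\<close> of
  the cut-off functions.\<close>

lemma abs_dir_sin_le:
  assumes "0 \<le> x" "x \<le> 1"
  shows "\<bar>dir_sin k x\<bar> \<le> (real (Suc k) * pi) * x" "\<bar>dir_sin k x\<bar> \<le> (real (Suc k) * pi) * (1 - x)"
proof -
  have *: "\<bar>sin t\<bar> \<le> \<bar>t\<bar>" for t :: real by (rule abs_sin_x_le_abs_x)
  show "\<bar>dir_sin k x\<bar> \<le> (real (Suc k) * pi) * x"
    using *[of "real (Suc k) * pi * x"] assms unfolding dir_sin_def by (simp add: abs_mult)
  have "sin (real (Suc k) * pi * (1 - x)) = sin (real (Suc k) * pi - real (Suc k) * pi * x)"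
    by (simp add: algebra_simps)
  also have "\<dots> = - (cos (real (Suc k) * pi) * sin (real (Suc k) * pi * x))"
    by (subst sin_diff) (simp del: of_nat_Suc)
  finally have "\<bar>dir_sin k x\<bar> = \<bar>sin (real (Suc k) * pi * (1 - x))\<bar>"
    unfolding dir_sin_def by (simp only: abs_minus_cancel abs_mult cos_npi) (simp add: power_abs)
  then show "\<bar>dir_sin k x\<bar> \<le> (real (Suc k) * pi) * (1 - x)"
    using *[of "real (Suc k) * pi * (1 - x)"] assms by (simp add: abs_mult)
qed

text \<open>Unlike \<open>bump\<close>, its support fills the interval as \<open>n\<close> grows: it
  lies between 1/n and 1 - 1/n. For \<open>n = 0\<close> the function is zero.\<close>

definition cutoff :: "nat \<Rightarrow> real \<Rightarrow> real" where
  "cutoff n x = flat (real n * x - 1) * flat (real n * (1 - x) - 1)"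

lemma cutoff_bounds: "0 \<le> cutoff n x" "cutoff n x \<le> 1"
  unfolding cutoff_def using flat_bounds by (auto intro: mult_le_one)

lemma smooth_cutoff: "smooth (cutoff n)"
proof -
  have "smooth (\<lambda>x. flat (real n * x + (- 1)) * flat ((- real n) * x + (real n - 1)))"
    by (intro smooth_mult smooth_affine smooth_flat)
  then show ?thesis unfolding cutoff_def[abs_def] by (simp add: algebra_simps)
qed

lemma cutoff_test: "cutoff n \<in> test_fun1"
  unfolding test_fun1_iff
proof (intro conjI smooth_cutoff exI[of _ "if n = 0 then {} else {1 / real n..1 - 1 / real n}"] allI impI)
  fix x assume x: "x \<notin> (if n = 0 then {} else {1 / real n..1 - 1 / real n})"
  show "cutoff n x = 0"
  proof (cases "n = 0")
    case False
    then have "x < 1 / real n \<or> 1 - 1 / real n < x" using x by auto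
    then show ?thesis using False by (auto simp: cutoff_def flat_def field_simps)
  qed (simp add: cutoff_def flat_def)
next
  have "{z..1 - z} \<subseteq> {0<..<1}" if "0 < z" for z :: real using that by auto
  from this[of "1 / real n"] show "(if n = 0 then {} else {1 / real n..1 - 1 / real n}) \<subseteq> {0<..<1}" by simp
qed simp

lemma deriv_cutoff:
  "deriv (cutoff n) x = real n * deriv flat (real n * x - 1) * flat (real n * (1 - x) - 1)
     - flat (real n * x - 1) * (real n * deriv flat (real n * (1 - x) - 1))"
proof (rule DERIV_imp_deriv)
  have 1: "((\<lambda>x. flat (real n * x - 1)) has_real_derivative deriv flat (real n * x - 1) * real n) (at x)"
    by (rule DERIV_chain2[OF smooth_has_deriv[OF smooth_flat]]) (auto intro!: derivative_eq_intros)
  have 2: "((\<lambda>x. flat (real n * (1 - x) - 1)) has_real_derivative deriv flat (real n * (1 - x) - 1) * (- real n)) (at x)"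
    by (rule DERIV_chain2[OF smooth_has_deriv[OF smooth_flat]]) (auto intro!: derivative_eq_intros)
  from DERIV_mult[OF 1 2]
  show "(cutoff n has_real_derivative real n * deriv flat (real n * x - 1) * flat (real n * (1 - x) - 1)
     - flat (real n * x - 1) * (real n * deriv flat (real n * (1 - x) - 1))) (at x)"
    unfolding cutoff_def[abs_def] by (simp add: algebra_simps)
qed

lemma flat_shift_tendsto:
  assumes "0 < x"
  shows "(\<lambda>n. flat (real n * x - 1)) \<longlonglongrightarrow> 1"
    and "(\<lambda>n. real n * x * deriv flat (real n * x - 1)) \<longlonglongrightarrow> 0"
proof -
  have top: "filterlim (\<lambda>n. real n * x - 1) at_top sequentially"
  proof -
    have "filterlim (\<lambda>n. -1 + x * real n) at_top sequentially"
      by (intro filterlim_tendsto_add_at_top[OF tendsto_const] filterlim_tendsto_pos_mult_at_top[OF tendsto_const assms]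
          filterlim_real_sequentially)
    then show ?thesis by (simp add: mult.commute)
  qed
  have "((\<lambda>y. exp (- 1 / y)) \<longlongrightarrow> exp 0) (at_top :: real filter)"
    by (intro tendsto_exp tendsto_divide_0[OF tendsto_const] filterlim_at_top_imp_at_infinity filterlim_ident)
  moreover have "\<forall>\<^sub>F y in at_top. exp (- 1 / y) = flat y"
    using eventually_gt_at_top[of 0] by (rule eventually_mono) (simp add: flat_def)
  ultimately have "(flat \<longlongrightarrow> 1) at_top" using Lim_transform_eventually by fastforce
  from filterlim_compose[OF this top] show "(\<lambda>n. flat (real n * x - 1)) \<longlonglongrightarrow> 1" .
  have "((\<lambda>y. (y + 1) * deriv flat y) \<longlongrightarrow> 0) at_top"
  proof (rule tendsto_sandwich[OF _ _ tendsto_const])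
    show "\<forall>\<^sub>F y in at_top. 0 \<le> (y + 1) * deriv flat y"
      using eventually_gt_at_top[of 0] by (rule eventually_mono) (auto simp: flat_growth_bounds(1))
    show "\<forall>\<^sub>F y in at_top. (y + 1) * deriv flat y \<le> 2 / y"
      using eventually_ge_at_top[of 1] by (rule eventually_mono) (rule flat_growth_bounds(3))
    show "((\<lambda>y. 2 / y) \<longlongrightarrow> 0) (at_top :: real filter)"
      by (intro tendsto_divide_0[OF tendsto_const] filterlim_at_top_imp_at_infinity filterlim_ident)
  qed
  from filterlim_compose[OF this top] show "(\<lambda>n. real n * x * deriv flat (real n * x - 1)) \<longlonglongrightarrow> 0" by simp
qed

lemma cutoff_tendsto: "x \<in> {0<..<1} \<Longrightarrow> (\<lambda>n. cutoff n x) \<longlonglongrightarrow> 1"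
  unfolding cutoff_def using tendsto_mult[OF flat_shift_tendsto(1)[of x] flat_shift_tendsto(1)[of "1 - x"]] by simp

lemma dir_sin_cutoff:
  fixes k n :: nat
  assumes x: "x \<in> {0<..<1}"
  defines "K \<equiv> real (Suc k) * pi"
  shows "\<bar>dir_sin k x * deriv (cutoff n) x\<bar>
    \<le> K * (real n * x * deriv flat (real n * x - 1)) + K * (real n * (1 - x) * deriv flat (real n * (1 - x) - 1))"
proof -
  have d0: "0 \<le> deriv flat y" "0 \<le> flat y" "flat y \<le> 1" for y
    using flat_growth_bounds(1) flat_bounds by auto
  have b: "\<bar>dir_sin k x\<bar> \<le> K * x" "\<bar>dir_sin k x\<bar> \<le> K * (1 - x)"
    using abs_dir_sin_le[of x k] x unfolding K_def by auto
  let ?p = "real n * deriv flat (real n * x - 1)" and ?q = "real n * deriv flat (real n * (1 - x) - 1)"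
  have pq: "0 \<le> ?p" "0 \<le> ?q" using d0 by auto
  have "\<bar>deriv (cutoff n) x\<bar> \<le> ?p * flat (real n * (1 - x) - 1) + flat (real n * x - 1) * ?q"
    unfolding deriv_cutoff using pq d0 by (intro order_trans[OF abs_triangle_ineq4]) (simp add: abs_mult)
  also have "\<dots> \<le> ?p * 1 + 1 * ?q" using pq d0 by (intro add_mono mult_left_mono mult_right_mono) auto
  finally have "\<bar>dir_sin k x\<bar> * \<bar>deriv (cutoff n) x\<bar> \<le> \<bar>dir_sin k x\<bar> * (?p + ?q)"
    by (intro mult_left_mono) auto
  also have "\<dots> \<le> (K * x) * ?p + (K * (1 - x)) * ?q"
    unfolding distrib_left using pq b by (intro add_mono mult_right_mono) auto
  finally show ?thesis by (simp add: abs_mult mult_ac)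
qed

text \<open>The approximants are the sine times \<open>cutoff n\<close>. The error in the derivative
  is s' (1 - \<chi>) - s \<chi>', which is bounded uniformly in \<open>n\<close> and tends to 0
  pointwise by \<open>dir_sin_cutoff\<close>, so \<open>L2_tendsto_0\<close> applies.\<close>

lemma h10_dir_sin: "h10 (dir_sin k) (deriv (dir_sin k))"
  unfolding h10_def
proof (intro conjI allI impI)
  show "wd (dir_sin k) (deriv (dir_sin k))" by (rule wd_smooth[OF smooth_dir_sin])
  define K where "K = real (Suc k) * pi"
  have K: "0 \<le> K" by (simp add: K_def)
  let ?\<phi> = "\<lambda>n x. dir_sin k x * cutoff n x"
  have d\<phi>: "deriv (?\<phi> n) = (\<lambda>x. deriv (dir_sin k) x * cutoff n x + dir_sin k x * deriv (cutoff n) x)" for n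
    by (rule deriv_mult_smooth[OF smooth_dir_sin smooth_cutoff])
  have \<phi>s: "smooth (?\<phi> n)" for n by (rule smooth_mult[OF smooth_dir_sin smooth_cutoff])
  have m: "f \<in> borel_measurable unit_ivl" if "smooth f" for f
    using sq_integrable_smooth[OF that] by (rule sq_integrableD)
  have l1: "(\<lambda>n. nrI (\<lambda>x. dir_sin k x - ?\<phi> n x)) \<longlonglongrightarrow> 0"
  proof (rule L2_tendsto_0[where B = 1])
    fix n and x :: real assume "x \<in> {0<..<1}"
    have "\<bar>dir_sin k x\<bar> * \<bar>1 - cutoff n x\<bar> \<le> 1 * 1"
      using cutoff_bounds[of n x] by (intro mult_mono) (auto simp: dir_sin_def)
    then show "\<bar>dir_sin k x - ?\<phi> n x\<bar> \<le> 1" by (simp add: abs_mult[symmetric] algebra_simps)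
  next
    fix x :: real assume "x \<in> {0<..<1}"
    then have "(\<lambda>n. dir_sin k x - ?\<phi> n x) \<longlonglongrightarrow> dir_sin k x - dir_sin k x * 1"
      by (intro tendsto_intros cutoff_tendsto)
    then show "(\<lambda>n. dir_sin k x - ?\<phi> n x) \<longlonglongrightarrow> 0" by simp
  qed (intro borel_measurable_diff m smooth_dir_sin \<phi>s)
  have l2: "(\<lambda>n. nrI (\<lambda>x. deriv (dir_sin k) x - deriv (?\<phi> n) x)) \<longlonglongrightarrow> 0"
  \<comment> \<open>\<open>K\<close> bounds the derivative of the sine, and each end point adds
    \<open>K * 2\<close> by the uniform bound of \<open>flat_growth_bounds\<close>.\<close>
  proof (rule L2_tendsto_0[where B = "K + (K * 2 + K * 2)"])
    fix n and x :: real assume x: "x \<in> {0<..<1}"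
    have g: "real n * y * deriv flat (real n * y - 1) \<le> 2" for y
      using flat_growth_bounds(2)[of "real n * y - 1"] by simp
    have "\<bar>deriv (dir_sin k) x\<bar> \<le> K"
      unfolding deriv_dir_sin K_def[symmetric] using K by (simp add: abs_mult mult_left_le)
    then have "\<bar>deriv (dir_sin k) x\<bar> * \<bar>1 - cutoff n x\<bar> \<le> K * 1"
      using cutoff_bounds[of n x] K by (intro mult_mono) auto
    moreover have "\<bar>dir_sin k x * deriv (cutoff n) x\<bar> \<le> K * 2 + K * 2"
      using dir_sin_cutoff[OF x, of k n] mult_left_mono[OF g[of x] K] mult_left_mono[OF g[of "1 - x"] K]
      unfolding K_def[symmetric] by linarith
    moreover have "deriv (dir_sin k) x - deriv (?\<phi> n) x
        = deriv (dir_sin k) x * (1 - cutoff n x) - dir_sin k x * deriv (cutoff n) x"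
      unfolding d\<phi> by (simp add: algebra_simps)
    ultimately show "\<bar>deriv (dir_sin k) x - deriv (?\<phi> n) x\<bar> \<le> K + (K * 2 + K * 2)"
      using abs_triangle_ineq4[of "deriv (dir_sin k) x * (1 - cutoff n x)" "dir_sin k x * deriv (cutoff n) x"]
      by (simp add: abs_mult)
  next
    fix x :: real assume x: "x \<in> {0<..<1}"
    have "(\<lambda>n. K * (real n * x * deriv flat (real n * x - 1)) + K * (real n * (1 - x) * deriv flat (real n * (1 - x) - 1)))
        \<longlonglongrightarrow> K * 0 + K * 0"
      using x by (intro tendsto_intros flat_shift_tendsto) auto
    then have lim: "(\<lambda>n. K * (real n * x * deriv flat (real n * x - 1)) + K * (real n * (1 - x) * deriv flat (real n * (1 - x) - 1)))
        \<longlonglongrightarrow> 0" by simp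
    have "(\<lambda>n. dir_sin k x * deriv (cutoff n) x) \<longlonglongrightarrow> 0"
      by (rule Lim_null_comparison[OF always_eventually lim])
        (unfold K_def real_norm_def, intro allI dir_sin_cutoff x)
    then have "(\<lambda>n. deriv (dir_sin k) x - (deriv (dir_sin k) x * cutoff n x + dir_sin k x * deriv (cutoff n) x))
        \<longlonglongrightarrow> deriv (dir_sin k) x - (deriv (dir_sin k) x * 1 + 0)"
      by (intro tendsto_intros cutoff_tendsto x)
    then show "(\<lambda>n. deriv (dir_sin k) x - deriv (?\<phi> n) x) \<longlonglongrightarrow> 0" by (simp add: d\<phi>)
  qed (intro borel_measurable_diff m smooth_deriv smooth_dir_sin \<phi>s)
  fix \<epsilon> :: real assume "\<epsilon> > 0"
  then have "\<forall>\<^sub>F n in sequentially. nrI (\<lambda>x. dir_sin k x - ?\<phi> n x) < \<epsilon> \<and> nrI (\<lambda>x. deriv (dir_sin k) x - deriv (?\<phi> n) x) < \<epsilon>"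
    by (intro eventually_conj order_tendstoD(2)[OF l1] order_tendstoD(2)[OF l2])
  then obtain n where "nrI (\<lambda>x. dir_sin k x - ?\<phi> n x) < \<epsilon> \<and> nrI (\<lambda>x. deriv (dir_sin k) x - deriv (?\<phi> n) x) < \<epsilon>"
    using eventually_happens'[OF sequentially_bot] by blast
  then show "\<exists>\<phi>\<in>test_fun1. nrI (\<lambda>x. dir_sin k x - \<phi> x) < \<epsilon> \<and> nrI (\<lambda>x. deriv (dir_sin k) x - deriv \<phi> x) < \<epsilon>"
    by (intro bexI[of _ "?\<phi> n"] test_fun1_mult_smooth[OF smooth_dir_sin cutoff_test])
qed

lemma dir_sin_H2_H10: "dir_sin k \<in> H2_ivl \<inter> H10_ivl"
  unfolding H2_H10_iff using h10_dir_sin wd_smooth[OF smooth_deriv[OF smooth_dir_sin]] by blast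

section \<open>Density of the sine polynomials\<close>

inductive_set sine_poly :: "(real \<Rightarrow> real) set" where
  zero: "(\<lambda>_. 0) \<in> sine_poly"
| step: "T \<in> sine_poly \<Longrightarrow> (\<lambda>x. T x + c * dir_sin k x) \<in> sine_poly"

lemma sine_poly_add:
  assumes "T \<in> sine_poly" "T' \<in> sine_poly" shows "(\<lambda>x. T x + T' x) \<in> sine_poly"
  using assms(2)
proof induction
  case (step T' c k)
  from sine_poly.step[OF step.IH, of c k] show ?case by (simp add: add.assoc)
qed (use assms(1) in simp)

lemma sine_poly_cmult: "T \<in> sine_poly \<Longrightarrow> (\<lambda>x. b * T x) \<in> sine_poly"
proof (induction rule: sine_poly.induct)
  case (step T c k)
  from sine_poly.step[OF step.IH, of "b * c" k] show ?case by (simp add: distrib_left mult.assoc)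
qed (simp add: sine_poly.zero)

lemma dir_sin_sine_poly: "(\<lambda>x. c * dir_sin k x) \<in> sine_poly"
  using sine_poly.step[OF sine_poly.zero, of c k] by simp

text \<open>Product-to-sum formula: frequency k + 1 splits into k + 2 and k.\<close>

lemma sine_poly_cos: "T \<in> sine_poly \<Longrightarrow> (\<lambda>x. cos (pi * x) * T x) \<in> sine_poly"
proof (induction rule: sine_poly.induct)
  case (step T c k)
  have "(\<lambda>x. cos (pi * x) * (c * dir_sin k x)) \<in> sine_poly"
  proof -
    have "cos (pi * x) * (c * dir_sin k x)
        = (c / 2) * dir_sin (Suc k) x + (c / 2) * sin (real k * pi * x)" for x
    proof -
      have "sin (real (Suc k) * pi * x) * cos (pi * x)
          = (sin (real (Suc k) * pi * x + pi * x) + sin (real (Suc k) * pi * x - pi * x)) / 2"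
        by (rule sin_times_cos)
      also have "real (Suc k) * pi * x + pi * x = real (Suc (Suc k)) * pi * x" by (simp add: algebra_simps)
      also have "real (Suc k) * pi * x - pi * x = real k * pi * x" by (simp add: algebra_simps)
      finally have eq: "sin (real (Suc k) * pi * x) * cos (pi * x)
          = (sin (real (Suc (Suc k)) * pi * x) + sin (real k * pi * x)) / 2" .
      have "cos (pi * x) * (c * dir_sin k x) = c * (sin (real (Suc k) * pi * x) * cos (pi * x))"
        by (simp only: dir_sin_def mult_ac)
      then show ?thesis unfolding eq dir_sin_def by (simp add: distrib_left add_divide_distrib del: of_nat_Suc)
    qed
    moreover have "(\<lambda>x. (c / 2) * sin (real k * pi * x)) \<in> sine_poly"
    proof (cases k)
      case (Suc m)
      then show ?thesis using dir_sin_sine_poly[of "c / 2" m] by (simp add: dir_sin_def[abs_def])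
    qed (simp add: sine_poly.zero)
    ultimately show ?thesis using sine_poly_add[OF dir_sin_sine_poly[of "c / 2" "Suc k"]] by simp
  qed
  from sine_poly_add[OF step.IH this] show ?case by (simp add: distrib_left)
qed (simp add: sine_poly.zero)

lemma sine_poly_polynomial:
  assumes "real_polynomial_function p" "T \<in> sine_poly"
  shows "(\<lambda>x. p (cos (pi * x)) * T x) \<in> sine_poly"
  using assms
proof (induction p arbitrary: T rule: real_polynomial_function.induct)
  case (linear f)
  have f: "f y = f 1 * y" for y :: real
    using linear_scale[OF bounded_linear.linear[OF linear(1)], of y 1] by simp
  have "(\<lambda>x. f (cos (pi * x)) * T x) = (\<lambda>x. f 1 * (cos (pi * x) * T x))"
    by (rule ext, subst f, rule mult.assoc)
  then show ?case using sine_poly_cmult[OF sine_poly_cos[OF linear(2)], of "f 1"] by simp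
next
  case (const c)
  then show ?case by (rule sine_poly_cmult)
next
  case (add f g)
  from sine_poly_add[OF add.IH(1)[OF add.prems] add.IH(2)[OF add.prems]] show ?case by (simp add: distrib_right)
next
  case (mult f g)
  from mult.IH(1)[OF mult.IH(2)[OF mult.prems]] show ?case by (simp add: mult.assoc)
qed

lemma sine_poly_sq_integrable: "T \<in> sine_poly \<Longrightarrow> T \<in> L2I"
  by (induction rule: sine_poly.induct)
    (intro sq_integrable_zero sq_integrable_add sq_integrable_cmult sq_integrable_smooth[OF smooth_dir_sin] | assumption)+

text \<open>After removing a small set of \<open>x\<close> near the end points and a small set of large values, \<open>g / sin (pi x)\<close>
  is bounded; it is approximated by a continuous function, and this by a polynomial in \<open>cos (pi x)\<close>.\<close>
lemma sine_poly_dense: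
  assumes g: "g \<in> L2I" and \<epsilon>: "\<epsilon> > 0"
  shows "\<exists>T\<in>sine_poly. nrI (\<lambda>x. g x - T x) < \<epsilon>"
proof -
  have gm [measurable]: "g \<in> borel_measurable unit_ivl" using g by (rule sq_integrableD)
  have [measurable]: "(\<lambda>x. x) \<in> borel_measurable unit_ivl" "(\<lambda>x. sin (pi * x)) \<in> borel_measurable unit_ivl"
    by (auto intro!: measurable_unit_ivl)
  \<comment> \<open>On \<open>A n\<close> the quotient of \<open>g\<close> by the sine is at most n
    (n + 1) in modulus, and every point of the interval lies in \<open>A n\<close> for large
    \<open>n\<close>.\<close>
  define A where "A n = {x \<in> space unit_ivl. \<bar>g x\<bar> \<le> real n \<and> inverse (real (Suc n)) \<le> sin (pi * x)}" for n
  have Am [measurable]: "A n \<in> sets unit_ivl" for n unfolding A_def by measurable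
  have sp: "0 < sin (pi * x)" if "x \<in> {0<..<1}" for x
    using that by (intro sin_gt_zero) auto
  have gA: "(\<lambda>x. g x * indicator (A n) x) \<in> L2I" for n
    unfolding sq_integrable_def
  proof (intro CollectI conjI)
    show "integrable unit_ivl (\<lambda>x. (g x * indicator (A n) x)\<^sup>2)"
      by (rule Bochner_Integration.integrable_bound[OF sq_integrableD(2)[OF g]])
        (measurable, auto simp: indicator_def)
  qed measurable
  have "(\<lambda>n. inI (\<lambda>x. g x - g x * indicator (A n) x) (\<lambda>x. g x - g x * indicator (A n) x)) \<longlonglongrightarrow> (\<integral>x. 0 \<partial>unit_ivl)"
    unfolding L2_inner_def
  proof (rule integral_dominated_convergence[OF _ _ sq_integrableD(2)[OF g]])
    show "AE x in unit_ivl. (\<lambda>n. (g x - g x * indicator (A n) x) * (g x - g x * indicator (A n) x)) \<longlonglongrightarrow> 0"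
    proof (rule AE_I2)
      fix x assume x: "x \<in> space unit_ivl"
      obtain N1 where N1: "\<bar>g x\<bar> \<le> real N1" using real_arch_simple by blast
      have "\<forall>\<^sub>F n in sequentially. inverse (real (Suc n)) < sin (pi * x)"
        using order_tendstoD(2)[OF LIMSEQ_inverse_real_of_nat] sp x by (simp add: space_unit_ivl)
      moreover have "\<forall>\<^sub>F n in sequentially. N1 \<le> n" by (rule eventually_ge_at_top)
      ultimately have "\<forall>\<^sub>F n in sequentially. 0 = (g x - g x * indicator (A n) x) * (g x - g x * indicator (A n) x)"
      proof eventually_elim
        case (elim n)
        then have "real N1 \<le> real n" by simp
        then have "x \<in> A n" using x elim N1 unfolding A_def by (simp del: of_nat_Suc)
        then show ?case by simp
      qed
      then show "(\<lambda>n. (g x - g x * indicator (A n) x) * (g x - g x * indicator (A n) x)) \<longlonglongrightarrow> 0"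
        by (rule Lim_transform_eventually[OF tendsto_const])
    qed
    show "AE x in unit_ivl. norm ((g x - g x * indicator (A n) x) * (g x - g x * indicator (A n) x)) \<le> (g x)\<^sup>2" for n
      by (rule AE_I2) (simp add: indicator_def power2_eq_square)
  qed (auto, measurable)
  then have "(\<lambda>n. sqrt (inI (\<lambda>x. g x - g x * indicator (A n) x) (\<lambda>x. g x - g x * indicator (A n) x))) \<longlonglongrightarrow> sqrt 0"
    by (intro tendsto_real_sqrt) simp
  then have "(\<lambda>n. nrI (\<lambda>x. g x - g x * indicator (A n) x)) \<longlonglongrightarrow> 0" by (simp add: L2_nrm_def)
  then have "\<forall>\<^sub>F n in sequentially. nrI (\<lambda>x. g x - g x * indicator (A n) x) < \<epsilon> / 3"
    using \<epsilon> by (intro order_tendstoD(2)) auto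
  then obtain n where n: "nrI (\<lambda>x. g x - g x * indicator (A n) x) < \<epsilon> / 3"
    using eventually_happens'[OF sequentially_bot] by blast
  define f where "f x = (if x \<in> {0<..<1} then g x * indicator (A n) x / sin (pi * x) else 0)" for x
  define B where "B = real n * real (Suc n)"
  have fB: "\<bar>f x\<bar> \<le> B" for x
  proof (cases "x \<in> A n")
    case True
    then have x: "x \<in> {0<..<1}" "\<bar>g x\<bar> \<le> real n" "inverse (real (Suc n)) \<le> sin (pi * x)"
      by (auto simp: A_def space_unit_ivl)
    then have "\<bar>g x\<bar> * inverse (sin (pi * x)) \<le> real n * real (Suc n)"
      using le_imp_inverse_le[OF x(3)] sp[OF x(1)] by (intro mult_mono) auto
    then show ?thesis using x(1) True sp[OF x(1)] by (simp add: f_def B_def divide_inverse abs_mult)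
  qed (simp add: f_def B_def)
  have fm: "f \<in> borel_measurable borel"
  proof -
    have "(\<lambda>x. g x * indicator (A n) x / sin (pi * x)) \<in> borel_measurable unit_ivl" by measurable
    then have "(\<lambda>x. indicator {0<..<1} x *\<^sub>R (g x * indicator (A n) x / sin (pi * x))) \<in> borel_measurable lborel"
      unfolding unit_ivl_def by (subst (asm) borel_measurable_restrict_space_iff) auto
    also have "(\<lambda>x. indicator {0<..<1} x *\<^sub>R (g x * indicator (A n) x / sin (pi * x))) = f"
      by (auto simp: f_def indicator_def)
    finally show ?thesis by simp
  qed
  have "f measurable_on UNIV"
    by (rule lebesgue_measurable_imp_measurable_on_real) (use fm in \<open>auto intro: measurable_completion\<close>)
  then obtain Z h where Z: "negligible Z" and hc: "\<And>m. continuous_on UNIV (h m)"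
    and hl: "\<And>x. x \<notin> Z \<Longrightarrow> (\<lambda>m. h m x) \<longlonglongrightarrow> f x"
    unfolding measurable_on_def by auto
  \<comment> \<open>Truncating at the bound of \<open>f\<close> preserves continuity and the limit,
    and supplies the majorant for dominated convergence.\<close>
  define k where "k m x = max (- B) (min B (h m x))" for m x
  have kc: "continuous_on UNIV (k m)" for m
    unfolding k_def by (intro continuous_intros hc)
  have "AE x in lebesgue. x \<notin> Z" using Z by (simp add: AE_not_in negligible_iff_null_sets)
  then have Zn: "AE x in unit_ivl. x \<notin> Z"
    unfolding unit_ivl_def by (auto simp: AE_restrict_space_iff AE_completion_iff elim: eventually_mono)
  have B0: "0 \<le> B" by (simp add: B_def)
  have fI: "f \<in> borel_measurable unit_ivl" by (rule measurable_unit_ivl[OF fm])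
  have kI: "k m \<in> borel_measurable unit_ivl" for m
    by (intro measurable_unit_ivl borel_measurable_continuous_onI kc)
  have "(\<lambda>m. inI (\<lambda>x. f x - k m x) (\<lambda>x. f x - k m x)) \<longlonglongrightarrow> (\<integral>x. 0 \<partial>unit_ivl)"
    unfolding L2_inner_def
  proof (rule integral_dominated_convergence[where w = "\<lambda>_. (2 * B) * (2 * B)"])
    show "AE x in unit_ivl. (\<lambda>m. (f x - k m x) * (f x - k m x)) \<longlonglongrightarrow> 0"
      using Zn
    proof eventually_elim
      case (elim x)
      have "(\<lambda>m. k m x) \<longlonglongrightarrow> max (- B) (min B (f x))"
        unfolding k_def by (intro tendsto_intros hl elim)
      moreover have "max (- B) (min B (f x)) = f x" using fB[of x] by auto
      ultimately have "(\<lambda>m. (f x - k m x) * (f x - k m x)) \<longlonglongrightarrow> (f x - f x) * (f x - f x)"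
        by (intro tendsto_intros) simp_all
      then show ?case by simp
    qed
    show "AE x in unit_ivl. norm ((f x - k m x) * (f x - k m x)) \<le> (2 * B) * (2 * B)" for m
    proof (rule AE_I2)
      fix x
      have "\<bar>k m x\<bar> \<le> B" using B0 unfolding k_def by auto
      then have "\<bar>f x - k m x\<bar> \<le> 2 * B" using fB[of x] by linarith
      then have "\<bar>f x - k m x\<bar> * \<bar>f x - k m x\<bar> \<le> (2 * B) * (2 * B)" using B0 by (intro mult_mono) auto
      then show "norm ((f x - k m x) * (f x - k m x)) \<le> (2 * B) * (2 * B)" by (simp add: abs_mult)
    qed
  qed (use fI kI in auto)
  then have "(\<lambda>m. sqrt (inI (\<lambda>x. f x - k m x) (\<lambda>x. f x - k m x))) \<longlonglongrightarrow> sqrt 0"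
    by (intro tendsto_real_sqrt) simp
  then have "(\<lambda>m. nrI (\<lambda>x. f x - k m x)) \<longlonglongrightarrow> 0" by (simp add: L2_nrm_def)
  then have "\<forall>\<^sub>F m in sequentially. nrI (\<lambda>x. f x - k m x) < \<epsilon> / 3"
    using \<epsilon> by (intro order_tendstoD(2)) auto
  then obtain m where m: "nrI (\<lambda>x. f x - k m x) < \<epsilon> / 3"
    using eventually_happens'[OF sequentially_bot] by blast
  \<comment> \<open>The substitution y = cos(pi x), with inverse arccos(y) / pi, lets Weierstrass
    approximation produce a polynomial in the cosine.\<close>
  obtain p where p: "real_polynomial_function p" "\<And>y. y \<in> {-1..1} \<Longrightarrow> \<bar>k m (arccos y / pi) - p y\<bar> < \<epsilon> / 3"
  proof (rule Stone_Weierstrass_real_polynomial_function[of "{-1..1::real}" "\<lambda>y. k m (arccos y / pi)" "\<epsilon> / 3"])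
    show "continuous_on {-1..1} (\<lambda>y. k m (arccos y / pi))"
      by (rule continuous_on_compose2[OF kc]) (auto intro!: continuous_intros continuous_on_arccos')
  qed (use \<epsilon> in auto)
  define T where "T x = p (cos (pi * x)) * sin (pi * x)" for x
  have "(\<lambda>x. p (cos (pi * x)) * (1 * dir_sin 0 x)) \<in> sine_poly"
    by (rule sine_poly_polynomial[OF p(1) dir_sin_sine_poly])
  then have T: "T \<in> sine_poly" by (simp add: T_def[abs_def] dir_sin_def)
  have nr_le: "nrI u \<le> nrI v" if "u \<in> L2I" "v \<in> L2I" "\<And>x. x \<in> {0<..<1} \<Longrightarrow> \<bar>u x\<bar> \<le> \<bar>v x\<bar>" for u v
  proof -
    have "inI u u \<le> inI v v"
      unfolding L2_inner_def using that
      by (intro integral_mono sq_integrable_mult) (auto simp: space_unit_ivl abs_le_square_iff power2_eq_square[symmetric])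
    then show ?thesis by (simp add: L2_nrm_def)
  qed
  have L: "(\<lambda>x. k m x * sin (pi * x)) \<in> L2I" "T \<in> L2I" "f \<in> L2I" "k m \<in> L2I"
    by (intro sq_integrable_continuous continuous_intros kc sine_poly_sq_integrable[OF T]
        unit_ivl.sq_integrable_bounded[OF fI fB])+
  have gf: "g x * indicator (A n) x = f x * sin (pi * x)" if "x \<in> {0<..<1}" for x
    using that sp[OF that] by (simp add: f_def)
  \<comment> \<open>Multiplying by sin(pi x) undoes the division and, as its modulus is at most 1,
    enlarges no error.\<close>
  have "nrI (\<lambda>x. g x * indicator (A n) x - k m x * sin (pi * x)) \<le> nrI (\<lambda>x. f x - k m x)"
  proof (rule nr_le)
    fix x :: real assume x: "x \<in> {0<..<1}"
    have "\<bar>f x - k m x\<bar> * \<bar>sin (pi * x)\<bar> \<le> \<bar>f x - k m x\<bar>" by (intro mult_left_le) auto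
    then show "\<bar>g x * indicator (A n) x - k m x * sin (pi * x)\<bar> \<le> \<bar>f x - k m x\<bar>"
      by (simp add: gf[OF x] left_diff_distrib[symmetric] abs_mult)
  qed (intro sq_integrable_diff gA L)+
  then have 2: "nrI (\<lambda>x. g x * indicator (A n) x - k m x * sin (pi * x)) < \<epsilon> / 3" using m by simp
  have "nrI (\<lambda>x. k m x * sin (pi * x) - T x) \<le> nrI (\<lambda>_. \<epsilon> / 3)"
  proof (rule nr_le)
    fix x :: real assume x: "x \<in> {0<..<1}"
    have "arccos (cos (pi * x)) = pi * x" using x by (intro arccos_cos) auto
    then have "\<bar>k m x - p (cos (pi * x))\<bar> < \<epsilon> / 3" using p(2)[of "cos (pi * x)"] by simp
    then have "\<bar>k m x - p (cos (pi * x))\<bar> * \<bar>sin (pi * x)\<bar> \<le> (\<epsilon> / 3) * 1" using \<epsilon> by (intro mult_mono) auto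
    then show "\<bar>k m x * sin (pi * x) - T x\<bar> \<le> \<bar>\<epsilon> / 3\<bar>"
      using \<epsilon> by (simp add: T_def left_diff_distrib[symmetric] abs_mult)
  qed (intro sq_integrable_diff L sq_integrable_continuous continuous_on_const)+
  also have "\<dots> = \<epsilon> / 3"
    using \<epsilon> prob_unit_ivl by (simp add: L2_nrm_def L2_inner_def measure_def real_sqrt_mult flip: power2_eq_square)
  finally have 3: "nrI (\<lambda>x. k m x * sin (pi * x) - T x) \<le> \<epsilon> / 3" .
  have "nrI (\<lambda>x. g x - T x) \<le> nrI (\<lambda>x. g x - g x * indicator (A n) x) + nrI (\<lambda>x. g x * indicator (A n) x - T x)"
    using L2_nrm_triangle[OF sq_integrable_diff[OF g gA[of n]] sq_integrable_diff[OF gA[of n] L(2)]] by simp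
  moreover have "nrI (\<lambda>x. g x * indicator (A n) x - T x)
      \<le> nrI (\<lambda>x. g x * indicator (A n) x - k m x * sin (pi * x)) + nrI (\<lambda>x. k m x * sin (pi * x) - T x)"
    using L2_nrm_triangle[OF sq_integrable_diff[OF gA[of n] L(1)] sq_integrable_diff[OF L(1) L(2)]] by simp
  ultimately have "nrI (\<lambda>x. g x - T x) < \<epsilon>" using n 2 3 by linarith
  with T show ?thesis by blast
qed

section \<open>Tensor products of functions on the unit cube\<close>

interpretation cube: product_sigma_finite "\<lambda>_. unit_ivl"
  by standard

lemma space_unit_cube: "space (unit_cube d) = (\<Pi>\<^sub>E i\<in>{..<d}. {0<..<1})"
  by (simp add: unit_cube_def space_PiM space_unit_ivl)

lemma finite_measure_unit_cube: "finite_measure (unit_cube d)"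
proof
  have "emeasure (unit_cube d) (space (unit_cube d)) = (\<Prod>i<d. emeasure unit_ivl (space unit_ivl))"
    unfolding unit_cube_def space_PiM by (rule cube.emeasure_PiM) auto
  then show "emeasure (unit_cube d) (space (unit_cube d)) \<noteq> \<infinity>" by (simp add: prob_unit_ivl)
qed

interpretation unit_cube: finite_measure "unit_cube d" for d
  by (rule finite_measure_unit_cube)

lemma coordinate_measurable: "i < d \<Longrightarrow> (\<lambda>x. x i) \<in> borel_measurable (unit_cube d)"
proof -
  assume i: "i < d"
  have "(\<lambda>x. x i) \<in> measurable (unit_cube d) unit_ivl"
    unfolding unit_cube_def by (rule measurable_component_singleton) (use i in simp)
  moreover have "(\<lambda>x. x) \<in> measurable unit_ivl borel" by (rule measurable_unit_ivl) simp
  ultimately show ?thesis by (rule measurable_compose)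
qed

definition tensor_fun :: "nat \<Rightarrow> (nat \<Rightarrow> real \<Rightarrow> real) \<Rightarrow> (nat \<Rightarrow> real) \<Rightarrow> real" where
  "tensor_fun d f x = (\<Prod>k<d. f k (x k))"

lemma tensor_fun_remove:
  assumes "i < d" shows "tensor_fun d f x = f i (x i) * (\<Prod>k\<in>{..<d} - {i}. f k (x k))"
  unfolding tensor_fun_def using assms by (simp add: prod.remove[of _ i])

lemma tensor_fun_upd:
  assumes "i < d" shows "tensor_fun d f (x(i := t)) = f i t * (\<Prod>k\<in>{..<d} - {i}. f k (x k))"
proof -
  have "(\<Prod>k\<in>{..<d} - {i}. f k ((x(i := t)) k)) = (\<Prod>k\<in>{..<d} - {i}. f k (x k))"
    by (rule prod.cong) auto
  then show ?thesis by (simp add: tensor_fun_remove[OF assms])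
qed

lemma tensor_fun_sq_integrable:
  assumes "\<And>k. k < d \<Longrightarrow> f k \<in> L2I" shows "tensor_fun d f \<in> sq_integrable (unit_cube d)"
  unfolding sq_integrable_def
proof (intro CollectI conjI)
  have "integrable (unit_cube d) (\<lambda>x. \<Prod>k<d. f k (x k))" unfolding unit_cube_def
    by (rule cube.product_integrable_prod) (auto intro: unit_ivl.sq_integrable_integrable assms)
  then show "tensor_fun d f \<in> borel_measurable (unit_cube d)"
    unfolding tensor_fun_def[abs_def] by (rule borel_measurable_integrable)
  have "integrable (unit_cube d) (\<lambda>x. \<Prod>k<d. (f k (x k))\<^sup>2)" unfolding unit_cube_def
    by (rule cube.product_integrable_prod) (auto intro: sq_integrableD assms)
  then show "integrable (unit_cube d) (\<lambda>x. (tensor_fun d f x)\<^sup>2)"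
    by (simp add: tensor_fun_def prod_power_distrib)
qed

lemma inner_tensor_fun:
  assumes "\<And>k. k < d \<Longrightarrow> f k \<in> L2I" "\<And>k. k < d \<Longrightarrow> g k \<in> L2I"
  shows "L2_inner (unit_cube d) (tensor_fun d f) (tensor_fun d g) = (\<Prod>k<d. inI (f k) (g k))"
proof -
  have "L2_inner (unit_cube d) (tensor_fun d f) (tensor_fun d g)
      = (\<integral>x. (\<Prod>k<d. f k (x k) * g k (x k)) \<partial>unit_cube d)"
    by (simp add: L2_inner_def tensor_fun_def prod.distrib)
  also have "\<dots> = (\<Prod>k<d. inI (f k) (g k))"
    unfolding unit_cube_def L2_inner_def
    by (rule cube.product_integral_prod) (auto intro: sq_integrable_mult assms)
  finally show ?thesis .
qed

lemma partial_tensor_fun: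
  assumes "i < d" "smooth (f i)"
  shows "partial i (tensor_fun d f) = tensor_fun d (f(i := deriv (f i)))"
proof
  fix x
  have "((\<lambda>t. f i t * (\<Prod>k\<in>{..<d} - {i}. f k (x k))) has_real_derivative
      deriv (f i) (x i) * (\<Prod>k\<in>{..<d} - {i}. f k (x k))) (at (x i))"
    by (rule DERIV_cmult_right[OF smooth_has_deriv[OF assms(2)]])
  then have "partial i (tensor_fun d f) x = deriv (f i) (x i) * (\<Prod>k\<in>{..<d} - {i}. f k (x k))"
    unfolding partial_def tensor_fun_upd[OF assms(1)] by (rule DERIV_imp_deriv)
  also have "(\<Prod>k\<in>{..<d} - {i}. f k (x k)) = (\<Prod>k\<in>{..<d} - {i}. (f(i := deriv (f i))) k (x k))"
    by (rule prod.cong) auto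
  finally show "partial i (tensor_fun d f) x = tensor_fun d (f(i := deriv (f i))) x"
    unfolding tensor_fun_remove[OF assms(1), of "f(i := deriv (f i))"] by simp
qed

text \<open>Iterated partial derivatives of a tensor product are tensor products of smooth factors,
  and the induction over the list of directions carries just this form.\<close>

lemma smooth_Rd_tensor_fun:
  assumes "\<And>k. smooth (f k)" shows "smooth_Rd d (tensor_fun d f)"
  unfolding smooth_Rd_def
proof (intro allI impI conjI ballI)
  fix js :: "nat list" assume js: "set js \<subseteq> {..<d}"
  have "\<exists>g. (\<forall>k. smooth (g k)) \<and> foldr partial js (tensor_fun d f) = tensor_fun d g"
    using js
  proof (induction js)
    case Nil
    then show ?case using assms by auto
  next
    case (Cons i js)
    then obtain g where g: "\<And>k. smooth (g k)" "foldr partial js (tensor_fun d f) = tensor_fun d g" by auto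
    then have "foldr partial (i # js) (tensor_fun d f) = tensor_fun d (g(i := deriv (g i)))"
      using Cons.prems by (simp add: partial_tensor_fun)
    moreover have "smooth ((g(i := deriv (g i))) k)" for k using g(1) smooth_deriv by simp
    ultimately show ?case by blast
  qed
  then obtain g where g: "\<And>k. smooth (g k)" "foldr partial js (tensor_fun d f) = tensor_fun d g" by blast
  have "continuous_on A (\<lambda>x::nat \<Rightarrow> real. g k (x k))" for A k
    by (rule continuous_on_compose2[OF smooth_continuous[OF g(1), of UNIV]
          continuous_on_subset[OF continuous_on_product_coordinates]]) auto
  then show "continuous_on (Rd d) (foldr partial js (tensor_fun d f))"
    unfolding g(2) unfolding tensor_fun_def[abs_def] by (intro continuous_on_prod)
  fix i x assume "i < d" "x \<in> Rd d"
  then show "(\<lambda>t. foldr partial js (tensor_fun d f) (x(i := t))) differentiable (at (x i))"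
    unfolding g(2) by (simp add: tensor_fun_upd smooth_differentiable[OF g(1)])
qed

text \<open>Extensional functions are constant outside \<open>{..<d}\<close>, so the set is a
  product over all of \<open>nat\<close> with singleton factors there, and Tychonoff
  applies.\<close>

lemma compact_PiE_lessThan:
  fixes K :: "nat \<Rightarrow> real set"
  assumes "\<And>k. k < d \<Longrightarrow> compact (K k)" shows "compact (\<Pi>\<^sub>E k\<in>{..<d}. K k)"
proof -
  have "(\<Pi>\<^sub>E k\<in>{..<d}. K k) = (\<Pi>\<^sub>E k\<in>UNIV. if k < d then K k else {undefined})"
    by (auto simp: PiE_def extensional_def Pi_def split: if_splits)
  moreover have "compact (\<Pi>\<^sub>E k\<in>UNIV. if k < d then K k else {undefined})"
    unfolding compactin_euclidean_iff[symmetric] euclidean_product_topology[symmetric]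
    by (subst compactin_PiE) (use assms in auto)
  ultimately show ?thesis by simp
qed

lemma tensor_fun_test_fun:
  assumes "\<And>k. f k \<in> test_fun1" shows "tensor_fun d f \<in> test_fun d"
proof -
  have "\<forall>k. \<exists>K. compact K \<and> K \<subseteq> {0<..<1} \<and> (\<forall>x. x \<notin> K \<longrightarrow> f k x = 0)"
    using assms by (simp add: test_fun1_iff)
  then obtain K where K: "\<And>k. compact (K k)" "\<And>k. K k \<subseteq> {0<..<1}" "\<And>k x. x \<notin> K k \<Longrightarrow> f k x = 0"
    by metis
  show ?thesis
    unfolding test_fun_def
  proof (intro CollectI conjI exI[of _ "\<Pi>\<^sub>E k\<in>{..<d}. K k"] ballI impI)
    show "smooth_Rd d (tensor_fun d f)" by (intro smooth_Rd_tensor_fun test_fun1_smooth assms)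
    show "compact (\<Pi>\<^sub>E k\<in>{..<d}. K k)" by (rule compact_PiE_lessThan) (rule K)
    show "(\<Pi>\<^sub>E k\<in>{..<d}. K k) \<subseteq> (\<Pi>\<^sub>E k\<in>{..<d}. {0<..<1})" by (rule PiE_mono) (rule K)
    fix x assume "x \<in> Rd d" "x \<notin> (\<Pi>\<^sub>E k\<in>{..<d}. K k)"
    then obtain k where "k < d" "x k \<notin> K k" by (auto simp: Rd_def PiE_def Pi_def)
    then show "tensor_fun d f x = 0"
      unfolding tensor_fun_def using K(3) by (intro prod_zero) auto
  qed
qed

lemma partial_slice:
  "partial i F (x(i := t)) = deriv (\<lambda>s. F (x(i := s))) t"
  by (simp add: partial_def)

text \<open>The k-th derivative of a slice is the slice of the k-fold partial derivative in
  direction \<open>i\<close>, and the support of a slice lies in the projection of a compact set.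
  Through Fubini, slices reduce weak partial derivatives to univariate ones.\<close>

lemma test_fun_slice:
  assumes \<phi>: "\<phi> \<in> test_fun d" and i: "i < d" and x: "\<And>t. x(i := t) \<in> Rd d"
  shows "(\<lambda>t. \<phi> (x(i := t))) \<in> test_fun1"
    and "deriv (\<lambda>t. \<phi> (x(i := t))) t = partial i \<phi> (x(i := t))"
proof -
  have sm: "smooth_Rd d \<phi>" using \<phi> by (simp add: test_fun_def)
  have iter: "(deriv ^^ k) (\<lambda>t. \<phi> (x(i := t))) = (\<lambda>t. foldr partial (replicate k i) \<phi> (x(i := t)))" for k
  proof (induction k)
    case (Suc k)
    show ?case by (rule ext) (simp only: funpow.simps o_apply Suc replicate_Suc foldr.simps partial_slice)
  qed simp
  have "smooth (\<lambda>t. \<phi> (x(i := t)))"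
    unfolding smooth_def iter
  proof (intro allI)
    fix k t
    have "set (replicate k i) \<subseteq> {..<d}" using i by auto
    then have "(\<lambda>s. foldr partial (replicate k i) \<phi> ((x(i := t))(i := s))) differentiable (at ((x(i := t)) i))"
      using sm i x unfolding smooth_Rd_def by blast
    then show "(\<lambda>t. foldr partial (replicate k i) \<phi> (x(i := t))) differentiable (at t)" by simp
  qed
  moreover obtain K where K: "compact K" "K \<subseteq> (\<Pi>\<^sub>E k\<in>{..<d}. {0<..<1})" "\<And>y. y \<in> Rd d \<Longrightarrow> y \<notin> K \<Longrightarrow> \<phi> y = 0"
    using \<phi> unfolding test_fun_def by blast
  have "compact ((\<lambda>y. y i) ` K)"
    by (rule compact_continuous_image[OF continuous_on_subset[OF continuous_on_product_coordinates] K(1)]) simp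
  moreover have "(\<lambda>y. y i) ` K \<subseteq> {0<..<1}" using K(2) i by (auto simp: PiE_def Pi_def)
  moreover have "\<phi> (x(i := t)) = 0" if "t \<notin> (\<lambda>y. y i) ` K" for t
  proof (rule K(3)[OF x])
    show "x(i := t) \<notin> K" using that by (metis fun_upd_same image_eqI)
  qed
  ultimately show "(\<lambda>t. \<phi> (x(i := t))) \<in> test_fun1" unfolding test_fun1_iff by blast
  show "deriv (\<lambda>t. \<phi> (x(i := t))) t = partial i \<phi> (x(i := t))" by (simp add: partial_slice)
qed

lemma continuous_Rd_bounded_measurable:
  assumes F: "continuous_on (Rd d) F"
  shows "F \<in> borel_measurable (unit_cube d)" and "\<exists>B. \<forall>x\<in>space (unit_cube d). \<bar>F x :: real\<bar> \<le> B"
proof -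
  \<comment> \<open>Retraction onto the extensional functions: \<open>F\<close> is continuous only
    on \<open>Rd d\<close>, whereas \<open>F\<close> after \<open>res\<close> is continuous, hence
    Borel, on the whole product space.\<close>
  define res :: "(nat \<Rightarrow> real) \<Rightarrow> nat \<Rightarrow> real" where "res x = (\<lambda>k. if k < d then x k else undefined)" for x
  have "continuous_on UNIV (\<lambda>x. res x k)" for k
    unfolding res_def by (cases "k < d") auto
  then have "continuous_on UNIV res" by (rule continuous_on_coordinatewise_then_product)
  moreover have "res ` UNIV \<subseteq> Rd d" by (auto simp: res_def Rd_def PiE_def extensional_def)
  ultimately have "continuous_on UNIV (\<lambda>x. F (res x))" by (rule continuous_on_compose2[OF F])
  then have m: "(\<lambda>x. F (res x)) \<in> borel_measurable borel" by (rule borel_measurable_continuous_onI)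
  have "(\<lambda>x k. x k) \<in> measurable (unit_cube d) (\<Pi>\<^sub>M k\<in>(UNIV::nat set). (borel :: real measure))"
  proof (rule measurable_PiM_single')
    fix k :: nat
    show "(\<lambda>x. x k) \<in> borel_measurable (unit_cube d)"
    proof (cases "k < d")
      case False
      then have "(\<lambda>x. x k) \<in> borel_measurable (unit_cube d) \<longleftrightarrow> (\<lambda>_. undefined :: real) \<in> borel_measurable (unit_cube d)"
        by (intro measurable_cong) (auto simp: space_unit_cube PiE_def extensional_def)
      then show ?thesis by simp
    qed (rule coordinate_measurable)
  qed simp
  then have "(\<lambda>x. x) \<in> measurable (unit_cube d) borel"
    using measurable_cong_sets[OF refl sets_PiM_equal_borel] by blast
  from measurable_compose[OF this m] have "(\<lambda>x. F (res x)) \<in> borel_measurable (unit_cube d)" .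
  also have "?this \<longleftrightarrow> F \<in> borel_measurable (unit_cube d)"
  proof (rule measurable_cong)
    fix x assume "x \<in> space (unit_cube d)"
    then have "res x = x" by (auto simp: res_def space_unit_cube PiE_def extensional_def)
    then show "F (res x) = F x" by simp
  qed
  finally show "F \<in> borel_measurable (unit_cube d)" .
  have "compact (\<Pi>\<^sub>E k\<in>{..<d}. {0..1::real})" by (rule compact_PiE_lessThan) simp
  moreover have "(\<Pi>\<^sub>E k\<in>{..<d}. {0..1::real}) \<subseteq> Rd d" unfolding Rd_def by (rule PiE_mono) simp
  ultimately have "compact (F ` (\<Pi>\<^sub>E k\<in>{..<d}. {0..1}))"
    by (intro compact_continuous_image continuous_on_subset[OF F])
  then obtain B where B: "\<forall>y\<in>F ` (\<Pi>\<^sub>E k\<in>{..<d}. {0..1}). norm y \<le> B"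
    using compact_imp_bounded bounded_iff by blast
  moreover have "space (unit_cube d) \<subseteq> (\<Pi>\<^sub>E k\<in>{..<d}. {0..1})"
    unfolding space_unit_cube by (rule PiE_mono) auto
  ultimately show "\<exists>B. \<forall>x\<in>space (unit_cube d). \<bar>F x\<bar> \<le> B" by force
qed

lemma sq_integrable_continuous_Rd: "continuous_on (Rd d) F \<Longrightarrow> F \<in> sq_integrable (unit_cube d)"
  using continuous_Rd_bounded_measurable[of d F] unit_cube.sq_integrable_bounded by blast

lemma test_fun_sq_integrable:
  assumes "\<phi> \<in> test_fun d"
  shows "\<phi> \<in> sq_integrable (unit_cube d)" and "i < d \<Longrightarrow> partial i \<phi> \<in> sq_integrable (unit_cube d)"
proof -
  have s: "smooth_Rd d \<phi>" using assms by (simp add: test_fun_def)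
  have "set [] \<subseteq> {..<d} \<longrightarrow> continuous_on (Rd d) (foldr partial [] \<phi>)" using s unfolding smooth_Rd_def by blast
  then show "\<phi> \<in> sq_integrable (unit_cube d)" by (simp add: sq_integrable_continuous_Rd)
  assume i: "i < d"
  have "set [i] \<subseteq> {..<d} \<longrightarrow> continuous_on (Rd d) (foldr partial [i] \<phi>)" using s unfolding smooth_Rd_def by blast
  then show "partial i \<phi> \<in> sq_integrable (unit_cube d)" using i by (simp add: sq_integrable_continuous_Rd)
qed

section \<open>Weak partial derivatives of tensor products\<close>

text \<open>Fubini with coordinate \<open>i\<close> innermost. On each line the other factors are a
  constant \<open>P\<close> and the test function is univariate, so the one-dimensional weak
  derivative applies.\<close>

lemma is_weak_partial_tensor_fun:
  assumes f: "\<And>k. k < d \<Longrightarrow> f k \<in> L2I" and i: "i < d" and g: "wd (f i) g"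
  shows "is_weak_partial d i (tensor_fun d f) (tensor_fun d (f(i := g)))"
  unfolding is_weak_partial_def
proof
  fix \<phi> assume \<phi>: "\<phi> \<in> test_fun d"
  let ?I = "{..<d} - {i}"
  have cube: "unit_cube d = (\<Pi>\<^sub>M k\<in>insert i ?I. unit_ivl)"
    unfolding unit_cube_def using i by (simp add: insert_absorb)
  have fg: "(f(i := g)) k \<in> L2I" if "k < d" for k using f[OF that] wdD(2)[OF g] by simp
  have int1: "integrable (unit_cube d) (\<lambda>x. tensor_fun d f x * partial i \<phi> x)"
    by (intro sq_integrable_mult tensor_fun_sq_integrable f test_fun_sq_integrable \<phi> i)
  have int2: "integrable (unit_cube d) (\<lambda>x. tensor_fun d (f(i := g)) x * \<phi> x)"
    by (intro sq_integrable_mult tensor_fun_sq_integrable fg test_fun_sq_integrable \<phi>)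
  have "(\<integral>x. tensor_fun d f x * partial i \<phi> x \<partial>unit_cube d)
      = (\<integral>x. (\<integral>t. tensor_fun d f (x(i := t)) * partial i \<phi> (x(i := t)) \<partial>unit_ivl) \<partial>(\<Pi>\<^sub>M k\<in>?I. unit_ivl))"
    unfolding cube by (rule cube.product_integral_insert) (use int1[unfolded cube] in simp_all)
  also have "\<dots> = (\<integral>x. - (\<integral>t. tensor_fun d (f(i := g)) (x(i := t)) * \<phi> (x(i := t)) \<partial>unit_ivl) \<partial>(\<Pi>\<^sub>M k\<in>?I. unit_ivl))"
  proof (rule Bochner_Integration.integral_cong[OF refl])
    fix x assume "x \<in> space (\<Pi>\<^sub>M k\<in>?I. unit_ivl)"
    then have x: "x(i := t) \<in> Rd d" for t
      using i by (auto simp: Rd_def space_PiM PiE_def extensional_def)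
    define P where "P = (\<Prod>k\<in>?I. f k (x k))"
    define \<eta> where "\<eta> t = \<phi> (x(i := t))" for t
    have \<eta>: "\<eta> \<in> test_fun1" "\<And>t. partial i \<phi> (x(i := t)) = deriv \<eta> t"
      using test_fun_slice[OF \<phi> i x] by (simp_all add: \<eta>_def[abs_def])
    have "(\<Prod>k\<in>?I. (f(i := g)) k (x k)) = P" unfolding P_def by (rule prod.cong) auto
    then have g_upd: "tensor_fun d (f(i := g)) (x(i := t)) = P * g t" for t
      by (simp add: tensor_fun_upd[OF i])
    have f_upd: "tensor_fun d f (x(i := t)) = P * f i t" for t
      by (simp add: tensor_fun_upd[OF i] P_def)
    have "(\<integral>t. tensor_fun d f (x(i := t)) * partial i \<phi> (x(i := t)) \<partial>unit_ivl) = P * inI (f i) (deriv \<eta>)"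
      unfolding f_upd \<eta>(2) L2_inner_def by (simp add: mult.assoc)
    also have "inI (f i) (deriv \<eta>) = - inI g \<eta>" by (rule wdD(3)[OF g \<eta>(1)])
    also have "P * - inI g \<eta> = - (\<integral>t. tensor_fun d (f(i := g)) (x(i := t)) * \<phi> (x(i := t)) \<partial>unit_ivl)"
      unfolding g_upd L2_inner_def by (simp add: \<eta>_def mult.assoc)
    finally show "(\<integral>t. tensor_fun d f (x(i := t)) * partial i \<phi> (x(i := t)) \<partial>unit_ivl)
        = - (\<integral>t. tensor_fun d (f(i := g)) (x(i := t)) * \<phi> (x(i := t)) \<partial>unit_ivl)" .
  qed
  also have "\<dots> = - (\<integral>x. tensor_fun d (f(i := g)) x * \<phi> x \<partial>unit_cube d)"
    unfolding cube
    by (subst cube.product_integral_insert) (use int2[unfolded cube] in simp_all)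
  finally show "(\<integral>x. tensor_fun d f x * partial i \<phi> x \<partial>unit_cube d)
      = - (\<integral>x. tensor_fun d (f(i := g)) x * \<phi> x \<partial>unit_cube d)" .
qed

text \<open>Products of test functions suffice. Their factors are turned into indicators of Borel
  sets one coordinate at a time, so \<open>g\<close> annihilates all boxes; positive and negative
  parts of \<open>g\<close> then define the same measure.\<close>

lemma fundamental_lemma_unit_cube:
  assumes g: "g \<in> sq_integrable (unit_cube d)"
    and zero: "\<And>\<phi>. \<phi> \<in> test_fun d \<Longrightarrow> (\<integral>x. g x * \<phi> x \<partial>unit_cube d) = 0"
  shows "AE x in unit_cube d. g x = 0"
proof -
  have gI: "integrable (unit_cube d) g" by (rule unit_cube.sq_integrable_integrable[OF g])
  have gm [measurable]: "g \<in> borel_measurable (unit_cube d)" using g by (rule sq_integrableD)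
  \<comment> \<open>Induction on the number \<open>m\<close> of factors already turned from test
    functions into indicators.\<close>
  have boxes: "(\<integral>x. g x * tensor_fun d h x \<partial>unit_cube d) = 0"
    if "m \<le> d" "\<And>k. k < m \<Longrightarrow> h k \<in> indicator ` sets borel" "\<And>k. m \<le> k \<Longrightarrow> h k \<in> test_fun1" for m h
    using that
  proof (induction m arbitrary: h)
    case 0
    then show ?case by (intro zero tensor_fun_test_fun) auto
  next
    case (Suc m)
    then have m: "m < d" by simp
    obtain A where A: "A \<in> sets borel" "h m = indicator A" using Suc.prems(2)[of m] by auto
    \<comment> \<open>The other factors form a bounded weight, so
      \<open>integral_indicator_of_test_fun1\<close> applies to coordinate \<open>m\<close> with
      \<open>g x * R x\<close> as integrand.\<close>
    define R where "R x = (\<Prod>k\<in>{..<d} - {m}. h k (x k))" for x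
    have hb: "h k \<in> borel_measurable borel \<and> (\<exists>B. \<forall>t\<in>{0<..<1}. \<bar>h k t\<bar> \<le> B)" for k
    proof (cases "k < Suc m")
      case True
      then obtain B where "B \<in> sets borel" "h k = indicator B" using Suc.prems(2)[of k] by auto
      then show ?thesis by (auto intro!: exI[of _ 1] simp: indicator_def)
    next
      case False
      then have "smooth (h k)" using Suc.prems(3) by (simp add: test_fun1_smooth)
      then have "continuous_on UNIV (h k)" by (rule smooth_continuous)
      then show ?thesis using continuous_bounded_unit_ivl[of "h k"] borel_measurable_continuous_onI by metis
    qed
    then obtain B where B: "\<And>k t. t \<in> {0<..<1} \<Longrightarrow> \<bar>h k t\<bar> \<le> B k" by metis
    have Rm: "R \<in> borel_measurable (unit_cube d)"
      unfolding R_def using hb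
      by (intro borel_measurable_prod measurable_compose[OF coordinate_measurable]) auto
    have Rb: "\<bar>R x\<bar> \<le> (\<Prod>k\<in>{..<d} - {m}. B k)" if "x \<in> space (unit_cube d)" for x
      unfolding R_def abs_prod using that B by (intro prod_mono) (auto simp: space_unit_cube PiE_def Pi_def)
    have GI: "integrable (unit_cube d) (\<lambda>x. g x * R x)"
    proof (rule Bochner_Integration.integrable_bound)
      show "integrable (unit_cube d) (\<lambda>x. (\<Prod>k\<in>{..<d} - {m}. B k) * g x)" using gI by simp
      show "(\<lambda>x. g x * R x) \<in> borel_measurable (unit_cube d)" using Rm by measurable
      show "AE x in unit_cube d. norm (g x * R x) \<le> norm ((\<Prod>k\<in>{..<d} - {m}. B k) * g x)"
      proof (rule AE_I2)
        fix x assume x: "x \<in> space (unit_cube d)"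
        have "\<bar>R x\<bar> * \<bar>g x\<bar> \<le> \<bar>\<Prod>k\<in>{..<d} - {m}. B k\<bar> * \<bar>g x\<bar>"
          using Rb[OF x] by (intro mult_right_mono) auto
        then show "norm (g x * R x) \<le> norm ((\<Prod>k\<in>{..<d} - {m}. B k) * g x)" by (simp add: abs_mult mult.commute)
      qed
    qed
    have split: "tensor_fun d (h(m := \<phi>)) x = R x * \<phi> (x m)" for \<phi> x
    proof -
      have "(\<Prod>k\<in>{..<d} - {m}. (h(m := \<phi>)) k (x k)) = R x" unfolding R_def by (rule prod.cong) auto
      then show ?thesis by (simp add: tensor_fun_remove[OF m])
    qed
    have "(\<integral>x. g x * R x * indicator A (x m) \<partial>unit_cube d) = 0"
    proof (rule integral_indicator_of_test_fun1[OF GI coordinate_measurable[OF m] _ _ A(1)])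
      show "x m \<in> {0<..<1}" if "x \<in> space (unit_cube d)" for x
        using PiE_mem[of x "{..<d}" "\<lambda>_. {0<..<1}" m] that m by (simp only: space_unit_cube lessThan_iff)
      fix \<phi> assume \<phi>: "\<phi> \<in> test_fun1"
      have "(\<integral>x. g x * tensor_fun d (h(m := \<phi>)) x \<partial>unit_cube d) = 0"
      proof (rule Suc.IH)
        show "m \<le> d" using m by simp
        show "(h(m := \<phi>)) k \<in> indicator ` sets borel" if "k < m" for k using Suc.prems(2)[of k] that by simp
        show "(h(m := \<phi>)) k \<in> test_fun1" if "m \<le> k" for k
          using Suc.prems(3)[of k] \<phi> that by (cases "k = m") auto
      qed
      then show "(\<integral>x. g x * R x * \<phi> (x m) \<partial>unit_cube d) = 0" by (simp add: split mult.assoc)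
    qed
    moreover have "tensor_fun d h x = R x * indicator A (x m)" for x
      using split[of "indicator A" x] A(2) by (metis fun_upd_triv)
    ultimately show ?case by (simp add: mult.assoc)
  qed
  define p where "p x = max 0 (g x)" for x
  define n where "n x = max 0 (- g x)" for x
  have pI: "integrable (unit_cube d) p" and nI: "integrable (unit_cube d) n"
    unfolding p_def n_def using gI by (auto intro!: integrable_max)
  have [measurable]: "p \<in> borel_measurable (unit_cube d)" "n \<in> borel_measurable (unit_cube d)"
    unfolding p_def n_def by measurable
  have pn: "g x = p x - n x" "0 \<le> p x" "0 \<le> n x" for x by (auto simp: p_def n_def)
  have em: "emeasure (density (unit_cube d) (\<lambda>x. ennreal (f x))) S = ennreal (\<integral>x. f x * indicator S x \<partial>unit_cube d)"
    if "integrable (unit_cube d) f" "\<And>x. 0 \<le> f x" and S: "S \<in> sets (unit_cube d)" for f :: "_ \<Rightarrow> real" and S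
  proof -
    have [measurable]: "f \<in> borel_measurable (unit_cube d)" using that(1) by (rule borel_measurable_integrable)
    have "emeasure (density (unit_cube d) (\<lambda>x. ennreal (f x))) S = (\<integral>\<^sup>+x. ennreal (f x) * indicator S x \<partial>unit_cube d)"
      by (rule emeasure_density) (use S in measurable)
    also have "\<dots> = (\<integral>\<^sup>+x. ennreal (f x * indicator S x) \<partial>unit_cube d)"
      by (rule nn_integral_cong) (simp add: indicator_def)
    also have "\<dots> = ennreal (\<integral>x. f x * indicator S x \<partial>unit_cube d)"
      by (rule nn_integral_eq_integral) (use that in \<open>auto intro!: integrable_real_mult_indicator\<close>)
    finally show ?thesis .
  qed
  have diff: "(\<integral>x. g x * indicator S x \<partial>unit_cube d)
      = (\<integral>x. p x * indicator S x \<partial>unit_cube d) - (\<integral>x. n x * indicator S x \<partial>unit_cube d)"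
    if "S \<in> sets (unit_cube d)" for S
    unfolding pn(1) left_diff_distrib
    using that pI nI by (intro Bochner_Integration.integral_diff integrable_real_mult_indicator)
  \<comment> \<open>Two finite measures that agree on boxes coincide, since boxes generate the
    product sigma-algebra and are stable under intersection.\<close>
  have "density (unit_cube d) (\<lambda>x. ennreal (p x)) = density (unit_cube d) (\<lambda>x. ennreal (n x))"
  proof (rule measure_eqI_PiM_finite[where I = "{..<d}" and M = "\<lambda>_. unit_ivl" and A = "\<lambda>_. space (unit_cube d)"])
    fix A assume A: "\<And>i. i \<in> {..<d} \<Longrightarrow> A i \<in> sets unit_ivl"
    have S: "Pi\<^sub>E {..<d} A \<in> sets (unit_cube d)"
      unfolding unit_cube_def by (rule sets_PiM_I_finite) (use A in auto)
    define h where "h k = (if k < d then indicator (A k) else (\<lambda>_. 0) :: real \<Rightarrow> real)" for k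
    have "(\<integral>x. g x * tensor_fun d h x \<partial>unit_cube d) = 0"
    proof (rule boxes[OF order_refl])
      show "h k \<in> indicator ` sets borel" if "k < d" for k
        using A[of k] that by (auto simp: h_def sets_unit_ivl)
      show "h k \<in> test_fun1" if "d \<le> k" for k
        using that by (auto simp: h_def test_fun1_iff smooth_const intro!: exI[of _ "{}"])
    qed
    moreover have "tensor_fun d h x = indicator (Pi\<^sub>E {..<d} A) x" if x: "x \<in> space (unit_cube d)" for x
    proof (cases "x \<in> Pi\<^sub>E {..<d} A")
      case False
      then obtain k where "k < d" "x k \<notin> A k" using x by (auto simp: space_unit_cube PiE_def Pi_def)
      then have "h k (x k) = 0" by (simp add: h_def)
      then have "tensor_fun d h x = 0" unfolding tensor_fun_def using \<open>k < d\<close> by (intro prod_zero) auto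
      then show ?thesis using False by simp
    next
      case True
      have "h k (x k) = 1" if "k < d" for k
        using PiE_mem[OF True, of k] that by (simp add: h_def)
      then have "tensor_fun d h x = 1" unfolding tensor_fun_def by simp
      then show ?thesis using True by simp
    qed
    ultimately have "(\<integral>x. g x * indicator (Pi\<^sub>E {..<d} A) x \<partial>unit_cube d) = 0"
      by (simp cong: Bochner_Integration.integral_cong)
    then show "emeasure (density (unit_cube d) (\<lambda>x. ennreal (p x))) (Pi\<^sub>E {..<d} A)
        = emeasure (density (unit_cube d) (\<lambda>x. ennreal (n x))) (Pi\<^sub>E {..<d} A)"
      using diff[OF S] by (simp add: em[OF pI pn(2) S] em[OF nI pn(3) S])
  next
    show "emeasure (density (unit_cube d) (\<lambda>x. ennreal (p x))) (space (unit_cube d)) \<noteq> \<infinity>"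
      by (subst em[OF pI pn(2)]) auto
    show "range (\<lambda>_. space (unit_cube d)) \<subseteq> prod_algebra {..<d} (\<lambda>_. unit_ivl)"
      unfolding space_unit_cube by (auto intro!: prod_algebraI_finite simp: sets_unit_ivl)
  qed (auto simp: unit_cube_def)
  then have eq: "emeasure (density (unit_cube d) (\<lambda>x. ennreal (p x))) S
      = emeasure (density (unit_cube d) (\<lambda>x. ennreal (n x))) S" for S by simp
  show ?thesis
  proof (rule AE_zero_of_set_integrals[OF gI])
    fix S assume S: "S \<in> sets (unit_cube d)"
    have "0 \<le> (\<integral>x. p x * indicator S x \<partial>unit_cube d)" "0 \<le> (\<integral>x. n x * indicator S x \<partial>unit_cube d)"
      using pn by (auto intro!: integral_nonneg_AE)
    then show "(\<integral>x. g x * indicator S x \<partial>unit_cube d) = 0"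
      using eq[of S] diff[OF S] by (simp add: em[OF pI pn(2) S] em[OF nI pn(3) S])
  qed
qed

lemma weak_partial_tensor_fun:
  assumes f: "\<And>k. k < d \<Longrightarrow> f k \<in> L2I" and i: "i < d" and g: "wd (f i) g"
  shows "weak_partial d i (tensor_fun d f) \<in> sq_integrable (unit_cube d)"
    and "AE x in unit_cube d. weak_partial d i (tensor_fun d f) x = tensor_fun d (f(i := g)) x"
proof -
  let ?w = "weak_partial d i (tensor_fun d f)" and ?g = "tensor_fun d (f(i := g))"
  have fg: "(f(i := g)) k \<in> L2I" if "k < d" for k using f[OF that] wdD(2)[OF g] by simp
  have g': "?g \<in> sq_integrable (unit_cube d)" by (rule tensor_fun_sq_integrable[OF fg])
  have gw: "is_weak_partial d i (tensor_fun d f) ?g" by (rule is_weak_partial_tensor_fun[where f = f, OF f i g])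
  have "\<exists>g. g \<in> sq_integrable (unit_cube d) \<and> is_weak_partial d i (tensor_fun d f) g" using g' gw by blast
  from someI_ex[OF this] have w: "?w \<in> sq_integrable (unit_cube d)" "is_weak_partial d i (tensor_fun d f) ?w"
    unfolding weak_partial_def by auto
  then show "?w \<in> sq_integrable (unit_cube d)" by simp
  have "AE x in unit_cube d. ?w x - ?g x = 0"
  proof (rule fundamental_lemma_unit_cube[OF sq_integrable_diff[OF w(1) g']])
    fix \<phi> assume \<phi>: "\<phi> \<in> test_fun d"
    note \<phi>L = test_fun_sq_integrable(1)[OF \<phi>]
    have "(\<integral>x. (?w x - ?g x) * \<phi> x \<partial>unit_cube d)
        = (\<integral>x. ?w x * \<phi> x \<partial>unit_cube d) - (\<integral>x. ?g x * \<phi> x \<partial>unit_cube d)"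
      unfolding left_diff_distrib
      by (intro Bochner_Integration.integral_diff sq_integrable_mult w g' \<phi>L)
    also have "\<dots> = 0"
      using w(2) gw \<phi> unfolding is_weak_partial_def by force
    finally show "(\<integral>x. (?w x - ?g x) * \<phi> x \<partial>unit_cube d) = 0" .
  qed
  then show "AE x in unit_cube d. ?w x = ?g x" by simp
qed

text \<open>The chosen representatives of the weak partials are known only almost everywhere, which
  suffices inside integrals; once they are tensor products, the integrals factorise.\<close>

lemma matrix_T_eq:
  assumes wd: "\<And>\<nu>. wd (\<psi> \<nu>) (\<psi>' \<nu>)"
  shows "matrix_T d \<psi> M \<mu> \<nu> = (\<Sum>i<d. \<Sum>j<d. M i j *
    (\<Prod>k<d. inI (((\<lambda>k. \<psi> (\<nu> k))(j := \<psi>' (\<nu> j))) k) (((\<lambda>k. \<psi> (\<mu> k))(i := \<psi>' (\<mu> i))) k)))"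
proof -
  let ?w = "\<lambda>\<nu> j. weak_partial d j (tensor_basis d \<psi> \<nu>)"
  let ?t = "\<lambda>\<nu> j. tensor_fun d ((\<lambda>k. \<psi> (\<nu> k))(j := \<psi>' (\<nu> j)))"
  have tb: "tensor_basis d \<psi> \<nu> = tensor_fun d (\<lambda>k. \<psi> (\<nu> k))" for \<nu>
    by (simp add: tensor_basis_def[abs_def] tensor_fun_def[abs_def])
  have L: "((\<lambda>k. \<psi> (\<nu> k))(j := \<psi>' (\<nu> j))) k \<in> L2I" for \<nu> j k
    using wdD(1)[OF wd] wdD(2)[OF wd] by simp
  have w: "?w \<nu> j \<in> sq_integrable (unit_cube d)" "AE x in unit_cube d. ?w \<nu> j x = ?t \<nu> j x" if "j < d" for \<nu> j
    unfolding tb using weak_partial_tensor_fun[where f = "\<lambda>k. \<psi> (\<nu> k)", OF wdD(1)[OF wd] that wd] by auto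
  have t: "?t \<nu> j \<in> sq_integrable (unit_cube d)" for \<nu> j by (rule tensor_fun_sq_integrable[OF L])
  have pair: "L2_inner (unit_cube d) (?w \<nu> j) (?w \<mu> i)
      = (\<Prod>k<d. inI (((\<lambda>k. \<psi> (\<nu> k))(j := \<psi>' (\<nu> j))) k) (((\<lambda>k. \<psi> (\<mu> k))(i := \<psi>' (\<mu> i))) k))"
    if ij: "i < d" "j < d" for i j
  proof -
    have "L2_inner (unit_cube d) (?w \<nu> j) (?w \<mu> i) = L2_inner (unit_cube d) (?t \<nu> j) (?w \<mu> i)"
      by (rule L2_inner_cong_AE[OF w(1)[OF ij(2)] t w(2)[OF ij(2)] w(1)[OF ij(1)]])
    also have "\<dots> = L2_inner (unit_cube d) (?w \<mu> i) (?t \<nu> j)" by (rule L2_inner_commute)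
    also have "\<dots> = L2_inner (unit_cube d) (?t \<mu> i) (?t \<nu> j)"
      by (rule L2_inner_cong_AE[OF w(1)[OF ij(1)] t w(2)[OF ij(1)] t])
    also have "\<dots> = L2_inner (unit_cube d) (?t \<nu> j) (?t \<mu> i)" by (rule L2_inner_commute)
    also have "\<dots> = (\<Prod>k<d. inI (((\<lambda>k. \<psi> (\<nu> k))(j := \<psi>' (\<nu> j))) k) (((\<lambda>k. \<psi> (\<mu> k))(i := \<psi>' (\<mu> i))) k))"
      by (rule inner_tensor_fun[OF L L])
    finally show ?thesis .
  qed
  have "matrix_T d \<psi> M \<mu> \<nu> = (\<integral>x. (\<Sum>i<d. \<Sum>j<d. M i j * (?w \<nu> j x * ?w \<mu> i x)) \<partial>unit_cube d)"
    unfolding matrix_T_def form_A_def by (simp add: sum_distrib_right mult.assoc)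
  also have "\<dots> = (\<Sum>i<d. \<Sum>j<d. M i j * L2_inner (unit_cube d) (?w \<nu> j) (?w \<mu> i))"
    unfolding L2_inner_def using w(1)
    by (subst Bochner_Integration.integral_sum, intro Bochner_Integration.integrable_sum integrable_mult_right sq_integrable_mult; simp)
      (rule sum.cong[OF refl], subst Bochner_Integration.integral_sum, intro integrable_mult_right sq_integrable_mult; simp)
  also have "\<dots> = (\<Sum>i<d. \<Sum>j<d. M i j *
    (\<Prod>k<d. inI (((\<lambda>k. \<psi> (\<nu> k))(j := \<psi>' (\<nu> j))) k) (((\<lambda>k. \<psi> (\<mu> k))(i := \<psi>' (\<mu> i))) k)))"
    by (intro sum.cong refl arg_cong2[where f = times] pair) auto
  finally show ?thesis .
qed

section \<open>Coordinates with respect to an orthonormal basis\<close>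

definition coef :: "('i \<Rightarrow> real \<Rightarrow> real) \<Rightarrow> (real \<Rightarrow> real) \<Rightarrow> 'i ell2" where
  "coef \<psi> f = Abs_ell2 (\<lambda>\<nu>. inI (\<psi> \<nu>) f)"

locale onb_ivl =
  fixes \<psi> :: "'i \<Rightarrow> real \<Rightarrow> real"
  assumes onb: "orthonormal_basis_L2 unit_ivl \<psi>"
begin

lemma basis_L2: "\<psi> \<nu> \<in> L2I"
  and basis_inner: "inI (\<psi> \<mu>) (\<psi> \<nu>) = (if \<mu> = \<nu> then 1 else 0)"
  using onb by (auto simp: orthonormal_basis_L2_def)

lemma inner_lin_comb: "h \<in> L2I \<Longrightarrow> inI (lin_comb F a \<psi>) h = (\<Sum>\<nu>\<in>F. a \<nu> * inI (\<psi> \<nu>) h)"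
  unfolding lin_comb_def by (subst L2_inner_sum) (auto simp: L2_inner_cmult intro: sq_integrable_cmult basis_L2)

text \<open>Completing the square. The optimal coefficients give Bessel's inequality; arbitrary ones
  together with density give Parseval's identity in \<open>norm_coef\<close>.\<close>

lemma dist_lin_comb_sq:
  assumes f: "f \<in> L2I" and F: "finite F"
  shows "(nrI (\<lambda>x. f x - lin_comb F a \<psi> x))\<^sup>2
    = (nrI f)\<^sup>2 - (\<Sum>\<nu>\<in>F. (inI (\<psi> \<nu>) f)\<^sup>2) + (\<Sum>\<nu>\<in>F. (a \<nu> - inI (\<psi> \<nu>) f)\<^sup>2)"
proof -
  let ?L = "lin_comb F a \<psi>"
  have L: "?L \<in> L2I" by (rule sq_integrable_lin_comb) (rule basis_L2)
  have nL: "(\<lambda>x. - 1 * ?L x) \<in> L2I" by (rule sq_integrable_cmult[OF L])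
  have fL: "inI f ?L = (\<Sum>\<nu>\<in>F. a \<nu> * inI (\<psi> \<nu>) f)"
    using inner_lin_comb[OF f, of F a] by (simp add: L2_inner_commute)
  have LL: "inI ?L ?L = (\<Sum>\<nu>\<in>F. (a \<nu>)\<^sup>2)"
  proof -
    have "inI (\<psi> \<nu>) ?L = a \<nu>" if "\<nu> \<in> F" for \<nu>
      using inner_lin_comb[OF basis_L2[of \<nu>], of F a] F that
      by (simp add: L2_inner_commute[of _ "\<psi> \<nu>"] basis_inner if_distrib[of "\<lambda>z. _ * z"] cong: if_cong)
    then show ?thesis unfolding inner_lin_comb[OF L] by (simp add: power2_eq_square)
  qed
  have "(nrI (\<lambda>x. f x - ?L x))\<^sup>2 = (nrI f)\<^sup>2 + 2 * (- 1 * inI f ?L) + (nrI (\<lambda>x. - 1 * ?L x))\<^sup>2"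
    using L2_nrm_add_sq[OF f nL] unfolding L2_inner_cmult_right by simp
  also have "(nrI (\<lambda>x. - 1 * ?L x))\<^sup>2 = inI ?L ?L" unfolding L2_nrm_cmult by (simp add: L2_nrm_sq)
  also have "(nrI f)\<^sup>2 + 2 * (- 1 * inI f ?L) + inI ?L ?L
      = (nrI f)\<^sup>2 + (\<Sum>\<nu>\<in>F. (a \<nu>)\<^sup>2 - 2 * (a \<nu> * inI (\<psi> \<nu>) f))"
    by (simp add: fL LL sum_subtractf sum_distrib_left sum_negf)
  also have "(\<Sum>\<nu>\<in>F. (a \<nu>)\<^sup>2 - 2 * (a \<nu> * inI (\<psi> \<nu>) f))
      = (\<Sum>\<nu>\<in>F. (a \<nu> - inI (\<psi> \<nu>) f)\<^sup>2 - (inI (\<psi> \<nu>) f)\<^sup>2)"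
    by (rule sum.cong[OF refl]) (simp add: power2_eq_square algebra_simps)
  finally show ?thesis by (simp add: sum_subtractf)
qed

lemma bessel: "f \<in> L2I \<Longrightarrow> finite F \<Longrightarrow> (\<Sum>\<nu>\<in>F. (inI (\<psi> \<nu>) f)\<^sup>2) \<le> (nrI f)\<^sup>2"
  using dist_lin_comb_sq[of f F "\<lambda>\<nu>. inI (\<psi> \<nu>) f"] zero_le_power2[of "nrI (\<lambda>x. f x - lin_comb F (\<lambda>\<nu>. inI (\<psi> \<nu>) f) \<psi> x)"]
  by simp

lemma coord_coef: "f \<in> L2I \<Longrightarrow> coord (coef \<psi> f) \<nu> = inI (\<psi> \<nu>) f"
  unfolding coef_def by (subst coord_Abs) (auto intro: summable_on_sq_bounded[OF bessel])

lemma norm_coef: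
  assumes f: "f \<in> L2I" shows "norm (coef \<psi> f) = nrI f"
proof (rule power2_eq_imp_eq)
  show "(norm (coef \<psi> f))\<^sup>2 = (nrI f)\<^sup>2"
  proof (rule antisym)
    show "(norm (coef \<psi> f))\<^sup>2 \<le> (nrI f)\<^sup>2"
      by (rule norm_ell2_sq_le) (simp add: coord_coef[OF f] bessel[OF f])
    show "(nrI f)\<^sup>2 \<le> (norm (coef \<psi> f))\<^sup>2"
    proof (rule field_le_epsilon)
      fix e :: real assume e: "e > 0"
      have "\<exists>F a. finite F \<and> nrI (\<lambda>x. f x - lin_comb F a \<psi> x) < sqrt e"
        using onb f e unfolding orthonormal_basis_L2_def dense_span_def by (meson real_sqrt_gt_zero)
      then obtain F a where F: "finite F" and lt: "nrI (\<lambda>x. f x - lin_comb F a \<psi> x) < sqrt e" by blast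
      have "(nrI (\<lambda>x. f x - lin_comb F a \<psi> x))\<^sup>2 \<le> (sqrt e)\<^sup>2"
        using lt by (intro power_mono L2_nrm_nonneg) simp
      moreover have "0 \<le> (\<Sum>\<nu>\<in>F. (a \<nu> - inI (\<psi> \<nu>) f)\<^sup>2)" by (intro sum_nonneg) simp
      moreover have "(\<Sum>\<nu>\<in>F. (inI (\<psi> \<nu>) f)\<^sup>2) \<le> (norm (coef \<psi> f))\<^sup>2"
        using sum_coord_sq_le[OF F, of "coef \<psi> f"] by (simp add: coord_coef[OF f])
      ultimately show "(nrI f)\<^sup>2 \<le> (norm (coef \<psi> f))\<^sup>2 + e"
        using dist_lin_comb_sq[OF f F, of a] e by simp
    qed
  qed
qed (auto simp: L2_nrm_nonneg)

lemma coef_add: "f \<in> L2I \<Longrightarrow> g \<in> L2I \<Longrightarrow> coef \<psi> (\<lambda>x. f x + g x) = coef \<psi> f + coef \<psi> g"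
  by (rule ell2_eqI) (simp add: coord_coef sq_integrable_add L2_inner_add_right basis_L2)

lemma coef_cmult: "f \<in> L2I \<Longrightarrow> coef \<psi> (\<lambda>x. c * f x) = c *\<^sub>R coef \<psi> f"
  by (rule ell2_eqI) (simp add: coord_coef sq_integrable_cmult L2_inner_cmult_right)

lemma coef_diff: "f \<in> L2I \<Longrightarrow> g \<in> L2I \<Longrightarrow> coef \<psi> (\<lambda>x. f x - g x) = coef \<psi> f - coef \<psi> g"
  using coef_add[of f "\<lambda>x. -1 * g x"] coef_cmult[of g "-1"] sq_integrable_cmult[of g unit_ivl "-1"] by simp

lemma coef_zero: "coef \<psi> (\<lambda>_. 0) = 0"
  using coef_cmult[OF sq_integrable_zero, of 0] by simp

lemma coef_sum:
  assumes "\<And>i. i \<in> F \<Longrightarrow> f i \<in> L2I"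
  shows "coef \<psi> (\<lambda>x. \<Sum>i\<in>F. c i * f i x) = (\<Sum>i\<in>F. c i *\<^sub>R coef \<psi> (f i))"
  using assms
proof (induction F rule: infinite_finite_induct)
  case (insert i F)
  have "coef \<psi> (\<lambda>x. c i * f i x + (\<Sum>i\<in>F. c i * f i x)) = coef \<psi> (\<lambda>x. c i * f i x) + coef \<psi> (\<lambda>x. \<Sum>i\<in>F. c i * f i x)"
    by (rule coef_add) (auto intro!: sq_integrable_cmult sq_integrable_sum insert.prems)
  then show ?case using insert by (simp add: coef_cmult)
qed (auto simp: coef_zero)

text \<open>Polarisation of \<open>norm_coef\<close>.\<close>

lemma inner_coef:
  assumes f: "f \<in> L2I" and g: "g \<in> L2I" shows "inner (coef \<psi> f) (coef \<psi> g) = inI f g"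
proof -
  have "(norm (coef \<psi> f + coef \<psi> g))\<^sup>2 = (nrI (\<lambda>x. f x + g x))\<^sup>2"
    using norm_coef[OF sq_integrable_add[OF f g]] by (simp add: coef_add[OF f g])
  then have "(nrI f)\<^sup>2 + 2 * inner (coef \<psi> f) (coef \<psi> g) + (nrI g)\<^sup>2 = (nrI f)\<^sup>2 + 2 * inI f g + (nrI g)\<^sup>2"
    unfolding L2_nrm_add_sq[OF f g] norm_coef[OF f, symmetric] norm_coef[OF g, symmetric]
    by (simp add: power2_norm_eq_inner inner_add_left inner_add_right inner_commute)
  then show ?thesis by simp
qed

lemma coef_basis: "coef \<psi> (\<psi> \<nu>) = unit_vec \<nu>"
  by (rule ell2_eqI) (simp add: coord_coef[OF basis_L2] basis_inner coord_unit_vec)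

end

lemma subspace_closure_span:
  fixes S :: "'a::real_normed_vector set" shows "subspace (closure (span S))"
proof (rule subspaceI)
  show "0 \<in> closure (span S)" using closure_subset span_zero by blast
  fix x y assume "x \<in> closure (span S)" "y \<in> closure (span S)"
  then obtain u v where "\<And>n. u n \<in> span S" "u \<longlonglongrightarrow> x" "\<And>n. v n \<in> span S" "v \<longlonglongrightarrow> y"
    by (auto simp: closure_sequential)
  then have "(\<forall>n. u n + v n \<in> span S) \<and> (\<lambda>n. u n + v n) \<longlonglongrightarrow> x + y"
    by (auto intro: span_add tendsto_add)
  then show "x + y \<in> closure (span S)"
    unfolding closure_sequential by (rule exI[of _ "\<lambda>n. u n + v n"])
next
  fix c :: real and x assume "x \<in> closure (span S)"
  then obtain u where "\<And>n. u n \<in> span S" "u \<longlonglongrightarrow> x" by (auto simp: closure_sequential)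
  then have "(\<forall>n. c *\<^sub>R u n \<in> span S) \<and> (\<lambda>n. c *\<^sub>R u n) \<longlonglongrightarrow> c *\<^sub>R x"
    by (auto intro: span_scale tendsto_scaleR)
  then show "c *\<^sub>R x \<in> closure (span S)"
    unfolding closure_sequential by (rule exI[of _ "\<lambda>n. c *\<^sub>R u n"])
qed

lemma closure_eq_UNIV_of_unit_vec:
  assumes Y: "subspace Y" "closed Y" and e: "\<And>\<nu>. unit_vec \<nu> \<in> Y"
  shows "Y = UNIV"
proof -
  have "x \<in> Y" for x
  proof (rule Lim_in_closed_set[OF Y(2)])
    show "((\<lambda>F. \<Sum>\<nu>\<in>F. coord x \<nu> *\<^sub>R unit_vec \<nu>) \<longlongrightarrow> x) (finite_subsets_at_top UNIV)"
      using has_sum_unit_vec[of x] unfolding has_sum_def .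
    show "\<forall>\<^sub>F F in finite_subsets_at_top UNIV. (\<Sum>\<nu>\<in>F. coord x \<nu> *\<^sub>R unit_vec \<nu>) \<in> Y"
      by (intro always_eventually allI subspace_sum[OF Y(1)] subspace_scale[OF Y(1)] e)
  qed simp
  then show ?thesis by blast
qed

section \<open>The univariate basis as a second order system\<close>

context onb_ivl
begin

text \<open>The density of sine polynomials is carried over by the isometry
  \<open>coef \<psi>\<close>.\<close>

lemma dir_sin_total: "closure (span (range (\<lambda>n. coef \<psi> (dir_sin n)))) = UNIV"
proof (rule closure_eq_UNIV_of_unit_vec[OF subspace_closure_span closed_closure])
  have T: "coef \<psi> T \<in> span (range (\<lambda>n. coef \<psi> (dir_sin n)))" if "T \<in> sine_poly" for T
    using that
  proof induction
    case (step T c k)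
    have s: "dir_sin k \<in> L2I" by (rule sq_integrable_smooth[OF smooth_dir_sin])
    have "coef \<psi> (\<lambda>x. T x + c * dir_sin k x) = coef \<psi> T + c *\<^sub>R coef \<psi> (dir_sin k)"
      using sine_poly_sq_integrable[OF step.hyps] s by (simp add: coef_add coef_cmult sq_integrable_cmult)
    then show ?case using step.IH by (simp add: span_add span_scale span_base)
  qed (simp add: coef_zero span_zero)
  fix \<nu>
  show "unit_vec \<nu> \<in> closure (span (range (\<lambda>n. coef \<psi> (dir_sin n))))"
    unfolding closure_approachable
  proof (intro allI impI)
    fix e :: real assume "e > 0"
    then obtain T where T': "T \<in> sine_poly" "nrI (\<lambda>x. \<psi> \<nu> x - T x) < e"
      using sine_poly_dense[OF basis_L2] by blast
    have "norm (unit_vec \<nu> - coef \<psi> T) < e"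
      using T'(2) sine_poly_sq_integrable[OF T'(1)] norm_coef[OF sq_integrable_diff[OF basis_L2[of \<nu>]], of T]
      by (simp add: coef_diff basis_L2 coef_basis)
    then have "dist (coef \<psi> T) (unit_vec \<nu>) < e" by (simp add: dist_norm norm_minus_commute)
    then show "\<exists>y\<in>span (range (\<lambda>n. coef \<psi> (dir_sin n))). dist y (unit_vec \<nu>) < e" using T[OF T'(1)] by blast
  qed
qed

lemma second_order_system_of_riesz_basis:
  assumes riesz: "riesz_basis (H2_ivl \<inter> H10_ivl) H2_nrm (\<lambda>\<nu> x. inverse (2 ^ (2 * lev \<nu>)) * \<psi> \<nu> x)"
  obtains \<psi>' q s \<kappa> c C where "\<And>\<nu>. wd (\<psi> \<nu>) (\<psi>' \<nu>)"
    and "second_order_system (\<lambda>\<nu>. coef \<psi> (\<psi>' \<nu>)) q (\<lambda>\<nu>. 2 ^ (2 * lev \<nu>)) c C s \<kappa>"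
proof -
  define l :: "'i \<Rightarrow> real" where "l \<nu> = 2 ^ (2 * lev \<nu>)" for \<nu>
  have l: "1 \<le> l \<nu>" for \<nu> by (simp add: l_def)
  have l0: "0 < l \<nu>" for \<nu> using l[of \<nu>] by linarith
  define b where "b \<nu> x = inverse (l \<nu>) * \<psi> \<nu> x" for \<nu> x
  have riesz: "riesz_basis (H2_ivl \<inter> H10_ivl) H2_nrm b"
    using riesz by (simp add: b_def[abs_def] l_def)
  have "\<exists>g h. h10 (b \<nu>) g \<and> wd g h" for \<nu>
    using riesz unfolding riesz_basis_def H2_H10_iff[symmetric] by blast
  then obtain b' b'' where b: "\<And>\<nu>. h10 (b \<nu>) (b' \<nu>)" "\<And>\<nu>. wd (b' \<nu>) (b'' \<nu>)" by metis
  define \<psi>' where "\<psi>' \<nu> x = l \<nu> * b' \<nu> x" for \<nu> x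
  define \<psi>'' where "\<psi>'' \<nu> x = l \<nu> * b'' \<nu> x" for \<nu> x
  have \<psi>_eq: "\<psi> \<nu> = (\<lambda>x. l \<nu> * b \<nu> x)" for \<nu>
    unfolding b_def using l0[of \<nu>] by (intro ext) simp
  have h: "h10 (\<psi> \<nu>) (\<psi>' \<nu>)" for \<nu>
    unfolding \<psi>_eq \<psi>'_def[abs_def] by (rule h10_cmult[OF b(1)])
  have w1: "wd (\<psi> \<nu>) (\<psi>' \<nu>)" for \<nu> using h by (simp add: h10_def)
  have w2: "wd (\<psi>' \<nu>) (\<psi>'' \<nu>)" for \<nu>
    unfolding \<psi>'_def[abs_def] \<psi>''_def[abs_def] by (rule wd_cmult[OF b(2)])
  note L = wdD(1)[OF w1] wdD(2)[OF w1] wdD(2)[OF w2]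
  define r where "r \<nu> = coef \<psi> (\<psi>' \<nu>)" for \<nu>
  define q where "q \<nu> = coef \<psi> (\<lambda>x. -1 * \<psi>'' \<nu> x)" for \<nu>
  define s where "s n = coef \<psi> (dir_sin n)" for n
  define \<kappa> where "\<kappa> n = (real (Suc n) * pi)\<^sup>2" for n
  have mL: "(\<lambda>x. -1 * \<psi>'' \<nu> x) \<in> L2I" for \<nu> by (rule sq_integrable_cmult[OF L(3)])
  obtain c C where c: "0 < c" and C: "0 < C"
    and low: "\<And>F a. finite F \<Longrightarrow> c * (\<Sum>\<nu>\<in>F. (a \<nu>)\<^sup>2) \<le> (H2_nrm (lin_comb F a b))\<^sup>2"
    and upp: "\<And>F a. finite F \<Longrightarrow> (H2_nrm (lin_comb F a b))\<^sup>2 \<le> C * (\<Sum>\<nu>\<in>F. (a \<nu>)\<^sup>2)"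
    using riesz unfolding riesz_basis_def by blast
  have lin: "lin_comb F (\<lambda>\<nu>. l \<nu> * a \<nu>) b = (\<lambda>x. \<Sum>\<nu>\<in>F. a \<nu> * \<psi> \<nu> x)" for F a
    unfolding lin_comb_def \<psi>_eq by (simp add: mult_ac)
  have comb_h: "h10 (\<lambda>x. \<Sum>\<nu>\<in>F. a \<nu> * \<psi> \<nu> x) (\<lambda>x. \<Sum>\<nu>\<in>F. a \<nu> * \<psi>' \<nu> x)"
    and comb_w: "wd (\<lambda>x. \<Sum>\<nu>\<in>F. a \<nu> * \<psi>' \<nu> x) (\<lambda>x. \<Sum>\<nu>\<in>F. a \<nu> * \<psi>'' \<nu> x)" for F a
    by (intro h10_sum h10_cmult h, intro wd_sum wd_cmult w2)
  have sum_q: "(\<Sum>\<nu>\<in>F. a \<nu> *\<^sub>R q \<nu>) = coef \<psi> (\<lambda>x. -1 * (\<Sum>\<nu>\<in>F. a \<nu> * \<psi>'' \<nu> x))" for F a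
    unfolding q_def using coef_sum[OF mL, where F = F and c = a] by (simp add: sum_negf)
  have norm_q: "norm (\<Sum>\<nu>\<in>F. a \<nu> *\<^sub>R q \<nu>) = nrI (\<lambda>x. \<Sum>\<nu>\<in>F. a \<nu> * \<psi>'' \<nu> x)" for F a
    unfolding sum_q using norm_coef[OF sq_integrable_cmult[OF wdD(2)[OF comb_w[where F = F and a = a]], where c = "-1"]]
    by (simp add: L2_nrm_cmult[of _ "-1", simplified])
  \<comment> \<open>The 21 is the constant of \<open>h2_bounds\<close>; it affects the lower bound
    only, as the second derivative is dominated by \<open>H2_nrm\<close> with constant 1. The square
    roots appear because the locale squares its constants.\<close>
  have "second_order_system r q l (sqrt (c / 21)) (sqrt C) s \<kappa>"
  proof
    show "inner (r \<mu>) (r \<nu>) = coord (q \<nu>) \<mu>" for \<mu> \<nu>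
      using h10_parts[OF h w2, of \<mu> \<nu>] coord_coef[OF mL, of \<nu> \<mu>]
      unfolding r_def q_def L2_inner_cmult_right by (simp add: inner_coef L)
    show "coord (r \<mu>) \<nu> = - coord (r \<nu>) \<mu>" for \<mu> \<nu>
      using h10_parts[OF h w1, of \<mu> \<nu>]
      by (simp add: r_def coord_coef L L2_inner_commute[of _ "\<psi> \<nu>"])
    show "1 \<le> l \<nu>" for \<nu> by (rule l)
    show "0 < sqrt (c / 21)" "0 < sqrt C" "0 < \<kappa> n" for n using c C by (simp_all add: \<kappa>_def)
    show "(sqrt (c / 21))\<^sup>2 * (\<Sum>\<nu>\<in>F. (l \<nu> * a \<nu>)\<^sup>2) \<le> (norm (\<Sum>\<nu>\<in>F. a \<nu> *\<^sub>R q \<nu>))\<^sup>2"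
      if F: "finite F" for F a
      using low[OF F, of "\<lambda>\<nu>. l \<nu> * a \<nu>"] h2_bounds(2)[OF comb_h[where F = F and a = a] comb_w[where F = F and a = a]] c
      unfolding norm_q lin by simp
    show "(norm (\<Sum>\<nu>\<in>F. a \<nu> *\<^sub>R q \<nu>))\<^sup>2 \<le> (sqrt C)\<^sup>2 * (\<Sum>\<nu>\<in>F. (l \<nu> * a \<nu>)\<^sup>2)"
      if F: "finite F" for F a
    proof -
      have "(nrI (\<lambda>x. \<Sum>\<nu>\<in>F. a \<nu> * \<psi>'' \<nu> x))\<^sup>2 \<le> (H2_nrm (\<lambda>x. \<Sum>\<nu>\<in>F. a \<nu> * \<psi> \<nu> x))\<^sup>2"
        by (intro power_mono h2_bounds(1)[OF comb_h comb_w] L2_nrm_nonneg)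
      then show ?thesis using upp[OF F, of "\<lambda>\<nu>. l \<nu> * a \<nu>"] C unfolding norm_q lin by simp
    qed
    show "closure (span (range s)) = UNIV" unfolding s_def by (rule dir_sin_total)
    fix n
    show "(s n, \<kappa> n *\<^sub>R s n) \<in> closure (span (range (\<lambda>\<nu>. (unit_vec \<nu>, q \<nu>))))"
      unfolding closure_approachable
    proof (intro allI impI)
      fix e :: real assume "e > 0"
      then have "e / 2 > 0" by simp
      \<comment> \<open>A single approximation in \<open>H2_nrm\<close> controls both components of
        the pair, the function and its second derivative.\<close>
      then obtain F a where F: "finite F" and lt: "H2_nrm (\<lambda>x. dir_sin n x - lin_comb F a b x) < e / 2"
        using riesz dir_sin_H2_H10[of n] unfolding riesz_basis_def dense_span_def by blast
      define v where "v \<nu> = inverse (l \<nu>) * a \<nu>" for \<nu>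
      have "lin_comb F a b = (\<lambda>x. \<Sum>\<nu>\<in>F. v \<nu> * \<psi> \<nu> x)"
      proof -
        have "l \<nu> * (inverse (l \<nu>) * a \<nu>) = a \<nu>" for \<nu> using l0[of \<nu>] by simp
        then show ?thesis unfolding lin[symmetric] v_def by (simp only:)
      qed
      note lt = lt[unfolded this]
      let ?u = "\<lambda>x. \<Sum>\<nu>\<in>F. v \<nu> * \<psi> \<nu> x" and ?u' = "\<lambda>x. \<Sum>\<nu>\<in>F. v \<nu> * \<psi>' \<nu> x"
        and ?u'' = "\<lambda>x. \<Sum>\<nu>\<in>F. v \<nu> * \<psi>'' \<nu> x"
      have hd: "h10 (\<lambda>x. dir_sin n x - ?u x) (\<lambda>x. deriv (dir_sin n) x - ?u' x)"
        using h10_add[OF h10_dir_sin[of n] h10_cmult[OF comb_h[where F = F and a = v], where c = "-1"]] by simp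
      have wdd: "wd (\<lambda>x. deriv (dir_sin n) x - ?u' x) (\<lambda>x. deriv (deriv (dir_sin n)) x - ?u'' x)"
        by (rule wd_diff[OF wd_smooth[OF smooth_deriv[OF smooth_dir_sin]] comb_w])
      note bds = h2_bounds(3)[OF hd wdd] h2_bounds(1)[OF hd wdd]
      have sL: "dir_sin n \<in> L2I" "deriv (deriv (dir_sin n)) \<in> L2I"
        by (intro sq_integrable_smooth smooth_deriv smooth_dir_sin)+
      have uL: "?u \<in> L2I" "?u'' \<in> L2I" 
        by (rule wdD(1)[OF conjunct1[OF comb_h[unfolded h10_def]]], rule wdD(2)[OF comb_w])
      define p where "p = (\<Sum>\<nu>\<in>F. v \<nu> *\<^sub>R (unit_vec \<nu>, q \<nu>))"
      have p: "p \<in> span (range (\<lambda>\<nu>. (unit_vec \<nu>, q \<nu>)))"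
        unfolding p_def by (intro span_sum span_scale span_base) auto
      have p1: "fst p = coef \<psi> ?u"
        unfolding p_def by (simp add: fst_sum coef_sum basis_L2 coef_basis)
      have p2: "snd p = - coef \<psi> ?u''"
        unfolding p_def using coef_cmult[OF uL(2), of "-1"] by (simp add: snd_sum sum_q)
      have "\<kappa> n *\<^sub>R s n = - coef \<psi> (deriv (deriv (dir_sin n)))"
        unfolding deriv2_dir_sin coef_cmult[OF sL(1)] s_def \<kappa>_def by simp
      then have 2: "norm (snd p - \<kappa> n *\<^sub>R s n) < e / 2"
        using bds(2) lt norm_coef[OF sq_integrable_diff[OF sL(2) uL(2)]] by (simp add: p2 coef_diff[OF sL(2) uL(2)])
      have 1: "norm (fst p - s n) < e / 2"
        using bds(1) lt norm_coef[OF sq_integrable_diff[OF sL(1) uL(1)]]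
        by (simp add: p1 s_def coef_diff[OF sL(1) uL(1)] norm_minus_commute)
      have "dist p (s n, \<kappa> n *\<^sub>R s n) = norm (fst p - s n, snd p - \<kappa> n *\<^sub>R s n)"
        unfolding dist_norm by (metis fst_conv minus_prod_def snd_conv)
      also have "\<dots> \<le> norm (fst p - s n) + norm (snd p - \<kappa> n *\<^sub>R s n)" by (rule norm_Pair_le)
      also have "\<dots> < e" using 1 2 by simp
      finally show "\<exists>y\<in>span (range (\<lambda>\<nu>. (unit_vec \<nu>, q \<nu>))). dist y (s n, \<kappa> n *\<^sub>R s n) < e"
        using p by blast
    qed
  qed
  with w1 show thesis unfolding r_def[abs_def] l_def[abs_def] by (rule that)
qed

end

section \<open>The stiffness matrix\<close>

text \<open>Row \<mu> of the stiffness matrix is the coordinate vector of A \<Psi>_\<mu>. In the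
  mixed terms the derivative on \<psi>_\<nu> in coordinate \<open>j\<close> moves to the other
  factor, with one change of sign.\<close>

lemma (in second_order_system) coord_tvec_eq_matrix_T:
  assumes onb: "onb_ivl \<psi>" and wd: "\<And>\<nu>. wd (\<psi> \<nu>) (\<psi>' \<nu>)" and r: "\<And>\<nu>. r \<nu> = coef \<psi> (\<psi>' \<nu>)"
    and \<nu>: "\<nu> \<in> multi_idx d"
  shows "coord (tvec d r q M \<mu>) \<nu> = matrix_T d \<psi> M \<mu> \<nu>"
proof -
  interpret onb_ivl \<psi> by (rule onb)
  note L = wdD(1)[OF wd] wdD(2)[OF wd]
  have ip: "inI (\<psi> a) (\<psi> b) = inner (unit_vec b) (unit_vec a)" "inI (\<psi>' a) (\<psi>' b) = inner (q b) (unit_vec a)"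
    "inI (\<psi> a) (\<psi>' b) = inner (r b) (unit_vec a)" "inI (\<psi>' a) (\<psi> b) = - inner (r b) (unit_vec a)" for a b
  proof -
    show "inI (\<psi> a) (\<psi> b) = inner (unit_vec b) (unit_vec a)"
      by (simp add: basis_inner inner_unit_vec_right coord_unit_vec)
    show "inI (\<psi>' a) (\<psi>' b) = inner (q b) (unit_vec a)"
      using inner_r[of a b] by (simp add: r inner_coef[OF L(2) L(2)] inner_unit_vec_right)
    show 1: "inI (\<psi> a) (\<psi>' b) = inner (r b) (unit_vec a)" for a b
      by (simp add: r inner_unit_vec_right coord_coef[OF L(2)])
    show "inI (\<psi>' a) (\<psi> b) = - inner (r b) (unit_vec a)"
      using 1[of b a] r_antisym[of a b] by (simp add: L2_inner_commute inner_unit_vec_right)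
  qed
  have entry: "(\<Prod>k<d. inI (((\<lambda>k. \<psi> (\<nu> k))(j := \<psi>' (\<nu> j))) k) (((\<lambda>k. \<psi> (\<mu> k))(i := \<psi>' (\<mu> i))) k))
      = - coord (dd d r q i j \<mu>) \<nu>" if i: "i < d" and j: "j < d" for i j
  proof -
    have c: "coord x \<nu> = inner x (tens d (\<lambda>k. unit_vec (\<nu> k)))" for x
      by (simp add: tens_unit_vec[OF \<nu>] inner_unit_vec_right)
    show ?thesis
    proof (cases "i = j")
      case True
      have "(\<Prod>k<d. inI (((\<lambda>k. \<psi> (\<nu> k))(i := \<psi>' (\<nu> i))) k) (((\<lambda>k. \<psi> (\<mu> k))(i := \<psi>' (\<mu> i))) k))
          = (\<Prod>k<d. inner (((\<lambda>k. unit_vec (\<mu> k))(i := q (\<mu> i))) k) (unit_vec (\<nu> k)))"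
        by (rule prod.cong) (auto simp: ip)
      then show ?thesis using True by (simp add: c dd_def inner_tens)
    next
      case False
      have "(\<Prod>k<d. inI (((\<lambda>k. \<psi> (\<nu> k))(j := \<psi>' (\<nu> j))) k) (((\<lambda>k. \<psi> (\<mu> k))(i := \<psi>' (\<mu> i))) k))
          = - (\<Prod>k<d. inner (((\<lambda>k. unit_vec (\<mu> k))(i := r (\<mu> i), j := r (\<mu> j))) k) (unit_vec (\<nu> k)))"
        by (rule prod_eq_uminus_at[where l = j]) (use False j in \<open>auto simp: ip\<close>)
      then show ?thesis using False by (simp add: c dd_def inner_tens)
    qed
  qed
  have "matrix_T d \<psi> M \<mu> \<nu> = (\<Sum>i<d. \<Sum>j<d. M i j * - coord (dd d r q i j \<mu>) \<nu>)"
    unfolding matrix_T_eq[where \<psi>' = \<psi>', OF wd] by (intro sum.cong refl arg_cong2[where f = times] entry) auto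
  then show ?thesis by (simp add: tvec_def coord_sum sum_negf)
qed

lemma imat_mult_S_inv2:
  assumes "\<mu> \<in> J"
  shows "imat_mult J (matrix_S_inv2 d w) A \<mu> \<nu> = inverse ((omega d w \<mu>)\<^sup>2) * A \<mu> \<nu>"
proof -
  have "imat_mult J (matrix_S_inv2 d w) A \<mu> \<nu> = (\<Sum>\<^sub>\<infinity>\<kappa>\<in>{\<mu>}. inverse ((omega d w \<mu>)\<^sup>2) * A \<mu> \<nu>)"
    unfolding imat_mult_def by (rule infsum_cong_neutral) (use assms in \<open>auto simp: matrix_S_inv2_def\<close>)
  then show ?thesis by simp
qed

text \<open>\<open>W\<close> is the weight in which the bounds for the stiffness vectors are
  natural. Its comparison with the squared scaling is the only source of \<open>\<alpha>\<close> and
  \<open>\<beta>\<close>, so the constants stay free of \<open>d\<close> whenever the inputs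
  are.\<close>

lemma (in second_order_system) scaled_stiffness_isomorphism:
  assumes onb: "onb_ivl \<psi>" and wd: "\<And>\<nu>. wd (\<psi> \<nu>) (\<psi>' \<nu>)" and r: "\<And>\<nu>. r \<nu> = coef \<psi> (\<psi>' \<nu>)"
    and d: "1 \<le> d" and M: "sym_pos_def d M"
    and W: "\<And>\<nu>. 0 < W \<nu>" and \<alpha>: "0 < \<alpha>" and \<beta>: "0 < \<beta>"
    and equiv: "\<And>\<nu>. \<alpha> * W \<nu> \<le> (omega d w \<nu>)\<^sup>2 \<and> (omega d w \<nu>)\<^sup>2 \<le> \<beta> * W \<nu>"
    and clow: "0 < clow" and cupp: "0 \<le> cupp"
    and lower: "\<And>G v. finite G \<Longrightarrow> G \<subseteq> multi_idx d \<Longrightarrow>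
      clow\<^sup>2 * (\<Sum>\<nu>\<in>G. (W \<nu> * v \<nu>)\<^sup>2) \<le> (norm (\<Sum>\<nu>\<in>G. v \<nu> *\<^sub>R tvec d r q M \<nu>))\<^sup>2"
    and upper: "\<And>G v. finite G \<Longrightarrow> G \<subseteq> multi_idx d \<Longrightarrow>
      (norm (\<Sum>\<nu>\<in>G. v \<nu> *\<^sub>R tvec d r q M \<nu>))\<^sup>2 \<le> cupp\<^sup>2 * (\<Sum>\<nu>\<in>G. (W \<nu> * v \<nu>)\<^sup>2)"
  defines "A \<equiv> imat_mult (multi_idx d) (matrix_S_inv2 d w) (matrix_T d \<psi> M)"
  shows "l2_isomorphism (multi_idx d) A"
    and "l2_bounds (multi_idx d) A (min 1 (clow / \<beta>)) (max 1 (cupp / \<alpha>))"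
proof -
  let ?J = "multi_idx d :: (nat \<Rightarrow> 'i) set"
  define \<Omega> where "\<Omega> \<nu> = (omega d w \<nu>)\<^sup>2" for \<nu>
  obtain \<gamma> where \<gamma>: "0 < \<gamma>" "\<And>y :: nat \<Rightarrow> real. \<gamma> * (\<Sum>i<d. (y i)\<^sup>2) \<le> (\<Sum>i<d. \<Sum>j<d. y i * M i j * y j)"
    using sym_pos_def_coercive[OF M] by blast
  have eq: "\<alpha> * W \<nu> \<le> \<Omega> \<nu>" "\<Omega> \<nu> \<le> \<beta> * W \<nu>" for \<nu> using equiv by (simp_all add: \<Omega>_def)
  have \<Omega>: "0 < \<Omega> \<nu>" for \<nu> using less_le_trans[OF mult_pos_pos[OF \<alpha> W] eq(1)] .
  have sum_le: "(\<Sum>\<nu>\<in>G. (f \<nu> * v \<nu>)\<^sup>2) \<le> b\<^sup>2 * (\<Sum>\<nu>\<in>G. (g \<nu> * v \<nu>)\<^sup>2)"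
    if "\<And>\<nu>. 0 \<le> f \<nu>" "\<And>\<nu>. f \<nu> \<le> b * g \<nu>" for f g v :: "(nat \<Rightarrow> 'i) \<Rightarrow> real" and b G
  proof -
    have "(f \<nu> * v \<nu>)\<^sup>2 \<le> b\<^sup>2 * (g \<nu> * v \<nu>)\<^sup>2" for \<nu>
      using mult_right_mono[OF power_mono[OF that(2) that(1), of \<nu> 2], of "(v \<nu>)\<^sup>2"]
      by (simp add: power_mult_distrib mult.assoc)
    then show ?thesis by (simp add: sum_distrib_left sum_mono)
  qed
  have rf: "riesz_family (\<lambda>\<nu>. if \<nu> \<in> ?J then inverse (\<Omega> \<nu>) *\<^sub>R tvec d r q M \<nu> else unit_vec \<nu>)
      (min 1 (clow / \<beta>)) (max 1 (cupp / \<alpha>))"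
  proof (rule extended_riesz_family)
    fix G :: "(nat \<Rightarrow> 'i) set" and v assume G: "finite G" "G \<subseteq> ?J"
    have "(min 1 (clow / \<beta>))\<^sup>2 * (\<Sum>\<nu>\<in>G. (\<Omega> \<nu> * v \<nu>)\<^sup>2) \<le> (clow / \<beta>)\<^sup>2 * (\<Sum>\<nu>\<in>G. (\<Omega> \<nu> * v \<nu>)\<^sup>2)"
      using clow \<beta> by (intro mult_right_mono power_mono sum_nonneg) auto
    also have "\<dots> \<le> (clow / \<beta>)\<^sup>2 * (\<beta>\<^sup>2 * (\<Sum>\<nu>\<in>G. (W \<nu> * v \<nu>)\<^sup>2))"
      using eq(2) \<Omega> by (intro mult_left_mono sum_le) (auto intro: less_imp_le)
    also have "\<dots> = clow\<^sup>2 * (\<Sum>\<nu>\<in>G. (W \<nu> * v \<nu>)\<^sup>2)" using \<beta> by (simp add: power_divide)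
    also have "\<dots> \<le> (norm (\<Sum>\<nu>\<in>G. v \<nu> *\<^sub>R tvec d r q M \<nu>))\<^sup>2" by (rule lower[OF G])
    finally show "(min 1 (clow / \<beta>))\<^sup>2 * (\<Sum>\<nu>\<in>G. (\<Omega> \<nu> * v \<nu>)\<^sup>2) \<le> (norm (\<Sum>\<nu>\<in>G. v \<nu> *\<^sub>R tvec d r q M \<nu>))\<^sup>2" .
    have W': "W \<nu> \<le> inverse \<alpha> * \<Omega> \<nu>" for \<nu> using eq(1)[of \<nu>] \<alpha> by (simp add: field_simps)
    have "(norm (\<Sum>\<nu>\<in>G. v \<nu> *\<^sub>R tvec d r q M \<nu>))\<^sup>2 \<le> cupp\<^sup>2 * (\<Sum>\<nu>\<in>G. (W \<nu> * v \<nu>)\<^sup>2)" by (rule upper[OF G])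
    also have "\<dots> \<le> cupp\<^sup>2 * ((inverse \<alpha>)\<^sup>2 * (\<Sum>\<nu>\<in>G. (\<Omega> \<nu> * v \<nu>)\<^sup>2))"
      using W' W by (intro mult_left_mono sum_le) (auto intro: less_imp_le)
    also have "\<dots> = (cupp / \<alpha>)\<^sup>2 * (\<Sum>\<nu>\<in>G. (\<Omega> \<nu> * v \<nu>)\<^sup>2)" by (simp add: power_mult_distrib divide_inverse)
    also have "\<dots> \<le> (max 1 (cupp / \<alpha>))\<^sup>2 * (\<Sum>\<nu>\<in>G. (\<Omega> \<nu> * v \<nu>)\<^sup>2)"
      using cupp \<alpha> by (intro mult_right_mono power_mono sum_nonneg) auto
    finally show "(norm (\<Sum>\<nu>\<in>G. v \<nu> *\<^sub>R tvec d r q M \<nu>))\<^sup>2 \<le> (max 1 (cupp / \<alpha>))\<^sup>2 * (\<Sum>\<nu>\<in>G. (\<Omega> \<nu> * v \<nu>)\<^sup>2)" .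
  next
    show "w = 0" if "\<And>\<nu>. \<nu> \<in> ?J \<Longrightarrow> inner (tvec d r q M \<nu>) w = 0" "\<And>\<nu>. \<nu> \<notin> ?J \<Longrightarrow> coord w \<nu> = 0" for w
      by (rule general_total[OF d \<gamma> that])
  qed (use clow \<beta> \<Omega> in \<open>auto simp: coord_tvec_out\<close>)
  have A: "A \<mu> \<nu> = inverse (\<Omega> \<mu>) * coord (tvec d r q M \<mu>) \<nu>" if "\<mu> \<in> ?J" "\<nu> \<in> ?J" for \<mu> \<nu>
    unfolding A_def imat_mult_S_inv2[OF that(1)] \<Omega>_def
    by (simp add: coord_tvec_eq_matrix_T[where \<psi>' = \<psi>', OF onb wd r that(2)])
  show "l2_isomorphism ?J A" by (rule l2_isomorphism_of_riesz_family(1)[OF rf A])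
  show "l2_bounds ?J A (min 1 (clow / \<beta>)) (max 1 (cupp / \<alpha>))" by (rule l2_isomorphism_of_riesz_family(2)[OF rf A])
qed

lemma omega_sq_bounds:
  assumes k: "0 < k" "0 < K" and W: "\<And>i. i < d \<Longrightarrow> 0 \<le> W i"
    and w: "\<And>i. i < d \<Longrightarrow> k * W i \<le> w i (\<nu> i) \<and> w i (\<nu> i) \<le> K * W i"
  shows "k\<^sup>2 * (\<Sum>i<d. (W i)\<^sup>2) \<le> (omega d w \<nu>)\<^sup>2 \<and> (omega d w \<nu>)\<^sup>2 \<le> K\<^sup>2 * (\<Sum>i<d. (W i)\<^sup>2)"
proof -
  have "(omega d w \<nu>)\<^sup>2 = (\<Sum>i<d. (w i (\<nu> i))\<^sup>2)" unfolding omega_def by (simp add: sum_nonneg)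
  moreover have "(\<Sum>i<d. (k * W i)\<^sup>2) \<le> (\<Sum>i<d. (w i (\<nu> i))\<^sup>2)"
    using k W w by (intro sum_mono power_mono) auto
  moreover have "(\<Sum>i<d. (w i (\<nu> i))\<^sup>2) \<le> (\<Sum>i<d. (K * W i)\<^sup>2)"
  proof (intro sum_mono power_mono)
    fix i assume "i \<in> {..<d}"
    then have i: "i < d" by simp
    have "0 \<le> k * W i" using k W[OF i] by simp
    then show "w i (\<nu> i) \<le> K * W i" "0 \<le> w i (\<nu> i)" using w[OF i] by linarith+
  qed
  ultimately show ?thesis by (simp add: power_mult_distrib sum_distrib_left)
qed

theorem theorem2p1:
  fixes \<psi> :: "'i::countable \<Rightarrow> real \<Rightarrow> real"
    and lev :: "'i \<Rightarrow> nat"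
  assumes onb: "orthonormal_basis_L2 unit_ivl \<psi>"
    and riesz: "riesz_basis (H2_ivl \<inter> H10_ivl) H2_nrm
                  (\<lambda>\<nu> x. inverse (2 ^ (2 * lev \<nu>)) * \<psi> \<nu> x)"
  shows
    "(\<forall>(d::nat) (M :: nat \<Rightarrow> nat \<Rightarrow> real) (w :: nat \<Rightarrow> 'i \<Rightarrow> real).
        1 \<le> d \<and> sym_pos_def d M \<and> diag_dominant d M \<and>
        (\<forall>i<d. \<forall>\<nu>. 0 < w i \<nu>) \<and>
        unif_equiv ({..<d} \<times> UNIV) (\<lambda>(i, \<nu>). w i \<nu>) (\<lambda>(i, \<nu>). 2 ^ lev \<nu>)
        \<longrightarrow> l2_isomorphism (multi_idx d)
              (imat_mult (multi_idx d) (matrix_S_inv2 d w) (matrix_T d \<psi> M)))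
     \<and>
     (\<forall>(M :: nat \<Rightarrow> nat \<Rightarrow> nat \<Rightarrow> real) (w :: nat \<Rightarrow> nat \<Rightarrow> 'i \<Rightarrow> real).
        (\<forall>d\<ge>1. sym_pos_def d (M d) \<and> diag_dominant d (M d) \<and> is_diagonal d (M d) \<and>
                (\<forall>i<d. \<forall>\<nu>. 0 < w d i \<nu>)) \<and>
        unif_equiv {(d, i, \<nu>). 1 \<le> d \<and> i < d}
          (\<lambda>(d, i, \<nu>). w d i \<nu>) (\<lambda>(d, i, \<nu>). sqrt (M d i i) * 2 ^ lev \<nu>)
        \<longrightarrow> (\<exists>c C. 0 < c \<and> c \<le> C \<and>
              (\<forall>d\<ge>1. l2_bounds (multi_idx d)
                (imat_mult (multi_idx d) (matrix_S_inv2 d (w d)) (matrix_T d \<psi> (M d))) c C)))"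
proof -
  have onb': "onb_ivl \<psi>" using onb by (rule onb_ivl.intro)
  obtain \<psi>' q s \<kappa> c C where wd: "\<And>\<nu>. wd (\<psi> \<nu>) (\<psi>' \<nu>)"
    and sys: "second_order_system (\<lambda>\<nu>. coef \<psi> (\<psi>' \<nu>)) q (\<lambda>\<nu>. 2 ^ (2 * lev \<nu>)) c C s \<kappa>"
    by (rule onb_ivl.second_order_system_of_riesz_basis[OF onb' riesz]) (rule that)
  define r where "r \<nu> = coef \<psi> (\<psi>' \<nu>)" for \<nu>
  define l :: "'i \<Rightarrow> real" where "l \<nu> = 2 ^ (2 * lev \<nu>)" for \<nu>
  interpret second_order_system r q l c C s \<kappa>
    using sys by (simp add: r_def[abs_def] l_def[abs_def])
  \<comment> \<open>The scaling matrix contains the squares of the weights, so 2^|\<nu>| turns into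
    the second-order weight \<open>l\<close>.\<close>
  have l_sq: "(2 ^ lev \<nu>)\<^sup>2 = l \<nu>" for \<nu> by (simp add: l_def power_mult[symmetric] mult.commute)
  show ?thesis
  proof (intro conjI allI impI; elim conjE)
    fix d :: nat and M :: "nat \<Rightarrow> nat \<Rightarrow> real" and w :: "nat \<Rightarrow> 'i \<Rightarrow> real"
    assume d: "1 \<le> d" and M: "sym_pos_def d M"
      and w: "unif_equiv ({..<d} \<times> UNIV) (\<lambda>(i, \<nu>). w i \<nu>) (\<lambda>(i, \<nu>). 2 ^ lev \<nu>)"
    obtain k K where k: "0 < k" "0 < K"
      "\<And>i \<nu>. i < d \<Longrightarrow> k * 2 ^ lev \<nu> \<le> w i \<nu> \<and> w i \<nu> \<le> K * 2 ^ lev \<nu>"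
      using w unfolding unif_equiv_def by auto
    obtain \<gamma> where \<gamma>: "0 < \<gamma>" "\<And>y :: nat \<Rightarrow> real. \<gamma> * (\<Sum>i<d. (y i)\<^sup>2) \<le> (\<Sum>i<d. \<Sum>j<d. y i * M i j * y j)"
      using sym_pos_def_coercive[OF M] by blast
    show "l2_isomorphism (multi_idx d) (imat_mult (multi_idx d) (matrix_S_inv2 d w) (matrix_T d \<psi> M))"
    proof (rule scaled_stiffness_isomorphism(1)[where \<psi>' = \<psi>' and clow = "\<gamma> * c"
          and cupp = "(\<Sum>i<d. \<Sum>j<d. \<bar>M i j\<bar>) * C", OF onb' wd r_def d M multi_weight_pos[OF d] _ _ _ _ _
          general_bounds[OF \<gamma>]])
      show "k\<^sup>2 * (\<Sum>i<d. l (\<nu> i)) \<le> (omega d w \<nu>)\<^sup>2 \<and> (omega d w \<nu>)\<^sup>2 \<le> K\<^sup>2 * (\<Sum>i<d. l (\<nu> i))" for \<nu>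
        using omega_sq_bounds[of k K d "\<lambda>i. 2 ^ lev (\<nu> i)" w \<nu>] k by (simp add: l_sq)
      show "0 \<le> (\<Sum>i<d. \<Sum>j<d. \<bar>M i j\<bar>) * C" using C_pos by (intro mult_nonneg_nonneg sum_nonneg) auto
    qed (use k \<gamma>(1) c_pos in auto)
  next
    fix M :: "nat \<Rightarrow> nat \<Rightarrow> nat \<Rightarrow> real" and w :: "nat \<Rightarrow> nat \<Rightarrow> 'i \<Rightarrow> real"
    assume M: "\<forall>d\<ge>1. sym_pos_def d (M d) \<and> diag_dominant d (M d) \<and> is_diagonal d (M d) \<and> (\<forall>i<d. \<forall>\<nu>. 0 < w d i \<nu>)"
      and w: "unif_equiv {(d, i, \<nu>). 1 \<le> d \<and> i < d}
          (\<lambda>(d, i, \<nu>). w d i \<nu>) (\<lambda>(d, i, \<nu>). sqrt (M d i i) * 2 ^ lev \<nu>)"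
    obtain k K where k: "0 < k" "0 < K" "\<And>d i \<nu>. 1 \<le> d \<Longrightarrow> i < d \<Longrightarrow>
        k * (sqrt (M d i i) * 2 ^ lev \<nu>) \<le> w d i \<nu> \<and> w d i \<nu> \<le> K * (sqrt (M d i i) * 2 ^ lev \<nu>)"
      using w unfolding unif_equiv_def by auto
    show "\<exists>c C. 0 < c \<and> c \<le> C \<and> (\<forall>d\<ge>1. l2_bounds (multi_idx d)
        (imat_mult (multi_idx d) (matrix_S_inv2 d (w d)) (matrix_T d \<psi> (M d))) c C)"
    \<comment> \<open>\<open>c\<close> and \<open>C\<close> come from the univariate basis and
      \<open>k\<close> and \<open>K\<close> from the uniform equivalence, so the witnesses can be
      fixed before \<open>d\<close>.\<close>
    proof (rule exI[of _ "min 1 (c / K\<^sup>2)"], rule exI[of _ "max 1 (C / k\<^sup>2)"], intro conjI allI impI)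
      show "0 < min 1 (c / K\<^sup>2)" using c_pos k by simp
      show "min 1 (c / K\<^sup>2) \<le> max 1 (C / k\<^sup>2)" by simp
      fix d :: nat assume d: "1 \<le> d"
      then have Md: "sym_pos_def d (M d)" "is_diagonal d (M d)" using M by auto
      \<comment> \<open>Positive definiteness tested on a coordinate vector; it gives nonnegative
        coefficients and makes the square of \<open>sqrt (M d i i)\<close> equal to
        \<open>M d i i\<close>.\<close>
      have pos: "0 < M d i i" if i: "i < d" for i
      proof -
        define x where "x j = (if j = i then 1 else 0 :: real)" for j
        have "0 < (\<Sum>a<d. \<Sum>b<d. x a * M d a b * x b)"
          using Md(1) i unfolding sym_pos_def_def by (auto simp: x_def intro!: exI[of _ i])
        also have "\<dots> = M d i i"
          using i by (simp add: x_def if_distrib[of "\<lambda>z. z * _"] if_distrib[of "\<lambda>z. _ * z"] cong: if_cong)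
        finally show ?thesis .
      qed
      define W where "W \<nu> = (\<Sum>i<d. M d i i * l (\<nu> i))" for \<nu>
      show "l2_bounds (multi_idx d) (imat_mult (multi_idx d) (matrix_S_inv2 d (w d)) (matrix_T d \<psi> (M d)))
          (min 1 (c / K\<^sup>2)) (max 1 (C / k\<^sup>2))"
      proof (rule scaled_stiffness_isomorphism(2)[where \<psi>' = \<psi>' and W = W, OF onb' wd r_def d Md(1) _ _ _ _ _ _
            diagonal_bounds[OF Md(2), folded W_def]])
        show "0 < W \<nu>" for \<nu>
          unfolding W_def using d by (intro sum_pos mult_pos_pos pos l_pos) (auto simp: lessThan_empty_iff)
        show "k\<^sup>2 * W \<nu> \<le> (omega d (w d) \<nu>)\<^sup>2 \<and> (omega d (w d) \<nu>)\<^sup>2 \<le> K\<^sup>2 * W \<nu>" for \<nu>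
        proof -
          have "(\<Sum>i<d. (sqrt (M d i i) * 2 ^ lev (\<nu> i))\<^sup>2) = W \<nu>"
            unfolding W_def using pos by (intro sum.cong refl) (simp add: power_mult_distrib l_sq less_imp_le)
          then show ?thesis
            using omega_sq_bounds[of k K d "\<lambda>i. sqrt (M d i i) * 2 ^ lev (\<nu> i)" "w d" \<nu>] k(1,2) k(3)[OF d] pos
            by (simp add: less_imp_le)
        qed
      qed (use k c_pos C_pos pos in \<open>simp_all add: less_imp_le\<close>)
    qed
  qed
qed

end
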